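(* Let $X$ be an $r$-dimensional simplicial complex with $r\ge 2$, let $\beta_r(X)=\dim \widetilde{H}_r(X;\mathbb{R})$, and let $q$ be a positive integer. Then $$\sum_{i=1}^{q}\lambda_{r-1,i}(X)=\sum_{i=1}^{q}d_{r-1,i}^{\top}(X)$$ if and only if $$q\ge \max\left\{f_r(X)-\beta_r(X),\ \Delta_{r-1}(X)\right\}.$$
   Context: A simplicial complex $X$ on a finite set $V$ is a collection of subsets of $V$ closed under taking subsets, with $\emptyset\in X$. A $k$-simplex is an element of $X$ of cardinality $k+1$; $X(k)$ is the set of $k$-simplices and $f_k(X)=|X(k)|$. The dimension of $X$ is the maximum dimension of its simplices; here it is $r$. Each simplex is given a fixed orientation (a linear ordering of its vertices). $C_k(X,\mathbb R)$ is the real vector space with basis the oriented $k$-simplices, and the boundary map $\partial_k(X):C_k(X,\mathbb R)\to C_{k-1}(X,\mathbb R)$ is the linear map sending $\sigma=[v_0,\dots,v_k]$ to $\sum_{j=0}^{k}(-1)^j[v_0,\dots,\widehat{v_j},\dots,v_k]$. The $k$-th reduced homology group is $\widetilde H_k(X;\mathbb R)=\ker\partial_k(X)/\operatorname{im}\partial_{k+1}(X)$ (with $C_{r+1}(X,\mathbb R)=0$). For $\sigma\in X(r)$ and $\tau\in X(r-1)$, the incidence sign $(\sigma:\tau)\in\{1,-1,0\}$ is the coefficient of the oriented simplex $\tau$ in $\partial_r(X)\sigma$: it is $1$ if $\tau\subset\sigma$ and the orientation of $\tau$ agrees with the one induced by $\sigma$, $-1$ if $\tau\subset\sigma$ and it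 is opposite, and $0$ if $\tau\not\subset\sigma$. $B_r(X)$ is the real matrix with rows indexed by $X(r-1)$, columns indexed by $X(r)$, and $(\tau,\sigma)$-entry $(\sigma:\tau)$. The $(r-1)$-dimensional up-Laplacian is $L_{r-1}^{\mathrm{up}}(X)=B_r(X)B_r(X)^{\top}$, a real symmetric positive semidefinite matrix indexed by $X(r-1)$. Its eigenvalues, with multiplicity and in weakly decreasing order, are $\lambda_{r-1,1}(X)\ge\lambda_{r-1,2}(X)\ge\cdots$; the sequence is padded with zeros beyond its length. For $\tau\in X(r-1)$, $\deg_{r-1}(X;\tau)=|\{F\in X(r):\tau\subseteq F\}|$. The conjugate $(r-1)$-degree sequence is given by $d_{r-1,j}^{\top}(X)=|\{\tau\in X(r-1):\deg_{r-1}(X;\tau)\ge j\}|$ for $j\ge1$. Finally, $\Delta_{r-1}(X)=\max_{\tau\in X(r-1)}\deg_{r-1}(X;\tau)$. *)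

theory Defs
  imports
    "HOL-Analysis.Finite_Function_Topology"
    "HOL-Algebra.QuotRing"
    "HOL-Combinatorics.Permutations"
    "HOL-Library.Countable_Set"
    "Jordan_Normal_Form.VS_Connect"
    "Jordan_Normal_Form.Char_Poly"
begin

hide_const (open) Multiset.mult Polynomial.smult

definition simplicial_complex :: "'a set \<Rightarrow> 'a set set \<Rightarrow> bool" where
  "simplicial_complex V X \<longleftrightarrow>
     finite V \<and> X \<subseteq> Pow V \<and> {} \<in> X \<and> (\<forall>\<sigma>\<in>X. \<forall>\<tau>. \<tau> \<subseteq> \<sigma> \<longrightarrow> \<tau> \<in> X)"

text \<open>Dimensions are integers: the empty simplex has dimension \<open>-1\<close>, so the chain complex
  below is the augmented one and its homology is reduced homology.\<close>

definition simplices :: "'a set set \<Rightarrow> int \<Rightarrow> 'a set set" where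
  "simplices X k = {\<sigma>\<in>X. int (card \<sigma>) = k + 1}"

definition face_count :: "'a set set \<Rightarrow> int \<Rightarrow> nat" where
  "face_count X k = card (simplices X k)"

definition complex_dim :: "'a set set \<Rightarrow> int" where
  "complex_dim X = Max ((\<lambda>\<sigma>. int (card \<sigma>) - 1) ` X)"

definition orientation :: "'a set set \<Rightarrow> ('a set \<Rightarrow> 'a list) \<Rightarrow> bool" where
  "orientation X ori \<longleftrightarrow> (\<forall>\<sigma>\<in>X. distinct (ori \<sigma>) \<and> set (ori \<sigma>) = \<sigma>)"

text \<open>The sign of the permutation that turns the ordering \<open>xs\<close> into the ordering \<open>ys\<close>
  of the same vertices.\<close>

definition ordering_sign :: "'a list \<Rightarrow> 'a list \<Rightarrow> int" where
  "ordering_sign xs ys = sign (THE p. p permutes set xs \<and> map p xs = ys)"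

text \<open>The basis vector \<open>single \<sigma> 1\<close> stands for \<open>\<sigma>\<close> with its fixed orientation \<open>ori \<sigma>\<close>.
  The simplex \<open>[v\<^sub>0, \<dots>, v\<^sub>k]\<close> given by another ordering is that vector or its negative.\<close>

definition oriented_simplex :: "('a set \<Rightarrow> 'a list) \<Rightarrow> 'a list \<Rightarrow> ('a set \<Rightarrow>\<^sub>0 real)" where
  "oriented_simplex ori vs =
     Poly_Mapping.single (set vs) (of_int (ordering_sign vs (ori (set vs))))"

definition chains :: "'a set set \<Rightarrow> int \<Rightarrow> ('a set \<Rightarrow>\<^sub>0 real) set" where
  "chains X k = {c. Poly_Mapping.keys c \<subseteq> simplices X k}"

definition boundary_simplex :: "('a set \<Rightarrow> 'a list) \<Rightarrow> 'a set \<Rightarrow> ('a set \<Rightarrow>\<^sub>0 real)" where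
  "boundary_simplex ori \<sigma> =
     (\<Sum>j<length (ori \<sigma>).
        (-1) ^ j *\<^sub>R oriented_simplex ori (take j (ori \<sigma>) @ drop (Suc j) (ori \<sigma>)))"

definition boundary :: "('a set \<Rightarrow> 'a list) \<Rightarrow> ('a set \<Rightarrow>\<^sub>0 real) \<Rightarrow> ('a set \<Rightarrow>\<^sub>0 real)" where
  "boundary ori c =
     (\<Sum>\<sigma>\<in>Poly_Mapping.keys c. Poly_Mapping.lookup c \<sigma> *\<^sub>R boundary_simplex ori \<sigma>)"

definition cycles :: "'a set set \<Rightarrow> ('a set \<Rightarrow> 'a list) \<Rightarrow> int \<Rightarrow> ('a set \<Rightarrow>\<^sub>0 real) set" where
  "cycles X ori k = {c \<in> chains X k. boundary ori c = 0}"

definition boundaries :: "'a set set \<Rightarrow> ('a set \<Rightarrow> 'a list) \<Rightarrow> int \<Rightarrow> ('a set \<Rightarrow>\<^sub>0 real) set" where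
  "boundaries X ori k = boundary ori ` chains X (k + 1)"

definition subspace_module :: "'b::real_vector set \<Rightarrow> (real, 'b) module" where
  "subspace_module S =
     \<lparr>carrier = S, mult = undefined, one = undefined, zero = 0, add = (+), smult = (*\<^sub>R)\<rparr>"

text \<open>The quotient of a module by a submodule, as a module of cosets. The multiplicative
  fields of the record are not used.\<close>

definition quotient_module :: "('r, 'b) module \<Rightarrow> 'b set \<Rightarrow> ('r, 'b set) module" where
  "quotient_module M N =
     \<lparr>carrier = a_rcosets\<^bsub>M\<^esub> N, mult = undefined, one = undefined, zero = N,
      add = set_add M,
      smult = (\<lambda>a C. \<Union>x\<in>C. N +>\<^bsub>M\<^esub> (a \<odot>\<^bsub>M\<^esub> x))\<rparr>"

definition reduced_homology ::
  "'a set set \<Rightarrow> ('a set \<Rightarrow> 'a list) \<Rightarrow> int \<Rightarrow> (real, ('a set \<Rightarrow>\<^sub>0 real) set) module" where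
  "reduced_homology X ori k =
     quotient_module (subspace_module (cycles X ori k)) (boundaries X ori k)"

definition betti :: "'a set set \<Rightarrow> ('a set \<Rightarrow> 'a list) \<Rightarrow> int \<Rightarrow> nat" where
  "betti X ori k = vectorspace.dim (class_ring :: real ring) (reduced_homology X ori k)"

definition incidence :: "('a set \<Rightarrow> 'a list) \<Rightarrow> 'a set \<Rightarrow> 'a set \<Rightarrow> real" where
  "incidence ori \<sigma> \<tau> = Poly_Mapping.lookup (boundary_simplex ori \<sigma>) \<tau>"

text \<open>For finite \<open>S\<close>, \<open>from_nat_into S\<close> enumerates \<open>S\<close> by \<open>{..<card S}\<close>; rows
  (\<open>(k - 1)\<close>-simplices) and columns (\<open>k\<close>-simplices) are indexed in this way.\<close>

definition boundary_matrix :: "'a set set \<Rightarrow> ('a set \<Rightarrow> 'a list) \<Rightarrow> int \<Rightarrow> real mat" where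
  "boundary_matrix X ori k =
     mat (face_count X (k - 1)) (face_count X k)
       (\<lambda>(i, j). incidence ori (from_nat_into (simplices X k) j)
                               (from_nat_into (simplices X (k - 1)) i))"

definition up_laplacian :: "'a set set \<Rightarrow> ('a set \<Rightarrow> 'a list) \<Rightarrow> int \<Rightarrow> real mat" where
  "up_laplacian X ori k =
     boundary_matrix X ori (k + 1) * transpose_mat (boundary_matrix X ori (k + 1))"

text \<open>The roots of the characteristic polynomial with multiplicity, in weakly decreasing order.
  For a real symmetric matrix these are all of its eigenvalues.\<close>

definition eigenvalues_desc :: "real mat \<Rightarrow> real list" where
  "eigenvalues_desc A = rev (sorted_list_of_multiset (proots (char_poly A)))"

text \<open>Indices start at 1, and the sequence is padded with zeros.\<close>

definition laplacian_eigenvalue ::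
  "'a set set \<Rightarrow> ('a set \<Rightarrow> 'a list) \<Rightarrow> int \<Rightarrow> nat \<Rightarrow> real" where
  "laplacian_eigenvalue X ori k i =
     (let es = eigenvalues_desc (up_laplacian X ori k)
      in if 1 \<le> i \<and> i \<le> length es then es ! (i - 1) else 0)"

definition up_degree :: "'a set set \<Rightarrow> int \<Rightarrow> 'a set \<Rightarrow> nat" where
  "up_degree X k \<tau> = card {F \<in> simplices X (k + 1). \<tau> \<subseteq> F}"

definition conj_degree :: "'a set set \<Rightarrow> int \<Rightarrow> nat \<Rightarrow> nat" where
  "conj_degree X k j = card {\<tau> \<in> simplices X k. j \<le> up_degree X k \<tau>}"

definition max_up_degree :: "'a set set \<Rightarrow> int \<Rightarrow> nat" where
  "max_up_degree X k = Max (up_degree X k ` simplices X k)"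

end

theory Submission
  imports Defs
begin

text \<open>
Let \<open>B\<close> be the boundary matrix from facets (\<open>r\<close>-simplices) to ridges (\<open>(r-1)\<close>-simplices), with rows
\<open>b t\<close> indexed by the ridges \<open>t\<close>. Both sums are partial sums of sequences with the same total: the
trace of \<open>B B\<^sup>T\<close> is the sum of the ridge degrees. The conjugate degree sum is the sum of
\<open>min q (deg t)\<close> over the ridges, so it has reached the total iff \<open>q\<close> is at least every degree; the
eigenvalue sum has reached it iff \<open>q\<close> is at least the rank of \<open>B\<close>, which is \<open>f_r - \<beta>_r\<close> because
there are no boundaries in dimension \<open>r\<close>. This settles every case except \<open>q < deg t\<close> for some ridge
\<open>t\<close>, and there the eigenvalue sum is strictly smaller (\<open>signed_trace_strict\<close>).

For the strict inequality, the top \<open>q\<close> eigenvalues are written on the side of the facets: with the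
right singular vectors \<open>y\<close> their sum is the sum of the squares of the products of the rows \<open>b t\<close>
with the \<open>y k\<close>. Every ridge contains exactly \<open>r\<close> faces \<open>p\<close> of codimension one, so this double
sum is \<open>1/r\<close> times the sum, over all \<open>p\<close>, of the same expression for the ridges above \<open>p\<close>. After
a change of signs those rows form the incidence matrix of a graph, the link of \<open>p\<close>, whose vertices
are the ridges and whose edges are the facets above \<open>p\<close>. For a graph with a vertex set \<open>H\<close>
the Grone--Merris inequality (Bai's theorem) bounds the expression by \<open>card H * s\<close> plus the degrees
outside \<open>H\<close>, where \<open>s \<le> q\<close> is the mass that the \<open>y k\<close> put on the edges
(\<open>graph_edge_trace_le\<close>). With \<open>H\<close> the vertices of degree more than \<open>q\<close>, averaging gives the weak
inequality, and equality would force all the mass onto the facets above every \<open>p\<close> inside a ridge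
\<open>t\<close> of degree more than \<open>q\<close>. As \<open>r \<ge> 2\<close>, these are the facets above \<open>t\<close>, and on that star a
direct estimate gives a strictly smaller value (\<open>star_trace_strict\<close>).

The Grone--Merris inequality is reduced, as in Bai's proof, to a split graph: a clique \<open>H\<close>, an
independent set \<open>W\<close>, and some edges between them. There the point is that any \<open>card H\<close>
orthonormal eigenvectors \<open>u i\<close> orthogonal to the constants have eigenvalue sum at most
\<open>(card H)\<^sup>2\<close> plus the number of edges between \<open>H\<close> and \<open>W\<close> (\<open>split_eigenvalue_sum_le\<close>). This
is proved by an extremal choice: among all maps \<open>f\<close> from \<open>H\<close> to \<open>W\<close>, take one for which the
determinant with entries \<open>u i h - u i (f h)\<close> is largest in absolute value. The Laplacian maps the
span of the vectors \<open>e_h - e_(f h)\<close> to itself up to nonnegative combinations of vectors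
\<open>e_(f h) - e_w\<close>, and by maximality these can only lower the trace.
\<close>

section \<open>Orthonormal families and symmetric operators\<close>

definition ip :: "'s set \<Rightarrow> ('s \<Rightarrow> real) \<Rightarrow> ('s \<Rightarrow> real) \<Rightarrow> real" where
  "ip S x y = (\<Sum>s\<in>S. x s * y s)"

definition orthonormal_on :: "'s set \<Rightarrow> 'i set \<Rightarrow> ('i \<Rightarrow> 's \<Rightarrow> real) \<Rightarrow> bool" where
  "orthonormal_on S I u \<longleftrightarrow> (\<forall>i\<in>I. \<forall>j\<in>I. ip S (u i) (u j) = (if i = j then 1 else 0))"

lemma orthonormal_onD: "orthonormal_on S I u \<Longrightarrow> i \<in> I \<Longrightarrow> j \<in> I \<Longrightarrow> ip S (u i) (u j) = (if i = j then 1 else 0)"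
  by (simp add: orthonormal_on_def)

lemma orthonormal_on_subset: "orthonormal_on S I u \<Longrightarrow> J \<subseteq> I \<Longrightarrow> orthonormal_on S J u"
  unfolding orthonormal_on_def by blast

lemma ip_commute: "ip S x y = ip S y x"
  by (simp add: ip_def mult.commute)

lemma ip_add_left: "ip S (\<lambda>s. x s + y s) z = ip S x z + ip S y z"
  by (simp add: ip_def sum.distrib algebra_simps)

lemma ip_diff_left: "ip S (\<lambda>s. x s - y s) z = ip S x z - ip S y z"
  by (simp add: ip_def sum_subtractf algebra_simps)

lemma ip_scale_left: "ip S (\<lambda>s. c * x s) z = c * ip S x z"
  by (simp add: ip_def sum_distrib_left mult.assoc)

lemma ip_sum_left: "ip S (\<lambda>s. \<Sum>i\<in>I. c i * u i s) z = (\<Sum>i\<in>I. c i * ip S (u i) z)"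
  unfolding ip_def
  by (simp add: sum_distrib_right sum_distrib_left mult.assoc) (rule sum.swap)

lemma ip_add_right: "ip S z (\<lambda>s. x s + y s) = ip S z x + ip S z y"
  by (simp add: ip_def sum.distrib algebra_simps)

lemma ip_diff_right: "ip S z (\<lambda>s. x s - y s) = ip S z x - ip S z y"
  by (simp add: ip_def sum_subtractf algebra_simps)

lemma ip_scale_right: "ip S z (\<lambda>s. c * x s) = c * ip S z x"
  by (simp add: ip_def sum_distrib_left mult.left_commute)

lemma ip_sum_right: "ip S z (\<lambda>s. \<Sum>i\<in>I. c i * u i s) = (\<Sum>i\<in>I. c i * ip S z (u i))"
  unfolding ip_commute[of S z] by (rule ip_sum_left)

lemma ip_cong: "(\<And>s. s \<in> S \<Longrightarrow> x s = x' s) \<Longrightarrow> (\<And>s. s \<in> S \<Longrightarrow> y s = y' s) \<Longrightarrow> ip S x y = ip S x' y'"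
  by (simp add: ip_def)

lemma ip_self_nonneg: "ip S x x \<ge> 0"
  by (simp add: ip_def sum_nonneg)

lemma ip_self_eq_0: "finite S \<Longrightarrow> ip S x x = 0 \<longleftrightarrow> (\<forall>s\<in>S. x s = 0)"
  by (simp add: ip_def sum_nonneg_eq_0_iff)

lemma ip_indicator: "finite S \<Longrightarrow> s \<in> S \<Longrightarrow> ip S (\<lambda>t. if t = s then 1 else 0) x = x s"
  by (simp add: ip_def if_distrib[of "\<lambda>a. a * _"] cong: if_cong)

lemma ip_residual:
  fixes x :: "'s \<Rightarrow> real"
  assumes "finite I" "orthonormal_on S I u"
  defines "r \<equiv> \<lambda>s. x s - (\<Sum>i\<in>I. ip S x (u i) * u i s)"
  shows "ip S r r = ip S x x - (\<Sum>i\<in>I. (ip S x (u i))\<^sup>2)"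
    and "\<And>j. j \<in> I \<Longrightarrow> ip S r (u j) = 0"
proof -
  show ort: "ip S r (u j) = 0" if "j \<in> I" for j
  proof -
    have "(\<Sum>i\<in>I. ip S x (u i) * ip S (u i) (u j)) = (\<Sum>i\<in>I. if i = j then ip S x (u i) else 0)"
      using assms(2) that by (intro sum.cong) (auto simp: orthonormal_onD)
    then show ?thesis using assms(1) that
      by (simp add: r_def ip_diff_left ip_sum_left)
  qed
  have "ip S r r = ip S r x - (\<Sum>i\<in>I. ip S x (u i) * ip S r (u i))"
    unfolding r_def by (subst ip_diff_right, subst ip_sum_right) simp
  also have "\<dots> = ip S r x" using ort by simp
  also have "\<dots> = ip S x x - (\<Sum>i\<in>I. (ip S x (u i))\<^sup>2)"
    by (simp add: r_def ip_diff_left ip_sum_left power2_eq_square ip_commute)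
  finally show "ip S r r = ip S x x - (\<Sum>i\<in>I. (ip S x (u i))\<^sup>2)" .
qed

lemma bessel:
  assumes "finite I" "orthonormal_on S I u"
  shows "(\<Sum>i\<in>I. (ip S x (u i))\<^sup>2) \<le> ip S x x"
  using ip_residual(1)[OF assms, of x]
    ip_self_nonneg[of S "\<lambda>s. x s - (\<Sum>i\<in>I. ip S x (u i) * u i s)"] by simp

lemma sum_squares_orthonormal:
  assumes "finite S" "finite I" "orthonormal_on S I u"
  shows "(\<Sum>s\<in>S. \<Sum>i\<in>I. (u i s)\<^sup>2) = card I"
proof -
  have "(\<Sum>s\<in>S. \<Sum>i\<in>I. (u i s)\<^sup>2) = (\<Sum>i\<in>I. ip S (u i) (u i))"
    by (subst sum.swap) (simp add: ip_def power2_eq_square)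
  also have "\<dots> = (\<Sum>i\<in>I. 1)" using assms(3) by (intro sum.cong) (auto simp: orthonormal_onD)
  finally show ?thesis by simp
qed

lemma sum_coordinates_le_1:
  assumes "finite S" "finite I" "orthonormal_on S I u" "s \<in> S"
  shows "(\<Sum>i\<in>I. (u i s)\<^sup>2) \<le> 1"
  using bessel[OF assms(2,3), of "\<lambda>t. if t = s then 1 else 0"] assms(1,4)
  by (simp add: ip_indicator)

lemma card_orthonormal_le:
  assumes "finite S" "finite I" "orthonormal_on S I u"
  shows "card I \<le> card S"
proof -
  have "real (card I) = (\<Sum>s\<in>S. \<Sum>i\<in>I. (u i s)\<^sup>2)"
    using sum_squares_orthonormal[OF assms] by simp
  also have "\<dots> \<le> (\<Sum>s\<in>S. 1)" by (intro sum_mono sum_coordinates_le_1[OF assms])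
  finally show ?thesis by simp
qed

text \<open>
Bessel bounds each sum \<open>\<Sum>i. (u i s)\<^sup>2\<close> by \<open>1\<close>, and these sums add up to \<open>card I\<close>. If this equals
\<open>card S\<close>, all of them are \<open>1\<close>, so the indicator of each point is its own projection.
\<close>

lemma orthonormal_basis_expansion:
  assumes "finite S" "finite I" "orthonormal_on S I u" "card I = card S" "s \<in> S"
  shows "x s = (\<Sum>i\<in>I. ip S x (u i) * u i s)"
proof -
  let ?e = "\<lambda>t s. if s = t then 1 else (0::real)"
  have eq1: "(\<Sum>i\<in>I. (u i t)\<^sup>2) = 1" if "t \<in> S" for t
  proof (rule ccontr)
    assume "(\<Sum>i\<in>I. (u i t)\<^sup>2) \<noteq> 1"
    then have "(\<Sum>i\<in>I. (u i t)\<^sup>2) < 1"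
      using sum_coordinates_le_1[OF assms(1-3) that] by simp
    then have "(\<Sum>s\<in>S. \<Sum>i\<in>I. (u i s)\<^sup>2) < (\<Sum>s\<in>S. 1)"
      using assms(1) that by (intro sum_strict_mono_ex1) (auto intro: sum_coordinates_le_1[OF assms(1-3)])
    then show False using sum_squares_orthonormal[OF assms(1-3)] assms(4) by simp
  qed
  have e: "?e t s = (\<Sum>i\<in>I. u i t * u i s)" if "t \<in> S" for t
  proof -
    define r where "r = (\<lambda>s. ?e t s - (\<Sum>i\<in>I. ip S (?e t) (u i) * u i s))"
    have "ip S r r = 0"
      using ip_residual(1)[OF assms(2,3), of "?e t"] eq1[OF that] that assms(1)
      by (simp add: r_def ip_indicator)
    then have "r s = 0" using assms(1,5) by (simp add: ip_self_eq_0)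
    then show ?thesis using that assms(1) by (simp add: r_def ip_indicator)
  qed
  have "x s = (\<Sum>t\<in>S. x t * ?e t s)" using assms(1,5) by (simp add: if_distrib cong: if_cong)
  also have "\<dots> = (\<Sum>t\<in>S. \<Sum>i\<in>I. x t * (u i t * u i s))" by (simp add: e sum_distrib_left)
  also have "\<dots> = (\<Sum>i\<in>I. ip S x (u i) * u i s)"
    by (subst sum.swap) (simp add: ip_def sum_distrib_right mult.assoc)
  finally show ?thesis .
qed

lemma parseval:
  assumes "finite S" "finite I" "orthonormal_on S I u" "card I = card S"
  shows "ip S x y = (\<Sum>i\<in>I. ip S x (u i) * ip S y (u i))"
proof -
  have "ip S x y = ip S (\<lambda>s. \<Sum>i\<in>I. ip S x (u i) * u i s) y"
    using orthonormal_basis_expansion[OF assms] by (intro ip_cong) auto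
  then show ?thesis by (simp add: ip_sum_left ip_commute)
qed

text \<open>
Matrices are functions of two indices, and vectors functions on an arbitrary finite index set, so
that the links of a complex need no enumeration.
\<close>

definition mat_op :: "'s set \<Rightarrow> ('s \<Rightarrow> 's \<Rightarrow> real) \<Rightarrow> ('s \<Rightarrow> real) \<Rightarrow> 's \<Rightarrow> real" where
  "mat_op S a x s = (\<Sum>t\<in>S. a s t * x t)"

lemma mat_op_symmetric:
  assumes "\<And>s t. s \<in> S \<Longrightarrow> t \<in> S \<Longrightarrow> a s t = a t s"
  shows "ip S x (mat_op S a y) = ip S (mat_op S a x) y"
proof -
  have "ip S x (mat_op S a y) = (\<Sum>s\<in>S. \<Sum>t\<in>S. x s * a s t * y t)"
    by (simp add: ip_def mat_op_def sum_distrib_left mult.assoc)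
  also have "\<dots> = (\<Sum>t\<in>S. \<Sum>s\<in>S. x s * a s t * y t)" by (rule sum.swap)
  also have "\<dots> = ip S (mat_op S a x) y"
    unfolding ip_def mat_op_def sum_distrib_right
    by (intro sum.cong refl) (simp add: assms)
  finally show ?thesis .
qed

lemma mat_op_add: "mat_op S a (\<lambda>s. x s + y s) = (\<lambda>s. mat_op S a x s + mat_op S a y s)"
  by (auto simp: mat_op_def sum.distrib algebra_simps)

lemma mat_op_scale: "mat_op S a (\<lambda>s. c * x s) = (\<lambda>s. c * mat_op S a x s)"
  by (auto simp: mat_op_def sum_distrib_left algebra_simps)

lemma mat_op_cong: "(\<And>s. s \<in> S \<Longrightarrow> x s = y s) \<Longrightarrow> mat_op S a x = mat_op S a y"
  by (auto simp: mat_op_def)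

lemma nonneg_quadratic_linear_coeff:
  fixes b c :: real
  assumes "\<And>t. 0 \<le> 2 * t * b + t\<^sup>2 * c"
  shows "b = 0"
proof (rule ccontr)
  assume b: "b \<noteq> 0"
  define k where "k = \<bar>c\<bar> + 1"
  have k: "k > 0" "c \<le> k" by (auto simp: k_def)
  define t where "t = - b / k"
  have "0 \<le> 2 * t * b + t\<^sup>2 * c" by (rule assms)
  also have "\<dots> \<le> 2 * t * b + t\<^sup>2 * k"
    using k by (intro add_left_mono mult_left_mono) auto
  also have "\<dots> = - (b\<^sup>2 / k)"
    unfolding t_def using k by (simp add: power2_eq_square field_simps)
  also have "\<dots> < 0" using b k by simp
  finally show False by simp
qed

text \<open>
Rayleigh's principle: the orthogonal complement of the given eigenvectors is invariant, and a point
at which the quadratic form is maximal on its unit sphere is an eigenvector, because the first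
variation vanishes. The sphere is made compact by letting vectors vanish outside \<open>S\<close>.
\<close>

lemma exists_next_eigenvector:
  assumes fin: "finite S" "finite I" and lt: "card I < card S"
    and sym: "\<And>s t. s \<in> S \<Longrightarrow> t \<in> S \<Longrightarrow> a s t = a t s"
    and on: "orthonormal_on S I u"
    and eig: "\<And>i s. i \<in> I \<Longrightarrow> s \<in> S \<Longrightarrow> mat_op S a (u i) s = l i * u i s"
  shows "\<exists>x \<mu>. ip S x x = 1 \<and> (\<forall>i\<in>I. ip S x (u i) = 0) \<and> (\<forall>s\<in>S. mat_op S a x s = \<mu> * x s)"
proof -
  define B :: "('a \<Rightarrow> real) set" where
    "B = (\<Pi>\<^sub>E s\<in>UNIV. if s \<in> S then {-1..1} else {0})"
  define K where "K = B \<inter> {x. ip S x x = 1} \<inter> (\<Inter>i\<in>I. {x. ip S x (u i) = 0})"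
  have "compactin (product_topology (\<lambda>_::'a. euclidean::real topology) UNIV) B"
    unfolding B_def by (subst compactin_PiE) auto
  then have "compact B" by (simp add: euclidean_product_topology)
  have cont_ip: "continuous_on UNIV (\<lambda>x. ip S x y)" for y
    unfolding ip_def by (intro continuous_intros continuous_on_product_coordinates)
  have cont_q: "continuous_on UNIV (\<lambda>x. ip S x x)"
    unfolding ip_def by (intro continuous_intros continuous_on_product_coordinates)
  have "closed {x. ip S x x = 1}"
    using cont_q by (intro closed_Collect_eq) auto
  moreover have "closed (\<Inter>i\<in>I. {x. ip S x (u i) = 0})"
    using cont_ip by (intro closed_INT ballI closed_Collect_eq) auto
  ultimately have "compact K" unfolding K_def using \<open>compact B\<close> by (intro compact_Int_closed)
  have norm_in_K: "(\<lambda>s. if s \<in> S then c * y s else 0) \<in> K"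
    if "ip S y y > 0" "\<And>i. i \<in> I \<Longrightarrow> ip S y (u i) = 0" "c = 1 / sqrt (ip S y y)" for y c
  proof -
    define x where "x = (\<lambda>s. if s \<in> S then c * y s else 0)"
    have ipx: "ip S x z = c * ip S y z" for z
      unfolding x_def ip_scale_left[symmetric] by (rule ip_cong) auto
    have "ip S x x = c * (c * ip S y y)" using ipx[of x] ipx[of y] by (simp add: ip_commute)
    also have "\<dots> = c\<^sup>2 * ip S y y" by (simp add: power2_eq_square)
    also have "\<dots> = 1" using that by (simp add: power_divide)
    finally have one: "ip S x x = 1" .
    have "x s \<in> {-1..1}" if "s \<in> S" for s
    proof -
      have "x s * x s \<le> ip S x x"
        unfolding ip_def using that fin by (intro member_le_sum) auto
      then have "\<bar>x s\<bar> \<le> 1" using one by (metis abs_le_square_iff abs_one one_power2 power2_eq_square)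
      then show ?thesis by auto
    qed
    then have "x \<in> B" by (auto simp: B_def x_def)
    then show ?thesis using one that(2) ipx by (auto simp: K_def x_def[symmetric])
  qed
  \<comment> \<open>The sphere is nonempty: some indicator is not in the span of fewer than \<open>card S\<close> vectors.\<close>
  have "\<exists>s\<in>S. (\<Sum>i\<in>I. (u i s)\<^sup>2) < 1"
  proof (rule ccontr)
    assume "\<not> ?thesis"
    then have "(\<Sum>s\<in>S. 1) \<le> (\<Sum>s\<in>S. \<Sum>i\<in>I. (u i s)\<^sup>2)" by (intro sum_mono) (simp add: not_less)
    then show False using sum_squares_orthonormal[OF fin on] lt by simp
  qed
  then obtain s0 where s0: "s0 \<in> S" "(\<Sum>i\<in>I. (u i s0)\<^sup>2) < 1" by auto
  define e where "e = (\<lambda>t. if t = s0 then 1 else (0::real))"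
  define r where "r = (\<lambda>s. e s - (\<Sum>i\<in>I. ip S e (u i) * u i s))"
  have "ip S r r > 0" and r0: "\<And>j. j \<in> I \<Longrightarrow> ip S r (u j) = 0"
    using ip_residual[OF fin(2) on, where x = e] s0 fin(1) by (simp_all add: r_def e_def ip_indicator)
  then have "K \<noteq> {}" using norm_in_K by blast
  have "continuous_on K (\<lambda>x. ip S x (mat_op S a x))"
    unfolding ip_def mat_op_def
    by (intro continuous_intros continuous_on_subset[OF continuous_on_product_coordinates]) auto
  then obtain x where x: "x \<in> K" "\<And>y. y \<in> K \<Longrightarrow> ip S y (mat_op S a y) \<le> ip S x (mat_op S a x)"
    using continuous_attains_sup[OF \<open>compact K\<close> \<open>K \<noteq> {}\<close>] by blast
  define \<mu> where "\<mu> = ip S x (mat_op S a x)"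
  have xx: "ip S x x = 1" and xu: "\<And>i. i \<in> I \<Longrightarrow> ip S x (u i) = 0"
    using x(1) by (auto simp: K_def)
  have max: "ip S y (mat_op S a y) \<le> \<mu> * ip S y y" if y: "\<And>i. i \<in> I \<Longrightarrow> ip S y (u i) = 0" for y
  proof (cases "ip S y y > 0")
    case True
    define c where "c = 1 / sqrt (ip S y y)"
    define z where "z = (\<lambda>s. if s \<in> S then c * y s else 0)"
    have "z \<in> K" unfolding z_def by (rule norm_in_K[OF True y c_def])
    then have "ip S z (mat_op S a z) \<le> \<mu>" unfolding \<mu>_def by (rule x(2))
    moreover have "mat_op S a z = (\<lambda>s. c * mat_op S a y s)"
      unfolding mat_op_scale[symmetric] by (rule mat_op_cong) (simp add: z_def)
    moreover have "ip S z w = c * ip S y w" for w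
      unfolding z_def ip_scale_left[symmetric] by (rule ip_cong) auto
    ultimately have "c\<^sup>2 * ip S y (mat_op S a y) \<le> \<mu>"
      by (simp add: ip_scale_right power2_eq_square)
    moreover have "c\<^sup>2 = 1 / ip S y y" using True by (simp add: c_def power_divide)
    ultimately show ?thesis using True by (simp add: field_simps)
  next
    case False
    then have "ip S y y = 0" using ip_self_nonneg[of S y] by simp
    then have "\<forall>s\<in>S. y s = 0" using fin by (simp add: ip_self_eq_0)
    then show ?thesis by (simp add: ip_def)
  qed
  \<comment> \<open>The residual \<open>g\<close> is itself an admissible direction of variation, which gives \<open>ip S g g = 0\<close>.\<close>
  define g where "g = (\<lambda>s. mat_op S a x s - \<mu> * x s)"
  have gu: "ip S g (u i) = 0" if "i \<in> I" for i
  proof -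
    have "ip S (mat_op S a x) (u i) = ip S x (mat_op S a (u i))" by (rule mat_op_symmetric[OF sym, symmetric])
    also have "\<dots> = ip S x (\<lambda>s. l i * u i s)" by (rule ip_cong) (auto simp: eig that)
    also have "\<dots> = 0" using xu that by (simp add: ip_scale_right)
    finally show ?thesis using xu that by (simp add: g_def ip_diff_left ip_scale_left)
  qed
  have g_right: "ip S z g = ip S z (mat_op S a x) - \<mu> * ip S z x" for z
    by (simp add: g_def ip_diff_right ip_scale_right)
  have "- ip S g g = 0"
  proof (rule nonneg_quadratic_linear_coeff)
    fix t :: real
    define y where "y = (\<lambda>s. x s + t * g s)"
    have "ip S y (mat_op S a y) \<le> \<mu> * ip S y y"
      using xu gu by (intro max) (simp add: y_def ip_add_left ip_scale_left)
    moreover have "ip S y (mat_op S a y) =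
        \<mu> + 2 * t * ip S g (mat_op S a x) + t\<^sup>2 * ip S g (mat_op S a g)"
    proof -
      have "ip S x (mat_op S a g) = ip S g (mat_op S a x)"
        using mat_op_symmetric[OF sym] by (simp add: ip_commute)
      then show ?thesis unfolding y_def mat_op_add mat_op_scale
        by (simp add: ip_add_left ip_add_right ip_scale_left ip_scale_right \<mu>_def power2_eq_square algebra_simps)
    qed
    moreover have "ip S y y = 1 + 2 * t * ip S g x + t\<^sup>2 * ip S g g"
      unfolding y_def using xx ip_commute[of S x g]
      by (simp add: ip_add_left ip_add_right ip_scale_left ip_scale_right power2_eq_square algebra_simps)
    moreover have "ip S g (mat_op S a x) = ip S g g + \<mu> * ip S g x"
      using g_right[of g] by simp
    ultimately have "\<mu> + 2 * t * (ip S g g + \<mu> * ip S g x) + t\<^sup>2 * ip S g (mat_op S a g)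
        \<le> \<mu> * (1 + 2 * t * ip S g x + t\<^sup>2 * ip S g g)" by simp
    then show "0 \<le> 2 * t * (- ip S g g) + t\<^sup>2 * (\<mu> * ip S g g - ip S g (mat_op S a g))"
      by (simp add: algebra_simps)
  qed
  then have "\<forall>s\<in>S. g s = 0" using fin by (simp add: ip_self_eq_0)
  then have "\<forall>s\<in>S. mat_op S a x s = \<mu> * x s" by (simp add: g_def)
  then show ?thesis using xx xu by blast
qed

text \<open>
A prescribed initial family is kept. This allows the constant vector to be a member of an eigenbasis
of a Laplacian; for the zero matrix it completes any orthonormal family to a basis.
\<close>

lemma extend_to_eigenbasis:
  assumes fin: "finite S"
    and sym: "\<And>s t. s \<in> S \<Longrightarrow> t \<in> S \<Longrightarrow> a s t = a t s"
    and on: "orthonormal_on S {..<k} u"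
    and eig: "\<And>i s. i < k \<Longrightarrow> s \<in> S \<Longrightarrow> mat_op S a (u i) s = l i * u i s"
  shows "\<exists>u' l'. (\<forall>i<k. u' i = u i \<and> l' i = l i) \<and> orthonormal_on S {..<card S} u' \<and>
     (\<forall>i<card S. \<forall>s\<in>S. mat_op S a (u' i) s = l' i * u' i s)"
proof -
  have "k \<le> card S" using card_orthonormal_le[OF fin _ on] by simp
  then show ?thesis using on eig
  proof (induction "card S - k" arbitrary: k u l)
    case 0
    then have "k = card S" by simp
    with 0 show ?case by blast
  next
    case (Suc m)
    then have lt: "card {..<k} < card S" by simp
    obtain x \<mu> where x: "ip S x x = 1" "\<forall>i\<in>{..<k}. ip S x (u i) = 0" "\<forall>s\<in>S. mat_op S a x s = \<mu> * x s"
      using exists_next_eigenvector[where a = a and l = l, OF fin _ lt sym Suc.prems(2)] Suc.prems(3)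
      by blast
    define u1 l1 where "u1 = u(k := x)" and "l1 = l(k := \<mu>)"
    have "orthonormal_on S {..<Suc k} u1"
      using Suc.prems(2) x by (auto simp: orthonormal_on_def u1_def ip_commute less_Suc_eq)
    moreover have "mat_op S a (u1 i) s = l1 i * u1 i s" if "i < Suc k" "s \<in> S" for i s
      using that Suc.prems(3) x by (auto simp: u1_def l1_def less_Suc_eq)
    moreover have "m = card S - Suc k" "Suc k \<le> card S" using Suc.hyps(2) lt by auto
    ultimately obtain u' l' where "\<forall>i<Suc k. u' i = u1 i \<and> l' i = l1 i" "orthonormal_on S {..<card S} u'"
      "\<forall>i<card S. \<forall>s\<in>S. mat_op S a (u' i) s = l' i * u' i s"
      using Suc.hyps(1)[of "Suc k" u1 l1] by blast
    then show ?case by (intro exI[of _ u'] exI[of _ l']) (auto simp: u1_def l1_def)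
  qed
qed

section \<open>An extremal choice of differences\<close>

text \<open>
Determinants are used for the matrix with rows \<open>g 0, \<dots>, g (n - 1)\<close>, as functions of single rows.
\<close>

definition row_mat :: "nat \<Rightarrow> (nat \<Rightarrow> nat \<Rightarrow> real) \<Rightarrow> real mat" where
  "row_mat n g = mat n n (\<lambda>(j, i). g j i)"

lemma row_mat_carrier: "row_mat n g \<in> carrier_mat n n"
  by (simp add: row_mat_def)

lemma row_mat_cong: "(\<And>j i. j < n \<Longrightarrow> i < n \<Longrightarrow> g j i = g' j i) \<Longrightarrow> row_mat n g = row_mat n g'"
  by (auto simp: row_mat_def)

lemma det_row_upd:
  assumes "k < n"
  shows "det (row_mat n (g(k := x))) = (\<Sum>i<n. x i * cofactor (row_mat n g) k i)"
proof -
  have "cofactor (row_mat n (g(k := x))) k i = cofactor (row_mat n g) k i" for i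
    unfolding cofactor_def
    by (rule arg_cong[where f = "\<lambda>A. (-1) ^ (k + i) * det A"])
       (auto simp: mat_delete_def row_mat_def)
  then show ?thesis
    using assms by (subst laplace_expansion_row[OF row_mat_carrier assms]) (simp add: row_mat_def)
qed

lemma det_row_dup:
  assumes "k < n" "j < n" "j \<noteq> k"
  shows "det (row_mat n (g(k := g j))) = 0"
  using assms by (intro det_identical_rows[OF row_mat_carrier, of j k])
    (auto simp: row_mat_def row_def)

lemma det_row_swap:
  assumes "k < n" "j < n" "j \<noteq> k"
  shows "det (row_mat n (g(k := x, j := y))) = - det (row_mat n (g(j := x, k := y)))"
proof -
  have "row_mat n (g(k := x, j := y)) = swaprows k j (row_mat n (g(j := x, k := y)))"
    using assms by (auto simp: row_mat_def)
  then show ?thesis using det_swaprows[OF assms(1,2) _ row_mat_carrier] assms(3) by simp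
qed

text \<open>
Allow arbitrary rows outside a set \<open>J\<close> of indices, and take \<open>J\<close> as large as possible such that
some choice on \<open>J\<close> can be completed to a nonsingular matrix. If an index \<open>j0\<close> is missing, the
determinant as a function of row \<open>j0\<close> is a nonzero functional that kills every difference
\<open>u (h k) - u w\<close>: otherwise \<open>j0\<close> or \<open>k\<close> could be added to \<open>J\<close>. This contradicts the hypothesis
that the differences span.
\<close>

lemma nonsingular_choice_exists:
  fixes u :: "'w \<Rightarrow> nat \<Rightarrow> real" and h :: "nat \<Rightarrow> 'w"
  assumes spanning: "\<forall>z. (\<forall>j<n. \<forall>w\<in>W. (\<Sum>i<n. (u (h j) i - u w i) * z i) = 0) \<longrightarrow> (\<forall>i<n. z i = 0)"
  shows "\<exists>f. (\<forall>j<n. f j \<in> W) \<and> det (row_mat n (\<lambda>j i. u (h j) i - u (f j) i)) \<noteq> (0::real)"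
proof -
  define rows where "rows = (\<lambda>J f x (j::nat) i. if j \<in> J then u (h j) i - u (f j) i else (x j i :: real))"
  define Q where "Q = (\<lambda>J. J \<subseteq> {..<n} \<and> (\<exists>f x. (\<forall>j\<in>J. f j \<in> W) \<and> det (row_mat n (rows J f x)) \<noteq> 0))"
  \<comment> \<open>The identity matrix is a completion for the empty set, so a largest set exists.\<close>
  have "row_mat n (rows {} f (\<lambda>j i. if i = j then 1 else 0)) = 1\<^sub>m n" for f
    by (auto simp: row_mat_def rows_def)
  then have "det (row_mat n (rows {} f (\<lambda>j i. if i = j then 1 else 0))) \<noteq> 0" for f
    by (metis det_one zero_neq_one)
  then have "Q {}" unfolding Q_def by blast
  moreover have "card J \<le> n" if "Q J" for J
    using that card_mono[of "{..<n}" J] by (auto simp: Q_def)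
  ultimately obtain J where J: "Q J" and max: "\<And>J'. Q J' \<Longrightarrow> card J' \<le> card J"
    using ex_has_greatest_nat[of Q "{}" card "Suc n"] by (auto simp: less_Suc_eq_le)
  then obtain f x where f: "\<forall>j\<in>J. f j \<in> W" and nz: "det (row_mat n (rows J f x)) \<noteq> 0" and JN: "J \<subseteq> {..<n}"
    by (auto simp: Q_def)
  have bigger: "\<not> Q (insert j J)" if "j \<notin> J" for j
    using max[of "insert j J"] that finite_subset[OF JN] by auto
  have "J = {..<n}"
  proof (rule ccontr)
    assume "J \<noteq> {..<n}"
    then obtain j0 where j0: "j0 < n" "j0 \<notin> J" using JN by auto
    define g where "g = rows J f x"
    define z where "z = cofactor (row_mat n g) j0"
    define \<phi> where "\<phi> = (\<lambda>y. \<Sum>i<n. y i * z i)"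
    have \<phi>: "\<phi> y = det (row_mat n (g(j0 := y)))" for y
      unfolding \<phi>_def z_def using det_row_upd[OF j0(1)] by simp
    have diff: "\<phi> (\<lambda>i. y i - y' i) = \<phi> y - \<phi> y'" for y y'
      by (simp add: \<phi>_def left_diff_distrib sum_subtractf)
    have at_j0: "\<phi> (\<lambda>i. u (h j0) i - u w i) = 0" if "w \<in> W" for w
    proof (rule ccontr)
      assume "\<not> ?thesis"
      moreover have "g(j0 := (\<lambda>i. u (h j0) i - u w i)) = rows (insert j0 J) (f(j0 := w)) x"
        using j0 by (auto simp: g_def rows_def fun_eq_iff)
      ultimately have "Q (insert j0 J)"
        unfolding Q_def \<phi> using f that JN j0 by (auto intro!: exI[of _ "f(j0 := w)"] exI[of _ x])
      then show False using bigger j0 by blast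
    qed
    have all: "\<phi> (\<lambda>i. u (h k) i - u w i) = 0" if k: "k < n" and w: "w \<in> W" for k w
    proof -
      consider "k = j0" | "k \<in> J" "k \<noteq> j0" | "k \<notin> J" "k \<noteq> j0" by blast
      then show ?thesis
      proof cases
        case 1 then show ?thesis using at_j0 w by simp
      next
        case 2
        \<comment> \<open>A row that occurs twice gives determinant \<open>0\<close>; the choice at \<open>j0\<close> is free, which moves the
          second term of the difference from \<open>f k\<close> to \<open>w\<close>.\<close>
        have "\<phi> (g k) = 0" unfolding \<phi> using det_row_dup[OF j0(1) k] 2 by simp
        moreover have "g k = (\<lambda>i. u (h k) i - u (f k) i)" using 2 by (auto simp: g_def rows_def)
        ultimately have "\<phi> (u (h k)) = \<phi> (u (f k))" using diff[of "u (h k)" "u (f k)"] by simp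
        moreover have "\<phi> (u (h j0)) = \<phi> (u w)" "\<phi> (u (h j0)) = \<phi> (u (f k))"
          using at_j0[of w] at_j0[of "f k"] w f 2 by (simp_all add: diff)
        ultimately show ?thesis by (simp add: diff)
      next
        case 3
        show ?thesis
        proof (rule ccontr)
          \<comment> \<open>Exchanging rows \<open>j0\<close> and \<open>k\<close> would put the difference at the free index \<open>k\<close>.\<close>
          let ?y = "\<lambda>i. u (h k) i - u w i"
          assume "\<not> ?thesis"
          then have "det (row_mat n (g(k := g k, j0 := ?y))) \<noteq> 0" by (simp add: \<phi>)
          then have "det (row_mat n (g(j0 := g k, k := ?y))) \<noteq> 0"
            using det_row_swap[OF k j0(1), of g "g k" ?y] 3 by auto
          moreover have "g(j0 := g k, k := ?y) = rows (insert k J) (f(k := w)) (x(j0 := g k))"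
            using j0 3 by (auto simp: g_def rows_def fun_eq_iff)
          ultimately have "Q (insert k J)"
            unfolding Q_def using f w JN k by (auto intro!: exI[of _ "f(k := w)"] exI[of _ "x(j0 := g k)"])
          then show False using bigger 3 by blast
        qed
      qed
    qed
    then have "z i = 0" if "i < n" for i
      using spanning that by (auto simp: \<phi>_def)
    then have "\<phi> (g j0) = 0" by (simp add: \<phi>_def)
    then show False using nz by (simp add: \<phi> g_def)
  qed
  moreover have "row_mat n (rows {..<n} f x) = row_mat n (\<lambda>j i. u (h j) i - u (f j) i)"
    by (rule row_mat_cong) (simp add: rows_def)
  ultimately show ?thesis using f nz by auto
qed

text \<open>
The map \<open>f\<close> makes the absolute value of the determinant of the differences maximal, and \<open>z\<close> is the
dual basis, given by cofactors. By Cramer's rule the product of \<open>z j\<close> with \<open>u (h j) - u w\<close> is the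
factor by which the determinant changes when \<open>f j\<close> is replaced by \<open>w\<close>. This factor is at most \<open>1\<close>,
and it is \<open>1\<close> for \<open>w = f j\<close>, hence the sign in the last conjunct.
\<close>

lemma extremal_choice:
  fixes u :: "'w \<Rightarrow> nat \<Rightarrow> real" and h :: "nat \<Rightarrow> 'w"
  assumes W: "finite W"
    and spanning: "\<forall>z. (\<forall>j<n. \<forall>w\<in>W. (\<Sum>i<n. (u (h j) i - u w i) * z i) = 0) \<longrightarrow> (\<forall>i<n. z i = 0)"
  shows "\<exists>f z. (\<forall>j<n. f j \<in> W) \<and>
     (\<forall>j<n. \<forall>k<n. (\<Sum>i<n. (u (h k) i - u (f k) i) * z j i) = (if k = j then 1 else 0)) \<and>
     (\<forall>i<n. (\<Sum>j<n. (u (h j) i - u (f j) i) * z j i) = 1) \<and>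
     (\<forall>j<n. \<forall>w\<in>W. (\<Sum>i<n. (u (f j) i - u w i) * z j i) \<le> (0::real))"
proof -
  define G where "G = (\<lambda>f j i. u (h j) i - u (f j) i)"
  define D where "D = (\<lambda>f. \<bar>det (row_mat n (G f))\<bar>)"
  define F where "F = (\<Pi>\<^sub>E j\<in>{..<n}. W)"
  have restr: "row_mat n (G (restrict f {..<n})) = row_mat n (G f)" for f
    by (rule row_mat_cong) (simp add: G_def)
  obtain f0 where f0: "\<forall>j<n. f0 j \<in> W" "det (row_mat n (G f0)) \<noteq> 0"
    using nonsingular_choice_exists[OF spanning] unfolding G_def by blast
  have "restrict f0 {..<n} \<in> F" using f0 by (auto simp: F_def)
  moreover have "finite F" unfolding F_def using W by (intro finite_PiE) auto
  ultimately have "\<exists>f\<in>F. D f = Max (D ` F)"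
    using obtains_MAX[of F D] by (metis empty_iff)
  then obtain f where f: "f \<in> F" and fmax: "\<And>f'. f' \<in> F \<Longrightarrow> D f' \<le> D f"
    using \<open>finite F\<close> by auto
  have fW: "\<forall>j<n. f j \<in> W" using f by (auto simp: F_def)
  define g where "g = G f"
  define d where "d = det (row_mat n g)"
  have "0 < D (restrict f0 {..<n})" using f0 by (simp add: D_def restr)
  also have "\<dots> \<le> D f" using \<open>restrict f0 {..<n} \<in> F\<close> by (rule fmax)
  finally have d: "d \<noteq> 0" by (simp add: D_def d_def g_def)
  define z where "z = (\<lambda>j i. cofactor (row_mat n g) j i / d)"
  have z: "(\<Sum>i<n. x i * z j i) = det (row_mat n (g(j := x))) / d" if "j < n" for j x
    using det_row_upd[OF that, of g x] by (simp add: z_def sum_divide_distrib)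
  have "(\<Sum>i<n. g k i * z j i) = (if k = j then 1 else 0)" if "j < n" "k < n" for j k
    using z[OF that(1), of "g k"] det_row_dup[OF that(1,2), of g] d by (simp add: d_def)
  moreover have "(\<Sum>j<n. g j i * z j i) = 1" if "i < n" for i
  proof -
    have "d = (\<Sum>j<n. g j i * cofactor (row_mat n g) j i)"
      unfolding d_def by (subst laplace_expansion_column[OF row_mat_carrier that])
        (simp add: row_mat_def that)
    then show ?thesis using d by (simp add: z_def sum_divide_distrib[symmetric])
  qed
  moreover have "(\<Sum>i<n. (u (f j) i - u w i) * z j i) \<le> 0" if j: "j < n" and w: "w \<in> W" for j w
  proof -
    define x where "x = (\<lambda>i. u (h j) i - u w i)"
    have "restrict (f(j := w)) {..<n} \<in> F" using fW w by (auto simp: F_def)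
    then have "D (restrict (f(j := w)) {..<n}) \<le> D f" by (rule fmax)
    moreover have "G (f(j := w)) = g(j := x)" by (auto simp: G_def g_def x_def fun_eq_iff)
    ultimately have "\<bar>det (row_mat n (g(j := x)))\<bar> \<le> \<bar>d\<bar>" by (simp add: D_def restr d_def g_def)
    then have "\<bar>(\<Sum>i<n. x i * z j i)\<bar> \<le> 1" using d by (simp add: z[OF j])
    moreover have "(\<Sum>i<n. g j i * z j i) = 1" using z[OF j, of "g j"] d by (simp add: d_def)
    moreover have "(u (f j) i - u w i) * z j i = x i * z j i - g j i * z j i" for i
      by (simp add: x_def g_def G_def algebra_simps)
    ultimately show ?thesis by (simp add: sum_subtractf)
  qed
  ultimately show ?thesis using fW unfolding g_def G_def by blast
qed


section \<open>Laplacians of split graphs\<close>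

text \<open>
The Laplacian of the graph in which \<open>H\<close> is a clique, \<open>W\<close> is independent, and \<open>h \<in> H\<close> is adjacent to
\<open>w \<in> W\<close> iff \<open>R h w\<close>.
\<close>

definition split_laplacian :: "'v set \<Rightarrow> 'v set \<Rightarrow> ('v \<Rightarrow> 'v \<Rightarrow> bool) \<Rightarrow> ('v \<Rightarrow> real) \<Rightarrow> 'v \<Rightarrow> real" where
  "split_laplacian H W R x v =
     (if v \<in> H then real (card H) * x v - sum x H + (\<Sum>w\<in>W. of_bool (R v w) * (x v - x w))
      else (\<Sum>h\<in>H. of_bool (R h v) * (x v - x h)))"

text \<open>
For the extremal map \<open>f\<close>, the Laplacian sends the vector \<open>c_j = e_(h j) - e_(f j)\<close> to
\<open>\<Sum>k. Y k j * c_k\<close> plus a combination of vectors \<open>e_(f j) - e_w\<close> with nonnegative coefficients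
\<open>F w j\<close>. In the coordinates given by the eigenvectors the trace of the Laplacian on the span is the
sum of the eigenvalues, the matrix \<open>Y\<close> contributes at most \<open>n\<^sup>2\<close> plus the number of cross edges, and
the remaining terms have a negative sign by extremality.
\<close>

lemma split_eigenvalue_sum_le:
  assumes fin: "finite H" "finite W" and disj: "H \<inter> W = {}" and ne: "W \<noteq> {}"
    and n: "n = card H"
    and on: "orthonormal_on (H \<union> W) {..<n} u"
    and eig: "\<And>i v. i < n \<Longrightarrow> v \<in> H \<union> W \<Longrightarrow> split_laplacian H W R (u i) v = l i * u i v"
    and ort: "\<And>i. i < n \<Longrightarrow> sum (u i) (H \<union> W) = 0"
  shows "(\<Sum>i<n. l i) \<le> real n * n + (\<Sum>h\<in>H. \<Sum>w\<in>W. of_bool (R h w))"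
proof -
  obtain h where h: "bij_betw h {..<n} H"
    using ex_bij_betw_nat_finite[OF fin(1)] n by (auto simp: lessThan_atLeast0)
  have hH: "j < n \<Longrightarrow> h j \<in> H" for j using h by (auto simp: bij_betw_def)
  have sumH: "sum F H = (\<Sum>j<n. F (h j))" for F :: "'a \<Rightarrow> real"
    using sum.reindex_bij_betw[OF h, of F] by simp
  define U where "U = (\<lambda>v i. u i v)"
  \<comment> \<open>The vectors \<open>e_h - e_w\<close> span the orthogonal complement of the constants: a combination of the
    eigenvectors that is orthogonal to all of them is constant, hence zero.\<close>
  have spanning: "\<forall>z. (\<forall>j<n. \<forall>w\<in>W. (\<Sum>i<n. (U (h j) i - U w i) * z i) = 0) \<longrightarrow> (\<forall>i<n. z i = 0)"
  proof (intro allI impI)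
    fix z i
    assume z: "\<forall>j<n. \<forall>w\<in>W. (\<Sum>i<n. (U (h j) i - U w i) * z i) = 0" and i: "i < n"
    define y where "y = (\<lambda>v. \<Sum>i<n. z i * u i v)"
    have yc: "y v = y w" if "v \<in> H" "w \<in> W" for v w
    proof -
      obtain j where "j < n" "v = h j" using h \<open>v \<in> H\<close> by (auto simp: bij_betw_def)
      then show ?thesis using z that
        by (simp add: y_def U_def sum_subtractf left_diff_distrib mult.commute[of "z _"])
    qed
    obtain v0 where v0: "v0 \<in> H" using i n fin by (metis card_gt_0_iff equals0I gr_zeroI not_less_zero)
    obtain w0 where w0: "w0 \<in> W" using ne by auto
    have const: "y v = y v0" if "v \<in> H \<union> W" for v
      using that yc[of v w0] yc[of v0 w0] yc[of v0 v] v0 w0 by auto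
    have "sum y (H \<union> W) = (\<Sum>i<n. z i * sum (u i) (H \<union> W))"
      unfolding y_def by (subst sum.swap) (simp add: sum_distrib_left)
    also have "\<dots> = 0" using ort by simp
    finally have "real (card (H \<union> W)) * y v0 = 0" using const by simp
    then have "y v0 = 0" using v0 fin by auto
    then have "ip (H \<union> W) y (u i) = 0" using const by (simp add: ip_def)
    moreover have "ip (H \<union> W) y (u i) = (\<Sum>k<n. if k = i then z k else 0)"
      unfolding y_def ip_sum_left using on i by (intro sum.cong) (auto simp: orthonormal_onD)
    ultimately show "z i = 0" using i by simp
  qed
  obtain f z where f: "\<forall>j<n. f j \<in> W"
    and dual: "\<forall>j<n. \<forall>k<n. (\<Sum>i<n. (U (h k) i - U (f k) i) * z j i) = (if k = j then 1 else 0)"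
    and tr: "\<forall>i<n. (\<Sum>j<n. (U (h j) i - U (f j) i) * z j i) = 1"
    and opt: "\<forall>j<n. \<forall>w\<in>W. (\<Sum>i<n. (U (f j) i - U w i) * z j i) \<le> 0"
    using extremal_choice[where u = U, OF fin(2) spanning] by blast
  define g where "g = (\<lambda>k i. U (h k) i - U (f k) i)"
  define r where "r = (\<lambda>j w. of_bool (R (h j) w) :: real)"
  define d where "d = (\<lambda>j. \<Sum>w\<in>W. r j w)"
  \<comment> \<open>The rows in \<open>H\<close> of the image of \<open>c_j\<close>; the entries with \<open>k \<noteq> j\<close> are \<open>-1\<close> or \<open>0\<close>.\<close>
  define Y where "Y = (\<lambda>k j. (if k = j then real n + d j else 0) - 1 + r k (f j))"
  \<comment> \<open>What is left in \<open>W\<close>. The coefficient with \<open>w = f j\<close> multiplies the zero vector and may be negative.\<close>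
  define F where "F = (\<lambda>w j. r j w - (\<Sum>k<n. if f k = w then Y k j else 0))"
  have Fnn: "F w j \<ge> 0" if "w \<noteq> f j" for w j
  proof -
    have "(\<Sum>k<n. if f k = w then Y k j else 0) \<le> 0"
      using that by (intro sum_nonpos) (auto simp: Y_def r_def)
    then show ?thesis by (simp add: F_def r_def)
  qed
  have decomp: "l i * g j i = (\<Sum>k<n. Y k j * g k i) + (\<Sum>w\<in>W. F w j * (U (f j) i - U w i))"
    if i: "i < n" and j: "j < n" for i j
  proof -
    let ?D = "\<Sum>k<n. r k (f j)"
    have fj: "f j \<in> W" "f j \<notin> H" using f j disj by auto
    have "l i * g j i = split_laplacian H W R (u i) (h j) - split_laplacian H W R (u i) (f j)"
      using eig[OF i] hH[OF j] fj by (simp add: g_def U_def algebra_simps)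
    also have "\<dots> = real n * U (h j) i - (\<Sum>k<n. U (h k) i) + (\<Sum>w\<in>W. r j w * (U (h j) i - U w i))
        - (\<Sum>k<n. r k (f j) * (U (f j) i - U (h k) i))"
      using hH[OF j] fj by (simp add: split_laplacian_def sumH U_def r_def n)
    also have "\<dots> = (real n + d j) * U (h j) i - (\<Sum>k<n. U (h k) i) - (\<Sum>w\<in>W. r j w * U w i)
        - ?D * U (f j) i + (\<Sum>k<n. r k (f j) * U (h k) i)"
      by (simp add: algebra_simps sum_subtractf sum_distrib_left sum_distrib_right d_def)
    finally have lhs: "l i * g j i = \<dots>" .
    have Yg: "(\<Sum>k<n. Y k j * x k) = (real n + d j) * x j - (\<Sum>k<n. x k) + (\<Sum>k<n. r k (f j) * x k)" for x
    proof -
      have "Y k j * x k = (if k = j then (real n + d j) * x j else 0) - x k + r k (f j) * x k" for k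
        by (simp add: Y_def algebra_simps)
      then show ?thesis using j by (simp add: sum.distrib sum_subtractf)
    qed
    have Fx: "(\<Sum>w\<in>W. F w j * x w) = (\<Sum>w\<in>W. r j w * x w) - (\<Sum>k<n. Y k j * x (f k))" for x
    proof -
      have "(\<Sum>w\<in>W. (\<Sum>k<n. if f k = w then Y k j else 0) * x w)
          = (\<Sum>k<n. \<Sum>w\<in>W. if f k = w then Y k j * x w else 0)"
        unfolding sum_distrib_right by (subst sum.swap) (intro sum.cong refl, simp)
      also have "\<dots> = (\<Sum>k<n. Y k j * x (f k))"
        using fin(2) f by (intro sum.cong refl) (simp add: sum.delta')
      finally show ?thesis by (simp add: F_def left_diff_distrib sum_subtractf)
    qed
    have "(\<Sum>w\<in>W. F w j) = - ?D"
      using Fx[of "\<lambda>_. 1"] Yg[of "\<lambda>_. 1"] by (simp add: d_def)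
    then have "(\<Sum>w\<in>W. F w j * (U (f j) i - U w i)) =
        - ?D * U (f j) i - (\<Sum>w\<in>W. r j w * U w i) + (\<Sum>k<n. Y k j * U (f k) i)"
      using Fx[of "\<lambda>w. U w i"] by (simp add: right_diff_distrib sum_subtractf sum_distrib_right[symmetric])
    moreover have "(\<Sum>k<n. Y k j * g k i) = (\<Sum>k<n. Y k j * U (h k) i) - (\<Sum>k<n. Y k j * U (f k) i)"
      by (simp add: g_def right_diff_distrib sum_subtractf)
    ultimately show ?thesis using lhs Yg[of "\<lambda>k. U (h k) i"] by simp
  qed
  have col: "(\<Sum>i<n. l i * g j i * z j i) \<le> real n + d j" if j: "j < n" for j
  proof -
    have "(\<Sum>i<n. l i * g j i * z j i) =
        (\<Sum>i<n. (\<Sum>k<n. Y k j * g k i) * z j i) + (\<Sum>i<n. (\<Sum>w\<in>W. F w j * (U (f j) i - U w i)) * z j i)"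
      unfolding sum.distrib[symmetric] using j by (intro sum.cong refl) (simp add: decomp distrib_right)
    moreover have "(\<Sum>i<n. (\<Sum>k<n. Y k j * g k i) * z j i) = Y j j"
    proof -
      have "(\<Sum>i<n. (\<Sum>k<n. Y k j * g k i) * z j i) = (\<Sum>k<n. Y k j * (\<Sum>i<n. g k i * z j i))"
        unfolding sum_distrib_right sum_distrib_left by (subst sum.swap) (simp add: mult.assoc)
      also have "\<dots> = (\<Sum>k<n. if k = j then Y k j else 0)"
        using dual j by (intro sum.cong) (auto simp: g_def)
      finally show ?thesis using j by simp
    qed
    moreover have "(\<Sum>i<n. (\<Sum>w\<in>W. F w j * (U (f j) i - U w i)) * z j i) \<le> 0"
    proof -
      have "(\<Sum>i<n. (\<Sum>w\<in>W. F w j * (U (f j) i - U w i)) * z j i)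
          = (\<Sum>w\<in>W. F w j * (\<Sum>i<n. (U (f j) i - U w i) * z j i))"
        unfolding sum_distrib_right sum_distrib_left by (subst sum.swap) (simp add: mult.assoc)
      also have "\<dots> \<le> 0"
      proof (intro sum_nonpos)
        fix w assume "w \<in> W"
        then show "F w j * (\<Sum>i<n. (U (f j) i - U w i) * z j i) \<le> 0"
          using Fnn[of w j] opt j by (cases "w = f j") (auto simp: mult_nonneg_nonpos)
      qed
      finally show ?thesis .
    qed
    moreover have "Y j j \<le> real n + d j" by (simp add: Y_def r_def)
    ultimately show ?thesis by linarith
  qed
  have "(\<Sum>i<n. l i) = (\<Sum>i<n. l i * (\<Sum>j<n. g j i * z j i))"
    using tr by (simp add: g_def)
  also have "\<dots> = (\<Sum>j<n. \<Sum>i<n. l i * g j i * z j i)"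
    unfolding sum_distrib_left by (subst sum.swap) (simp add: mult.assoc)
  also have "\<dots> \<le> (\<Sum>j<n. real n + d j)" using col by (intro sum_mono) auto
  also have "\<dots> = real n * n + (\<Sum>h\<in>H. \<Sum>w\<in>W. of_bool (R h w))"
    by (simp add: sum.distrib d_def r_def sumH)
  finally show ?thesis .
qed

text \<open>
The system is padded with zero rows to a singular square system.
\<close>

lemma homogeneous_system_nontrivial:
  fixes c :: "'i \<Rightarrow> 'h \<Rightarrow> real"
  assumes fin: "finite I" "finite H" and lt: "card H < card I"
  shows "\<exists>z. (\<exists>i\<in>I. z i \<noteq> 0) \<and> (\<forall>h\<in>H. (\<Sum>i\<in>I. z i * c i h) = 0)"
proof -
  define n where "n = card I"
  obtain p where p: "bij_betw p {..<n} I"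
    using ex_bij_betw_nat_finite[OF fin(1)] by (auto simp: n_def lessThan_atLeast0)
  obtain g where g: "bij_betw g {..<card H} H"
    using ex_bij_betw_nat_finite[OF fin(2)] by (auto simp: lessThan_atLeast0)
  define A where "A = row_mat n (\<lambda>j i. if j < card H then c (p i) (g j) else 0)"
  have A: "A \<in> carrier_mat n n" unfolding A_def by (rule row_mat_carrier)
  have "det A = 0"
    using lt by (subst laplace_expansion_row[OF A, of "card H"]) (auto simp: A_def row_mat_def n_def)
  then obtain v where v: "v \<in> carrier_vec n" "v \<noteq> 0\<^sub>v n" "A *\<^sub>v v = 0\<^sub>v n"
    using det_0_iff_vec_prod_zero[OF A] by auto
  define z where "z = (\<lambda>i. v $ (the_inv_into {..<n} p i))"
  have zp: "z (p i) = v $ i" if "i < n" for i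
    using p that by (simp add: z_def bij_betw_def the_inv_into_f_f)
  obtain i0 where "i0 < n" "v $ i0 \<noteq> 0"
    using v(1,2) by (metis carrier_vecD eq_vecI index_zero_vec(1,2))
  then have "\<exists>i\<in>I. z i \<noteq> 0" using p zp by (intro bexI[of _ "p i0"]) (auto simp: bij_betw_def)
  moreover have "(\<Sum>i\<in>I. z i * c i h) = 0" if "h \<in> H" for h
  proof -
    obtain j where j: "j < card H" "h = g j" using g \<open>h \<in> H\<close> by (auto simp: bij_betw_def)
    have "(\<Sum>i\<in>I. z i * c i h) = (\<Sum>i<n. z (p i) * c (p i) h)"
      using sum.reindex_bij_betw[OF p, of "\<lambda>i. z i * c i h"] by simp
    also have "\<dots> = (A *\<^sub>v v) $ j"
      using j lt v(1) by (auto simp: A_def row_mat_def scalar_prod_def n_def[symmetric] zp row_def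
          lessThan_atLeast0 mult.commute intro!: sum.cong)
    also have "\<dots> = 0" using j lt by (simp add: v(3) n_def)
    finally show ?thesis .
  qed
  ultimately show ?thesis by blast
qed

definition cross_edges :: "'v set \<Rightarrow> 'v set \<Rightarrow> ('v \<Rightarrow> 'v \<Rightarrow> bool) \<Rightarrow> real" where
  "cross_edges H W R = (\<Sum>h\<in>H. \<Sum>w\<in>W. of_bool (R h w))"

definition split_matrix :: "'v set \<Rightarrow> 'v set \<Rightarrow> ('v \<Rightarrow> 'v \<Rightarrow> bool) \<Rightarrow> 'v \<Rightarrow> 'v \<Rightarrow> real" where
  "split_matrix H W R s t =
     (if s = t then if s \<in> H then real (card H) + (\<Sum>w\<in>W. of_bool (R s w)) else (\<Sum>h\<in>H. of_bool (R h s)) else 0)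
     - of_bool (s \<in> H \<and> t \<in> H) - of_bool (s \<in> H \<and> t \<in> W \<and> R s t) - of_bool (s \<in> W \<and> t \<in> H \<and> R t s)"

lemma split_matrix_symmetric: "split_matrix H W R s t = split_matrix H W R t s"
  by (auto simp: split_matrix_def)

lemma mat_op_split_matrix:
  assumes fin: "finite H" "finite W" and disj: "H \<inter> W = {}" and v: "v \<in> H \<union> W"
  shows "mat_op (H \<union> W) (split_matrix H W R) x v = split_laplacian H W R x v"
proof -
  have part: "(\<Sum>t\<in>H \<union> W. of_bool (t \<in> A \<and> P t) * x t) = (\<Sum>t\<in>A. of_bool (P t) * x t)"
    if "A \<subseteq> H \<union> W" for A and P :: "'a \<Rightarrow> bool"
  proof -
    have "(\<Sum>t\<in>H \<union> W. of_bool (t \<in> A \<and> P t) * x t) = (\<Sum>t\<in>A. of_bool (t \<in> A \<and> P t) * x t)"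
      using fin that by (intro sum.mono_neutral_right) auto
    then show ?thesis by simp
  qed
  note partH = part[OF Un_upper1] and partW = part[OF Un_upper2]
  show ?thesis
  proof (cases "v \<in> H")
    case True
    then have "v \<notin> W" using disj by auto
    have "mat_op (H \<union> W) (split_matrix H W R) x v =
      (\<Sum>t\<in>H \<union> W. (if v = t then (real (card H) + (\<Sum>w\<in>W. of_bool (R v w))) * x t else 0)
         - of_bool (t \<in> H \<and> True) * x t - of_bool (t \<in> W \<and> R v t) * x t)"
      unfolding mat_op_def using True \<open>v \<notin> W\<close>
      by (intro sum.cong refl) (auto simp: split_matrix_def algebra_simps)
    also have "\<dots> = (real (card H) + (\<Sum>w\<in>W. of_bool (R v w))) * x v - sum x H - (\<Sum>w\<in>W. of_bool (R v w) * x w)"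
      unfolding sum_subtractf partH partW using fin v by simp
    finally show ?thesis using True
      by (simp add: split_laplacian_def right_diff_distrib sum_subtractf sum_distrib_right distrib_right)
  next
    case False
    then have "v \<in> W" using v by auto
    have "mat_op (H \<union> W) (split_matrix H W R) x v =
      (\<Sum>t\<in>H \<union> W. (if v = t then (\<Sum>h\<in>H. of_bool (R h v)) * x t else 0) - of_bool (t \<in> H \<and> R t v) * x t)"
      unfolding mat_op_def using False \<open>v \<in> W\<close>
      by (intro sum.cong refl) (auto simp: split_matrix_def algebra_simps)
    also have "\<dots> = (\<Sum>h\<in>H. of_bool (R h v)) * x v - (\<Sum>h\<in>H. of_bool (R h v) * x h)"
      unfolding sum_subtractf partH using fin v by simp
    finally show ?thesis using False
      by (simp add: split_laplacian_def right_diff_distrib sum_subtractf sum_distrib_right)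
  qed
qed

text \<open>
The complement of a split graph is the split graph with clique \<open>W\<close> and independent set \<open>H\<close>, and the two
Laplacians add up to that of the complete graph.
\<close>

lemma split_laplacian_complement:
  assumes fin: "finite H" "finite W" and disj: "H \<inter> W = {}" and v: "v \<in> H \<union> W"
  shows "split_laplacian W H (\<lambda>w h. \<not> R h w) x v =
    real (card (H \<union> W)) * x v - sum x (H \<union> W) - split_laplacian H W R x v"
proof -
  have cU: "card (H \<union> W) = card H + card W" and sU: "sum x (H \<union> W) = sum x H + sum x W"
    using fin disj by (simp_all add: card_Un_disjoint sum.union_disjoint)
  have nb: "(\<Sum>t\<in>A. of_bool (\<not> P t) * (x v - x t)) = real (card A) * x v - sum x A - (\<Sum>t\<in>A. of_bool (P t) * (x v - x t))"
    for A and P :: "'a \<Rightarrow> bool"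
  proof -
    have "of_bool (\<not> P t) * (x v - x t) = (x v - x t) - of_bool (P t) * (x v - x t)" for t by auto
    then show ?thesis by (simp add: sum_subtractf)
  qed
  show ?thesis
  proof (cases "v \<in> H")
    case True
    then have "v \<notin> W" using disj by auto
    with True show ?thesis by (simp add: split_laplacian_def nb cU sU) (simp add: algebra_simps)
  next
    case False
    then have "v \<in> W" using v by auto
    with False show ?thesis by (simp add: split_laplacian_def nb cU sU) (simp add: algebra_simps)
  qed
qed

lemma split_form:
  assumes fin: "finite H" "finite W" and disj: "H \<inter> W = {}"
  shows "ip (H \<union> W) x (split_laplacian H W R x) =
    real (card H) * (\<Sum>h\<in>H. (x h)\<^sup>2) - (sum x H)\<^sup>2 + (\<Sum>h\<in>H. \<Sum>w\<in>W. of_bool (R h w) * (x h - x w)\<^sup>2)"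
proof -
  have "ip (H \<union> W) x (split_laplacian H W R x) =
    (\<Sum>h\<in>H. x h * (real (card H) * x h - sum x H + (\<Sum>w\<in>W. of_bool (R h w) * (x h - x w))))
    + (\<Sum>w\<in>W. x w * (\<Sum>h\<in>H. of_bool (R h w) * (x w - x h)))"
  proof -
    have "split_laplacian H W R x w = (\<Sum>h\<in>H. of_bool (R h w) * (x w - x h))" if "w \<in> W" for w
      using that disj by (auto simp: split_laplacian_def)
    then show ?thesis unfolding ip_def
      by (subst sum.union_disjoint[OF fin disj]) (simp add: split_laplacian_def)
  qed
  also have "(\<Sum>w\<in>W. x w * (\<Sum>h\<in>H. of_bool (R h w) * (x w - x h)))
      = (\<Sum>h\<in>H. \<Sum>w\<in>W. of_bool (R h w) * (x w * (x w - x h)))"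
    unfolding sum_distrib_left by (subst sum.swap) (simp add: mult.left_commute)
  also have "(\<Sum>h\<in>H. x h * (real (card H) * x h - sum x H + (\<Sum>w\<in>W. of_bool (R h w) * (x h - x w))))
      = real (card H) * (\<Sum>h\<in>H. (x h)\<^sup>2) - (sum x H)\<^sup>2 + (\<Sum>h\<in>H. \<Sum>w\<in>W. of_bool (R h w) * (x h * (x h - x w)))"
  proof -
    have "x h * (real (card H) * x h - sum x H + (\<Sum>w\<in>W. of_bool (R h w) * (x h - x w)))
       = real (card H) * (x h)\<^sup>2 - x h * sum x H + (\<Sum>w\<in>W. of_bool (R h w) * (x h * (x h - x w)))" for h
      by (simp add: distrib_left right_diff_distrib' sum_distrib_left power2_eq_square mult.left_commute)
    moreover have "(\<Sum>h\<in>H. x h * sum x H) = (sum x H)\<^sup>2"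
      by (simp only: sum_distrib_right[symmetric] power2_eq_square)
    ultimately show ?thesis by (simp add: sum.distrib sum_subtractf sum_distrib_left)
  qed
  finally show ?thesis
    by (simp add: sum.distrib[symmetric] distrib_left[symmetric] power2_eq_square algebra_simps)
qed

lemma trace_eq_eigenvalue_sum:
  assumes fin: "finite S" "finite I" "orthonormal_on S I u" "card I = card S"
    and eig: "\<And>i s. i \<in> I \<Longrightarrow> s \<in> S \<Longrightarrow> mat_op S a (u i) s = l i * u i s"
  shows "(\<Sum>i\<in>I. l i) = (\<Sum>s\<in>S. a s s)"
proof -
  have "(\<Sum>i\<in>I. l i) = (\<Sum>i\<in>I. ip S (mat_op S a (u i)) (u i))"
  proof (intro sum.cong refl)
    fix i assume i: "i \<in> I"
    have "ip S (mat_op S a (u i)) (u i) = ip S (\<lambda>s. l i * u i s) (u i)"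
      by (rule ip_cong) (auto simp: eig i)
    then show "l i = ip S (mat_op S a (u i)) (u i)"
      using fin(3) i by (simp add: ip_scale_left orthonormal_onD)
  qed
  also have "\<dots> = (\<Sum>s\<in>S. \<Sum>i\<in>I. ip S (a s) (u i) * u i s)"
    unfolding ip_def mat_op_def by (rule sum.swap)
  also have "\<dots> = (\<Sum>s\<in>S. a s s)"
    using orthonormal_basis_expansion[OF fin] by (intro sum.cong refl) metis
  finally show ?thesis .
qed

context
  fixes H W :: "'v set" and R :: "'v \<Rightarrow> 'v \<Rightarrow> bool"
  assumes fin: "finite H" "finite W" and disj: "H \<inter> W = {}"
begin

text \<open>
On vectors that vanish on \<open>H\<close> the Laplacian is diagonal with entries at most \<open>card H\<close>. More than
\<open>card H\<close> eigenvectors would have a nonzero combination of this kind.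
\<close>

lemma few_large_split_eigenvalues:
  assumes I: "finite I" and on: "orthonormal_on (H \<union> W) I u"
    and eig: "\<And>i v. i \<in> I \<Longrightarrow> v \<in> H \<union> W \<Longrightarrow> split_laplacian H W R (u i) v = l i * u i v"
    and large: "\<And>i. i \<in> I \<Longrightarrow> l i > card H"
  shows "card I \<le> card H"
proof (rule ccontr)
  assume "\<not> ?thesis"
  then obtain z where z: "\<exists>i\<in>I. z i \<noteq> 0" "\<forall>h\<in>H. (\<Sum>i\<in>I. z i * u i h) = 0"
    using homogeneous_system_nontrivial[OF I fin(1), of u] by auto
  let ?S = "H \<union> W"
  define x where "x = (\<lambda>v. \<Sum>i\<in>I. z i * u i v)"
  have xH: "h \<in> H \<Longrightarrow> x h = 0" for h using z(2) by (simp add: x_def)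
  have finS: "finite ?S" using fin by simp
  have ipx: "ip ?S x (u i) = z i" if "i \<in> I" for i
  proof -
    have "ip ?S x (u i) = (\<Sum>k\<in>I. if k = i then z k else 0)"
      unfolding x_def ip_sum_left using on that by (intro sum.cong) (auto simp: orthonormal_onD)
    then show ?thesis using that I by simp
  qed
  have "ip ?S x (split_laplacian H W R x) = ip ?S x (mat_op ?S (split_matrix H W R) x)"
    by (rule ip_cong) (auto simp: mat_op_split_matrix[OF fin disj])
  also have "mat_op ?S (split_matrix H W R) x = (\<lambda>v. \<Sum>i\<in>I. z i * mat_op ?S (split_matrix H W R) (u i) v)"
    unfolding mat_op_def x_def sum_distrib_left by (subst sum.swap) (simp add: mult.left_commute)
  also have "ip ?S x \<dots> = (\<Sum>i\<in>I. z i * ip ?S x (mat_op ?S (split_matrix H W R) (u i)))"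
    by (rule ip_sum_right)
  also have "\<dots> = (\<Sum>i\<in>I. l i * (z i)\<^sup>2)"
  proof (intro sum.cong refl)
    fix i assume i: "i \<in> I"
    have "ip ?S x (mat_op ?S (split_matrix H W R) (u i)) = ip ?S x (\<lambda>v. l i * u i v)"
      by (rule ip_cong) (auto simp: mat_op_split_matrix[OF fin disj] eig i)
    then show "z i * ip ?S x (mat_op ?S (split_matrix H W R) (u i)) = l i * (z i)\<^sup>2"
      by (simp add: ip_scale_right ipx i power2_eq_square)
  qed
  finally have q: "ip ?S x (split_laplacian H W R x) = (\<Sum>i\<in>I. l i * (z i)\<^sup>2)" .
  have "(\<Sum>i\<in>I. card H * (z i)\<^sup>2) < (\<Sum>i\<in>I. l i * (z i)\<^sup>2)"
  proof (rule sum_strict_mono_ex1[OF I])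
    show "\<forall>i\<in>I. card H * (z i)\<^sup>2 \<le> l i * (z i)\<^sup>2"
      using large by (intro ballI mult_right_mono) (auto intro: less_imp_le)
    obtain i where "i \<in> I" "z i \<noteq> 0" using z(1) by auto
    then show "\<exists>i\<in>I. card H * (z i)\<^sup>2 < l i * (z i)\<^sup>2"
      using large by (intro bexI[of _ i] mult_strict_right_mono) auto
  qed
  also have "\<dots> = (\<Sum>h\<in>H. \<Sum>w\<in>W. of_bool (R h w) * (x w)\<^sup>2)"
    unfolding q[symmetric] split_form[OF fin disj] by (simp add: xH)
  also have "\<dots> \<le> (\<Sum>h\<in>H. \<Sum>w\<in>W. (x w)\<^sup>2)" by (intro sum_mono) auto
  also have "\<dots> = card H * (\<Sum>w\<in>W. (x w)\<^sup>2)" by simp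
  also have "(\<Sum>w\<in>W. (x w)\<^sup>2) = ip ?S x x"
    unfolding ip_def using xH by (subst sum.union_disjoint[OF fin disj]) (simp add: power2_eq_square)
  also have "\<dots> = (\<Sum>i\<in>I. (z i)\<^sup>2)"
  proof -
    have "ip ?S x x = (\<Sum>i\<in>I. z i * ip ?S x (u i))" by (subst (2) x_def) (rule ip_sum_right)
    then show ?thesis by (simp add: ipx power2_eq_square)
  qed
  finally show False by (simp add: sum_distrib_left)
qed

lemma split_eigenvalue_sum_le':
  assumes ne: "W \<noteq> {}" and I: "finite I" "card I = card H" and on: "orthonormal_on (H \<union> W) I u"
    and eig: "\<And>i v. i \<in> I \<Longrightarrow> v \<in> H \<union> W \<Longrightarrow> split_laplacian H W R (u i) v = l i * u i v"
    and ort: "\<And>i. i \<in> I \<Longrightarrow> sum (u i) (H \<union> W) = 0"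
  shows "(\<Sum>i\<in>I. l i) \<le> real (card H) * card H + cross_edges H W R"
proof -
  obtain p where p: "bij_betw p {..<card H} I"
    using ex_bij_betw_nat_finite[OF I(1)] I(2) by (auto simp: lessThan_atLeast0)
  have pI: "p i \<in> I" if "i < card H" for i using p that by (auto simp: bij_betw_def)
  have "(\<Sum>i<card H. l (p i)) \<le> real (card H) * card H + (\<Sum>h\<in>H. \<Sum>w\<in>W. of_bool (R h w))"
  proof (rule split_eigenvalue_sum_le[OF fin disj ne refl, where u = "u \<circ> p"])
    show "orthonormal_on (H \<union> W) {..<card H} (u \<circ> p)"
      using on p by (auto simp: orthonormal_on_def bij_betw_def inj_on_def)
  qed (use pI eig ort in auto)
  then show ?thesis using sum.reindex_bij_betw[OF p, of l] by (simp add: cross_edges_def)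
qed

end

text \<open>
The number of eigenvalues above \<open>N = card H\<close> is at most \<open>N\<close>. If it is \<open>N\<close>, the claim is
\<open>split_eigenvalue_sum_le\<close>. If it is smaller, then at least \<open>M = card W\<close> of the eigenvalues on the
complement of the constants are at most \<open>N\<close>, that is, at least \<open>M\<close> eigenvalues of the complementary
split graph are at least \<open>M\<close>; at most \<open>M\<close> of them are larger, so exactly \<open>M\<close> can be selected among
which all the larger ones are, and the same lemma for the complement bounds their sum. The trace
turns this into the claim.
\<close>

lemma split_excess_le:
  assumes fin: "finite H" "finite W" and disj: "H \<inter> W = {}"
  shows "\<exists>u l. orthonormal_on (H \<union> W) {..<card (H \<union> W)} u \<and>
     (\<forall>i<card (H \<union> W). \<forall>v\<in>H \<union> W. split_laplacian H W R (u i) v = l i * u i v) \<and>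
     (\<Sum>i<card (H \<union> W). max 0 (l i - card H)) \<le> cross_edges H W R"
proof (cases "H \<union> W = {}")
  case True
  then show ?thesis by (auto simp: orthonormal_on_def cross_edges_def)
next
  case False
  let ?S = "H \<union> W" and ?n = "card (H \<union> W)" and ?N = "card H" and ?M = "card W"
  let ?a = "split_matrix H W R" and ?R' = "\<lambda>w h. \<not> R h w"
  have finS: "finite ?S" using fin by simp
  have n: "?n = ?N + ?M" using fin disj by (simp add: card_Un_disjoint)
  have npos: "?n > 0" using False finS by (simp add: card_gt_0_iff)
  define u0 :: "nat \<Rightarrow> 'a \<Rightarrow> real" where "u0 = (\<lambda>_ _. 1 / sqrt ?n)"
  have "orthonormal_on ?S {..<1} u0"
    using npos by (simp add: orthonormal_on_def u0_def ip_def)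
  moreover have "mat_op ?S ?a (u0 i) s = 0 * u0 i s" if "i < 1" "s \<in> ?S" for i s
    using that by (simp add: mat_op_split_matrix[OF fin disj] split_laplacian_def u0_def)
  ultimately obtain u l where u0: "\<forall>i<1. u i = u0 i \<and> l i = (0::real)"
    and on: "orthonormal_on ?S {..<?n} u"
    and eigm: "\<forall>i<?n. \<forall>s\<in>?S. mat_op ?S ?a (u i) s = l i * u i s"
    using extend_to_eigenbasis[where a = ?a and k = 1 and u = u0 and l = "\<lambda>_. 0", OF finS split_matrix_symmetric] by blast
  have eig: "split_laplacian H W R (u i) v = l i * u i v" if "i < ?n" "v \<in> ?S" for i v
    using eigm that by (simp add: mat_op_split_matrix[OF fin disj])
  have ort: "sum (u i) ?S = 0" if "0 < i" "i < ?n" for i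
  proof -
    have "ip ?S (u 0) (u i) = 0" using on that npos by (simp add: orthonormal_onD)
    then show ?thesis using u0 npos by (simp add: ip_def u0_def sum_divide_distrib[symmetric])
  qed
  have eig': "split_laplacian W H ?R' (u i) v = (real ?n - l i) * u i v"
    if "0 < i" "i < ?n" "v \<in> ?S" for i v
    using that by (simp add: split_laplacian_complement[OF fin disj] eig ort left_diff_distrib)
  define I where "I = {i. i < ?n \<and> l i > ?N}"
  have "0 \<notin> I" using u0 by (simp add: I_def)
  then have I: "finite I" "I \<subseteq> {1..<?n}" by (auto simp: I_def Suc_le_eq) (metis gr0I mem_Collect_eq)+
  have onI: "orthonormal_on ?S A u" if "A \<subseteq> {1..<?n}" for A
    by (rule orthonormal_on_subset[OF on]) (use that in auto)
  have cI: "card I \<le> ?N"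
    by (rule few_large_split_eigenvalues[OF fin disj I(1) onI[OF I(2)], where R = R and l = l])
       (auto simp: I_def eig)
  have sumI: "(\<Sum>i<?n. max 0 (l i - card H)) = (\<Sum>i\<in>I. l i - ?N)"
    by (rule sum.mono_neutral_cong_right) (auto simp: I_def)
  have "(\<Sum>i\<in>I. l i - ?N) \<le> cross_edges H W R"
  proof (cases "card I = ?N")
    case True
    have "card I \<le> card {1..<?n}" using I by (intro card_mono) auto
    then have "W \<noteq> {}" using True n npos by auto
    have "(\<Sum>i\<in>I. l i) \<le> real ?N * ?N + cross_edges H W R"
      using I by (intro split_eigenvalue_sum_le'[OF fin disj \<open>W \<noteq> {}\<close> I(1) True onI[OF I(2)]])
        (auto simp: eig ort)
    then show ?thesis using True by (simp add: sum_subtractf)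
  next
    case False
    then have "H \<noteq> {}" and less: "card I < ?N" using cI by auto
    define J where "J = {1..<?n} - I"
    have J: "finite J" "J \<subseteq> {1..<?n}" by (auto simp: J_def)
    have cJ: "card J + card I = ?n - 1"
      using I card_Diff_subset[OF I] card_mono[OF _ I(2)] by (simp add: J_def)
    \<comment> \<open>\<open>J\<close> indexes the remaining eigenvectors orthogonal to the constants, \<open>J1\<close> those whose eigenvalue for
      the complementary graph exceeds \<open>M\<close>; the others have exactly the eigenvalue \<open>M\<close> there.\<close>
    define J1 where "J1 = {i\<in>J. real ?n - l i > ?M}"
    have J1: "finite J1" "J1 \<subseteq> J" using J by (auto simp: J1_def)
    have disj': "W \<inter> H = {}" and US: "W \<union> H = ?S" using disj by auto
    have "card J1 \<le> ?M"
      using J J1 onI[of J1] eig'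
      by (intro few_large_split_eigenvalues[OF fin(2,1) disj' J1(1), where R = ?R' and l = "\<lambda>i. real ?n - l i" and u = u])
         (auto simp: US J1_def)
    moreover have "?M \<le> card J" using cJ less n by linarith
    ultimately obtain J2 where J2: "J1 \<subseteq> J2" "J2 \<subseteq> J" "card J2 = ?M"
      using J J1 by (metis exists_subset_between)
    have finJ2: "finite J2" using J J2 finite_subset by blast
    have "(\<Sum>i\<in>J2. real ?n - l i) \<le> real ?M * ?M + cross_edges W H ?R'"
      using J J2 onI[of J2] eig' ort
      by (intro split_eigenvalue_sum_le'[OF fin(2,1) disj' \<open>H \<noteq> {}\<close> finJ2 J2(3), where u = u])
         (auto simp: US)
    then have "(\<Sum>i\<in>J2. real ?n - l i - ?M) \<le> cross_edges W H ?R'"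
      using J2(3) by (simp add: sum_subtractf)
    moreover have "(\<Sum>i\<in>J. real ?n - l i - ?M) = (\<Sum>i\<in>J2. real ?n - l i - ?M)"
    proof (rule sum.mono_neutral_right[OF J(1) J2(2)], rule ballI)
      fix i assume "i \<in> J - J2"
      then have "i \<in> J" "i \<notin> J1" using J2 by auto
      then have "\<not> (real ?n - l i > ?M)" "l i \<le> ?N" by (auto simp: J1_def J_def I_def)
      then show "real ?n - l i - ?M = 0" using n by simp
    qed
    moreover have "cross_edges W H ?R' = real ?N * ?M - cross_edges H W R"
    proof -
      have "cross_edges W H ?R' = (\<Sum>h\<in>H. \<Sum>w\<in>W. 1 - of_bool (R h w))"
        unfolding cross_edges_def by (subst sum.swap) (simp add: of_bool_not_iff)
      then show ?thesis by (simp add: cross_edges_def sum_subtractf)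
    qed
    ultimately have comp: "real ?N * card J - sum l J \<le> real ?N * ?M - cross_edges H W R"
      using n by (simp add: sum_subtractf algebra_simps)
    have "sum l {..<?n} = (\<Sum>s\<in>?S. ?a s s)"
      by (rule trace_eq_eigenvalue_sum[OF finS _ on]) (use eigm in auto)
    also have "\<dots> = (\<Sum>s\<in>H. ?a s s) + (\<Sum>s\<in>W. ?a s s)" by (rule sum.union_disjoint[OF fin disj])
    also have "(\<Sum>s\<in>H. ?a s s) = (\<Sum>s\<in>H. real ?N - 1 + (\<Sum>w\<in>W. of_bool (R s w)))"
      using disj by (intro sum.cong refl) (auto simp: split_matrix_def)
    also have "(\<Sum>s\<in>W. ?a s s) = (\<Sum>s\<in>W. \<Sum>h\<in>H. of_bool (R h s))"
      using disj by (intro sum.cong refl) (auto simp: split_matrix_def)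
    also have "(\<Sum>s\<in>W. \<Sum>h\<in>H. of_bool (R h s)) = cross_edges H W R"
      unfolding cross_edges_def by (rule sum.swap)
    finally have "sum l {..<?n} = real ?N * (real ?N - 1) + 2 * cross_edges H W R"
      by (simp add: sum.distrib cross_edges_def)
    moreover have "sum l {..<?n} = sum l I + sum l J"
    proof -
      have "{..<?n} = insert 0 (I \<union> J)" using I npos by (auto simp: J_def)
      moreover have "0 \<notin> I \<union> J" "I \<inter> J = {}" using I by (auto simp: J_def)
      ultimately show ?thesis using I J u0 by (simp add: sum.union_disjoint)
    qed
    ultimately have "sum l I \<le> real ?N * (real ?N - 1) + cross_edges H W R + real ?N * ?M - real ?N * card J"
      using comp by simp
    also have "\<dots> = cross_edges H W R + real ?N * card I"
    proof -
      have "real ?N + ?M = real (card I) + card J + 1" using cJ n npos by linarith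
      then have J_eq: "real (card J) = real ?N + ?M - card I - 1" by simp
      show ?thesis unfolding J_eq by (simp add: algebra_simps)
    qed
    finally show ?thesis by (simp add: sum_subtractf mult.commute)
  qed
  then show ?thesis using on eig sumI by (intro exI[of _ u] exI[of _ l]) auto
qed

text \<open>
The excess over \<open>card H\<close> of the quadratic form, summed over any orthonormal family, is at most the sum of
the positive excesses of the eigenvalues.
\<close>

lemma split_form_sum_le:
  assumes fin: "finite H" "finite W" and disj: "H \<inter> W = {}"
    and K: "finite K" "orthonormal_on (H \<union> W) K x"
  shows "(\<Sum>k\<in>K. ip (H \<union> W) (x k) (split_laplacian H W R (x k)) - card H) \<le> cross_edges H W R"
proof -
  let ?S = "H \<union> W" and ?n = "card (H \<union> W)" and ?N = "card H"
  obtain u l where on: "orthonormal_on ?S {..<?n} u"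
    and eig: "\<forall>i<?n. \<forall>v\<in>?S. split_laplacian H W R (u i) v = l i * u i v"
    and ex: "(\<Sum>i<?n. max 0 (l i - ?N)) \<le> cross_edges H W R"
    using split_excess_le[OF fin disj] by blast
  have finS: "finite ?S" using fin by simp
  note pars = parseval[OF finS _ on _]
  have "ip ?S (x k) (split_laplacian H W R (x k)) - ?N = (\<Sum>i<?n. (l i - ?N) * (ip ?S (u i) (x k))\<^sup>2)"
    if k: "k \<in> K" for k
  proof -
    have "ip ?S (split_laplacian H W R (x k)) (u i) = l i * ip ?S (x k) (u i)" if i: "i < ?n" for i
    proof -
      have "ip ?S (split_laplacian H W R (x k)) (u i) = ip ?S (mat_op ?S (split_matrix H W R) (x k)) (u i)"
        by (rule ip_cong) (auto simp: mat_op_split_matrix[OF fin disj])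
      also have "\<dots> = ip ?S (x k) (mat_op ?S (split_matrix H W R) (u i))"
        by (rule mat_op_symmetric[OF split_matrix_symmetric, symmetric])
      also have "\<dots> = ip ?S (x k) (\<lambda>v. l i * u i v)"
        by (rule ip_cong) (use eig i in \<open>auto simp: mat_op_split_matrix[OF fin disj]\<close>)
      finally show ?thesis by (simp add: ip_scale_right)
    qed
    then have "ip ?S (x k) (split_laplacian H W R (x k)) = (\<Sum>i<?n. l i * (ip ?S (u i) (x k))\<^sup>2)"
      by (subst pars[OF finite_lessThan card_lessThan], intro sum.cong refl) (simp add: power2_eq_square ip_commute[of ?S "u _" "x k"] mult_ac)
    moreover have "1 = (\<Sum>i<?n. (ip ?S (u i) (x k))\<^sup>2)"
      using orthonormal_onD[OF K(2) k k] pars[OF finite_lessThan card_lessThan, of "x k" "x k"]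
      by (simp add: power2_eq_square ip_commute[of ?S "u _" "x k"])
    then have "real ?N = (\<Sum>i<?n. ?N * (ip ?S (u i) (x k))\<^sup>2)"
      by (simp add: sum_distrib_left[symmetric])
    ultimately show ?thesis by (simp add: left_diff_distrib sum_subtractf)
  qed
  then have "(\<Sum>k\<in>K. ip ?S (x k) (split_laplacian H W R (x k)) - ?N)
      = (\<Sum>i<?n. (l i - ?N) * (\<Sum>k\<in>K. (ip ?S (u i) (x k))\<^sup>2))"
    by (simp add: sum_distrib_left) (rule sum.swap)
  also have "\<dots> \<le> (\<Sum>i<?n. max 0 (l i - ?N))"
  proof (intro sum_mono)
    fix i assume i: "i \<in> {..<?n}"
    have p: "0 \<le> (\<Sum>k\<in>K. (ip ?S (u i) (x k))\<^sup>2)" "(\<Sum>k\<in>K. (ip ?S (u i) (x k))\<^sup>2) \<le> 1"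
      using bessel[OF K, of "u i"] on i by (auto simp: orthonormal_onD intro: sum_nonneg)
    show "(l i - ?N) * (\<Sum>k\<in>K. (ip ?S (u i) (x k))\<^sup>2) \<le> max 0 (l i - ?N)"
    proof (cases "l i \<ge> ?N")
      case True
      then show ?thesis using mult_left_le[OF p(2), of "l i - ?N"] by simp
    next
      case False
      then show ?thesis using mult_nonpos_nonneg[of "l i - ?N", OF _ p(1)] by simp
    qed
  qed
  finally show ?thesis using ex by simp
qed

section \<open>The Grone--Merris inequality\<close>

text \<open>
Each edge is counted once, although the double sum meets it in both directions.
\<close>

definition graph_form :: "'v set \<Rightarrow> ('v \<Rightarrow> 'v \<Rightarrow> bool) \<Rightarrow> ('v \<Rightarrow> real) \<Rightarrow> real" where
  "graph_form V R x = (\<Sum>v\<in>V. \<Sum>w\<in>V. of_bool (R v w) * (x v - x w)\<^sup>2) / 2"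

lemma sum_square_differences:
  fixes x :: "'v \<Rightarrow> real"
  shows "(\<Sum>v\<in>H. \<Sum>w\<in>H. (x v - x w)\<^sup>2) / 2 = real (card H) * (\<Sum>h\<in>H. (x h)\<^sup>2) - (sum x H)\<^sup>2"
proof -
  have "(\<Sum>v\<in>H. \<Sum>w\<in>H. (x v - x w)\<^sup>2) =
      (\<Sum>v\<in>H. real (card H) * (x v)\<^sup>2 + (\<Sum>w\<in>H. (x w)\<^sup>2) - 2 * (x v * sum x H))"
    by (intro sum.cong refl) (simp add: power2_diff sum.distrib sum_subtractf sum_distrib_left mult.assoc)
  also have "\<dots> = 2 * (real (card H) * (\<Sum>h\<in>H. (x h)\<^sup>2)) - 2 * (sum x H * sum x H)"
    by (simp only: sum_subtractf sum.distrib sum_distrib_left[symmetric] sum_distrib_right[symmetric] sum_constant)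
  finally show ?thesis by (simp add: power2_eq_square)
qed

lemma orthonormal_difference_le:
  assumes "finite S" "finite K" "orthonormal_on S K x" "v \<in> S" "w \<in> S" "v \<noteq> w"
  shows "(\<Sum>k\<in>K. (x k v - x k w)\<^sup>2) \<le> 2"
proof -
  define e where "e = (\<lambda>s. (if s = v then 1 else 0) - (if s = w then 1 else (0::real)))"
  have ipe: "ip S e y = y v - y w" for y
    unfolding e_def ip_diff_left using assms by (simp add: ip_indicator)
  show ?thesis using bessel[OF assms(2,3), of e] assms(6) by (simp add: ipe) (simp add: e_def)
qed

text \<open>
The Grone--Merris inequality in variational form. Adding all edges inside \<open>H\<close> only increases the
form, and each edge outside \<open>H\<close> contributes at most \<open>2\<close>, by Bessel applied to the difference of two
indicators; this is what the edge adds to the degrees of its two ends. A split graph remains.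
\<close>

lemma graph_form_sum_le:
  assumes V: "finite V" and H: "H \<subseteq> V"
    and sym: "\<And>v w. R v w \<Longrightarrow> R w v" and irr: "\<And>v. \<not> R v v"
    and K: "finite K" "orthonormal_on V K x"
  shows "(\<Sum>k\<in>K. graph_form V R (x k) - card H) \<le> (\<Sum>w\<in>V - H. \<Sum>v\<in>V. of_bool (R v w))"
proof -
  define W where "W = V - H"
  have fin: "finite H" "finite W" and disj: "H \<inter> W = {}" and HW: "H \<union> W = V"
    using V H finite_subset by (auto simp: W_def)
  define q where "q = (\<lambda>x v w. of_bool (R v w) * (x v - x w :: real)\<^sup>2)"
  have qsym: "q x v w = q x w v" for x v w
    using sym by (auto simp: q_def power2_commute)
  have "graph_form V R y \<le> ip V y (split_laplacian H W R y) + (\<Sum>v\<in>W. \<Sum>w\<in>W. q y v w) / 2" for y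
  proof -
    have "(\<Sum>v\<in>V. \<Sum>w\<in>V. q y v w) = (\<Sum>v\<in>H. \<Sum>w\<in>H. q y v w) + (\<Sum>v\<in>H. \<Sum>w\<in>W. q y v w)
        + ((\<Sum>v\<in>W. \<Sum>w\<in>H. q y v w) + (\<Sum>v\<in>W. \<Sum>w\<in>W. q y v w))"
      unfolding HW[symmetric] sum.union_disjoint[OF fin disj] sum.distrib by simp
    moreover have "(\<Sum>v\<in>W. \<Sum>w\<in>H. q y v w) = (\<Sum>v\<in>H. \<Sum>w\<in>W. q y v w)"
      by (subst sum.swap) (intro sum.cong refl qsym)
    moreover have "(\<Sum>v\<in>H. \<Sum>w\<in>H. q y v w) \<le> (\<Sum>v\<in>H. \<Sum>w\<in>H. (y v - y w)\<^sup>2)"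
      by (intro sum_mono) (simp add: q_def)
    moreover have "graph_form V R y = (\<Sum>v\<in>V. \<Sum>w\<in>V. q y v w) / 2"
      by (simp add: graph_form_def q_def)
    moreover have "ip V y (split_laplacian H W R y) =
        (\<Sum>v\<in>H. \<Sum>w\<in>H. (y v - y w)\<^sup>2) / 2 + (\<Sum>v\<in>H. \<Sum>w\<in>W. q y v w)"
      using split_form[OF fin disj, of y R] unfolding HW sum_square_differences by (simp add: q_def)
    ultimately show ?thesis by simp
  qed
  then have "(\<Sum>k\<in>K. graph_form V R (x k) - card H) \<le>
     (\<Sum>k\<in>K. (ip V (x k) (split_laplacian H W R (x k)) - card H) + (\<Sum>v\<in>W. \<Sum>w\<in>W. q (x k) v w) / 2)"
    by (intro sum_mono) (simp add: algebra_simps)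
  also have "\<dots> = (\<Sum>k\<in>K. ip V (x k) (split_laplacian H W R (x k)) - card H)
      + (\<Sum>k\<in>K. (\<Sum>v\<in>W. \<Sum>w\<in>W. q (x k) v w) / 2)" by (rule sum.distrib)
  also have "(\<Sum>k\<in>K. ip V (x k) (split_laplacian H W R (x k)) - card H) \<le> cross_edges H W R"
    using split_form_sum_le[OF fin disj K(1), of x R] K(2) by (simp add: HW)
  also have "(\<Sum>k\<in>K. (\<Sum>v\<in>W. \<Sum>w\<in>W. q (x k) v w) / 2) = (\<Sum>v\<in>W. \<Sum>w\<in>W. of_bool (R v w) * ((\<Sum>k\<in>K. (x k v - x k w)\<^sup>2) / 2))"
  proof -
    have "(\<Sum>k\<in>K. (\<Sum>v\<in>W. \<Sum>w\<in>W. q (x k) v w) / 2) = (\<Sum>v\<in>W. \<Sum>w\<in>W. \<Sum>k\<in>K. q (x k) v w / 2)"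
      unfolding sum_divide_distrib by (subst sum.swap) (intro sum.cong refl, rule sum.swap)
    then show ?thesis by (simp add: q_def sum_divide_distrib sum_distrib_left)
  qed
  also have "\<dots> \<le> (\<Sum>v\<in>W. \<Sum>w\<in>W. of_bool (R v w))"
  proof (intro sum_mono)
    fix v w assume vw: "v \<in> W" "w \<in> W"
    show "of_bool (R v w) * ((\<Sum>k\<in>K. (x k v - x k w)\<^sup>2) / 2) \<le> of_bool (R v w)"
    proof (cases "R v w")
      case True
      then have "v \<noteq> w" using irr by auto
      then show ?thesis using orthonormal_difference_le[OF V K, of v w] vw HW True by auto
    qed simp
  qed
  also have "cross_edges H W R + (\<Sum>v\<in>W. \<Sum>w\<in>W. of_bool (R v w)) = (\<Sum>w\<in>W. \<Sum>v\<in>V. of_bool (R v w))"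
  proof -
    have "cross_edges H W R = (\<Sum>w\<in>W. \<Sum>v\<in>H. of_bool (R v w))"
      unfolding cross_edges_def by (rule sum.swap)
    moreover have "(\<Sum>v\<in>W. \<Sum>w\<in>W. of_bool (R v w) :: real) = (\<Sum>w\<in>W. \<Sum>v\<in>W. of_bool (R v w))"
      by (rule sum.swap)
    ultimately show ?thesis
      unfolding HW[symmetric] sum.union_disjoint[OF fin disj] sum.distrib by simp
  qed
  finally show ?thesis by (simp add: W_def)
qed

text \<open>
The singular value decomposition of the matrix with rows \<open>b v\<close>: the Gram matrix of the rows has
eigenvectors \<open>u i\<close>, and the \<open>w i\<close> are the corresponding right singular vectors.
\<close>

lemma gram_singular_vectors:
  fixes b :: "'v \<Rightarrow> 'e \<Rightarrow> real"
  assumes V: "finite V" and E: "finite E" and on: "orthonormal_on V {..<card V} u"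
    and eig: "\<And>i v. i < card V \<Longrightarrow> v \<in> V \<Longrightarrow>
      mat_op V (\<lambda>v w. ip E (b v) (b w)) (u i) v = l i * u i v"
  defines "w \<equiv> \<lambda>i e. (1 / sqrt (l i)) * (\<Sum>v\<in>V. u i v * b v e)"
  shows "\<And>i. i < card V \<Longrightarrow> l i = ip E (\<lambda>e. \<Sum>v\<in>V. u i v * b v e) (\<lambda>e. \<Sum>v\<in>V. u i v * b v e)"
    and "orthonormal_on E {i. i < card V \<and> 0 < l i} w"
    and "\<And>z. (\<Sum>v\<in>V. (ip E (b v) z)\<^sup>2) = (\<Sum>i\<in>{i. i < card V \<and> 0 < l i}. l i * (ip E (w i) z)\<^sup>2)"
proof -
  let ?I = "{..<card V}"
  define B where "B = (\<lambda>x e. \<Sum>v\<in>V. x v * b v e)"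
  define a where "a = (\<lambda>v w. ip E (b v) (b w))"
  have B_right: "ip E (b v) (B x) = mat_op V a x v" for v x
  proof -
    have "B x = (\<lambda>e. \<Sum>v\<in>V. x v * b v e)" by (simp add: B_def fun_eq_iff)
    then show ?thesis by (simp add: ip_sum_right mat_op_def a_def mult.commute)
  qed
  have B_left: "ip E (B x) z = (\<Sum>v\<in>V. x v * ip E (b v) z)" for x z
    unfolding B_def by (rule ip_sum_left)
  have BB: "ip E (B (u i)) (B (u j)) = (if i = j then l i else 0)" if "i \<in> ?I" "j \<in> ?I" for i j
  proof -
    have "ip E (B (u i)) (B (u j)) = (\<Sum>v\<in>V. u i v * mat_op V a (u j) v)"
      by (simp only: B_left B_right)
    also have "\<dots> = ip V (u i) (\<lambda>v. l j * u j v)"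
      using eig that by (simp add: ip_def[of V] a_def)
    finally show ?thesis using on that by (simp add: ip_scale_right orthonormal_onD)
  qed
  have wB: "w i = (\<lambda>e. (1 / sqrt (l i)) * B (u i) e)" for i
    by (simp add: w_def B_def)
  show l_eq: "l i = ip E (\<lambda>e. \<Sum>v\<in>V. u i v * b v e) (\<lambda>e. \<Sum>v\<in>V. u i v * b v e)" if "i < card V" for i
    using BB[of i i] that by (simp add: B_def)
  have ipw: "ip E (w i) z = ip E (B (u i)) z / sqrt (l i)" for i z
    unfolding wB ip_scale_left by simp
  show "orthonormal_on E {i. i < card V \<and> 0 < l i} w"
    unfolding orthonormal_on_def
  proof (intro ballI)
    fix i j assume ij: "i \<in> {i. i < card V \<and> 0 < l i}" "j \<in> {i. i < card V \<and> 0 < l i}"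
    have "ip E (w i) (w j) = ip E (B (u i)) (B (u j)) / (sqrt (l i) * sqrt (l j))"
      unfolding ipw by (subst ip_commute, subst ipw, subst ip_commute) simp
    then show "ip E (w i) (w j) = (if i = j then 1 else 0)" using ij BB by auto
  qed
  show "(\<Sum>v\<in>V. (ip E (b v) z)\<^sup>2) = (\<Sum>i\<in>{i. i < card V \<and> 0 < l i}. l i * (ip E (w i) z)\<^sup>2)" for z
  proof -
    define y where "y = (\<lambda>v. ip E (b v) z)"
    have "ip E (B (u i)) z = ip V y (u i)" for i
      by (simp add: B_left ip_def[of V] y_def mult.commute)
    then have "(\<Sum>v\<in>V. (ip E (b v) z)\<^sup>2) = (\<Sum>i\<in>?I. (ip E (B (u i)) z)\<^sup>2)"
      using parseval[OF V finite_lessThan on card_lessThan, of y y]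
      by (simp add: ip_def[of V y y] power2_eq_square) (simp add: y_def)
    also have "\<dots> = (\<Sum>i\<in>{i. i < card V \<and> 0 < l i}. l i * (ip E (w i) z)\<^sup>2)"
    proof (rule sum.mono_neutral_cong_right)
      show "\<forall>i\<in>?I - {i. i < card V \<and> 0 < l i}. (ip E (B (u i)) z)\<^sup>2 = 0"
      proof
        fix i assume i: "i \<in> ?I - {i. i < card V \<and> 0 < l i}"
        moreover have "0 \<le> l i" using i l_eq[of i] ip_self_nonneg by simp
        ultimately have "ip E (B (u i)) (B (u i)) = 0" using BB[of i i] by auto
        then have "\<forall>e\<in>E. B (u i) e = 0" using ip_self_eq_0[OF E, of "B (u i)"] by simp
        then show "(ip E (B (u i)) z)\<^sup>2 = 0" by (simp add: ip_def)
      qed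
    qed (auto simp: ipw power_divide)
    finally show ?thesis .
  qed
qed

text \<open>
The Grone--Merris inequality on the side of the edges, where the \<open>y k\<close> need not be orthonormal but only
satisfy Bessel's inequality. This is the form that survives the restriction of an orthonormal family to
the facets above a fixed face. Each eigenvalue of the Laplacian enters with a weight in \<open>[0, 1]\<close>, and the
weights add up to at most the mass of the \<open>y k\<close>.
\<close>

lemma graph_edge_trace_le:
  fixes b :: "'v \<Rightarrow> 'e \<Rightarrow> real" and ends :: "'e \<Rightarrow> 'v set"
  assumes V: "finite V" and E: "finite E" and H: "H \<subseteq> V" and inj: "inj_on ends E"
    and edge: "\<And>e. e \<in> E \<Longrightarrow> \<exists>a\<in>V. \<exists>c\<in>V. a \<noteq> c \<and> ends e = {a, c} \<and> \<bar>b a e\<bar> = 1 \<and> b c e = - b a e \<and>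
        (\<forall>v\<in>V - {a, c}. b v e = 0)"
    and K: "finite K" and bes: "\<And>x. (\<Sum>k\<in>K. (ip E x (y k))\<^sup>2) \<le> ip E x x"
  shows "(\<Sum>k\<in>K. \<Sum>v\<in>V. (ip E (b v) (y k))\<^sup>2) \<le>
     card H * (\<Sum>k\<in>K. ip E (y k) (y k)) + (\<Sum>w\<in>V - H. real (card {e\<in>E. w \<in> ends e}))"
proof -
  define R where "R = (\<lambda>v w. \<exists>e\<in>E. ends e = {v, w})"
  define B where "B = (\<lambda>x e. \<Sum>v\<in>V. x v * b v e)"
  have Rsum: "of_bool (R v w) = (\<Sum>e\<in>E. of_bool (ends e = {v, w}) :: real)" for v w
  proof (cases "R v w")
    case True
    then obtain e where e: "e \<in> E" "ends e = {v, w}" by (auto simp: R_def)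
    then have "(\<Sum>e'\<in>E. of_bool (ends e' = {v, w}) :: real) = (\<Sum>e'\<in>E. if e' = e then 1 else 0)"
      using inj by (intro sum.cong) (auto simp: inj_on_def)
    then show ?thesis using True e E by simp
  next
    case False
    then have "(\<Sum>e\<in>E. of_bool (ends e = {v, w}) :: real) = 0" by (intro sum.neutral) (auto simp: R_def)
    then show ?thesis using False by simp
  qed
  have Rsym: "R v w \<Longrightarrow> R w v" for v w by (auto simp: R_def insert_commute)
  have Rirr: "\<not> R v v" for v
  proof
    assume "R v v"
    then obtain e where "e \<in> E" "ends e = {v}" by (auto simp: R_def)
    then show False using edge[of e] by (auto simp: doubleton_eq_iff)
  qed
  have endpair: "(\<Sum>v\<in>V. \<Sum>w\<in>V. of_bool (ends e = {v, w}) * F v w) = F a c + (F c a :: real)"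
    if e: "ends e = {a, c}" "a \<in> V" "c \<in> V" "a \<noteq> c" for e a c F
  proof -
    have "of_bool (ends e = {v, w}) * F v w =
       (if w = c then if v = a then F v w else 0 else 0) + (if w = a then if v = c then F v w else 0 else 0)" for v w
      using e by (auto simp: doubleton_eq_iff)
    then show ?thesis using V e by (simp add: sum.distrib)
  qed
  have form: "graph_form V R x = ip E (B x) (B x)" for x
  proof -
    have "(\<Sum>v\<in>V. \<Sum>w\<in>V. of_bool (R v w) * (x v - x w)\<^sup>2)
        = (\<Sum>e\<in>E. \<Sum>v\<in>V. \<Sum>w\<in>V. of_bool (ends e = {v, w}) * (x v - x w)\<^sup>2)"
    proof -
      have "(\<Sum>v\<in>V. \<Sum>w\<in>V. of_bool (R v w) * (x v - x w)\<^sup>2)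
          = (\<Sum>v\<in>V. \<Sum>w\<in>V. \<Sum>e\<in>E. of_bool (ends e = {v, w}) * (x v - x w)\<^sup>2)"
        by (simp add: Rsum sum_distrib_right)
      also have "\<dots> = (\<Sum>v\<in>V. \<Sum>e\<in>E. \<Sum>w\<in>V. of_bool (ends e = {v, w}) * (x v - x w)\<^sup>2)"
        by (intro sum.cong refl) (rule sum.swap)
      also have "\<dots> = (\<Sum>e\<in>E. \<Sum>v\<in>V. \<Sum>w\<in>V. of_bool (ends e = {v, w}) * (x v - x w)\<^sup>2)"
        by (rule sum.swap)
      finally show ?thesis .
    qed
    also have "\<dots> = (\<Sum>e\<in>E. 2 * (B x e * B x e))"
    proof (intro sum.cong refl)
      fix e assume "e \<in> E"
      then obtain a c where ac: "a \<in> V" "c \<in> V" "a \<noteq> c" "ends e = {a, c}" "\<bar>b a e\<bar> = 1" "b c e = - b a e"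
        "\<forall>v\<in>V - {a, c}. b v e = 0" using edge by blast
      have "B x e = (\<Sum>v\<in>{a, c}. x v * b v e)"
        unfolding B_def using V ac by (intro sum.mono_neutral_right) auto
      then have "B x e = b a e * (x a - x c)" using ac by (simp add: algebra_simps)
      moreover have "b a e * b a e = 1" using ac(5) by (metis abs_mult_self_eq mult_1)
      ultimately have "B x e * B x e = (x a - x c)\<^sup>2"
        by (metis (no_types, opaque_lifting) mult.assoc mult.left_commute mult_1 power2_eq_square)
      then show "(\<Sum>v\<in>V. \<Sum>w\<in>V. of_bool (ends e = {v, w}) * (x v - x w)\<^sup>2) = 2 * (B x e * B x e)"
        using endpair[OF ac(4,1,2,3)] by (simp add: power2_commute)
    qed
    finally show ?thesis by (simp add: graph_form_def ip_def sum_distrib_left[symmetric])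
  qed
  have deg: "(\<Sum>v\<in>V. of_bool (R v w)) = real (card {e\<in>E. w \<in> ends e})" if w: "w \<in> V" for w
  proof -
    have "(\<Sum>v\<in>V. of_bool (R v w) :: real) = (\<Sum>e\<in>E. \<Sum>v\<in>V. of_bool (ends e = {v, w}))"
      unfolding Rsum by (rule sum.swap)
    also have "\<dots> = (\<Sum>e\<in>E. of_bool (w \<in> ends e))"
    proof (intro sum.cong refl)
      fix e assume "e \<in> E"
      then obtain a c where ac: "a \<in> V" "c \<in> V" "a \<noteq> c" "ends e = {a, c}" using edge by blast
      then have "of_bool (ends e = {v, w}) = (if v = a then of_bool (w = c) else 0) + (if v = c then of_bool (w = a) else (0::real))" for v
        by (auto simp: doubleton_eq_iff)
      then show "(\<Sum>v\<in>V. of_bool (ends e = {v, w})) = (of_bool (w \<in> ends e) :: real)"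
        using ac V by (auto simp: sum.distrib)
    qed
    also have "\<dots> = real (card {e\<in>E. w \<in> ends e})"
      using E by (simp add: sum.If_cases of_bool_def Int_def)
    finally show ?thesis .
  qed
  obtain u l where on: "orthonormal_on V {..<card V} u"
    and eig: "\<forall>i<card V. \<forall>v\<in>V. mat_op V (\<lambda>v w. ip E (b v) (b w)) (u i) v = l i * u i v"
    using extend_to_eigenbasis[OF V, of "\<lambda>v w. ip E (b v) (b w)" 0]
    by (auto simp: ip_commute orthonormal_on_def)
  define P where "P = {i. i < card V \<and> 0 < l i}"
  define w where "w = (\<lambda>i e. (1 / sqrt (l i)) * (\<Sum>v\<in>V. u i v * b v e))"
  note sv = gram_singular_vectors[OF V E on, of b l, folded w_def P_def]
  have l_form: "graph_form V R (u i) = l i" if "i < card V" for i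
    unfolding form B_def using sv(1)[OF _ that] eig by auto
  have onw: "orthonormal_on E P w" using sv(2) eig by blast
  have trace: "(\<Sum>v\<in>V. (ip E (b v) z)\<^sup>2) = (\<Sum>i\<in>P. l i * (ip E (w i) z)\<^sup>2)" for z
    using sv(3)[of z] eig by (simp add: w_def)
  define p where "p = (\<lambda>i. \<Sum>k\<in>K. (ip E (w i) (y k))\<^sup>2)"
  have total: "(\<Sum>k\<in>K. \<Sum>v\<in>V. (ip E (b v) (y k))\<^sup>2) = (\<Sum>i\<in>P. l i * p i)"
    unfolding trace p_def sum_distrib_left by (rule sum.swap)
  have p: "0 \<le> p i" "p i \<le> 1" if "i \<in> P" for i
    using bes[of "w i"] onw that by (auto simp: p_def orthonormal_onD intro: sum_nonneg)
  have psum: "(\<Sum>i\<in>P. p i) \<le> (\<Sum>k\<in>K. ip E (y k) (y k))"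
  proof -
    have "(\<Sum>i\<in>P. p i) = (\<Sum>k\<in>K. \<Sum>i\<in>P. (ip E (y k) (w i))\<^sup>2)"
      unfolding p_def by (subst sum.swap) (simp add: ip_commute)
    also have "\<dots> \<le> (\<Sum>k\<in>K. ip E (y k) (y k))"
      by (intro sum_mono bessel[OF _ onw]) (simp add: P_def)
    finally show ?thesis .
  qed
  define Q where "Q = {i. i < card V \<and> l i > card H}"
  have QP: "Q \<subseteq> P" by (auto simp: Q_def P_def)
  have "(\<Sum>i\<in>P. l i * p i) = (\<Sum>i\<in>P. card H * p i + (l i - card H) * p i)"
    by (intro sum.cong refl) (simp add: algebra_simps)
  also have "\<dots> \<le> (\<Sum>i\<in>P. card H * p i + (if i \<in> Q then l i - card H else 0))"
  proof (intro sum_mono add_left_mono)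
    fix i assume i: "i \<in> P"
    show "(l i - card H) * p i \<le> (if i \<in> Q then l i - card H else 0)"
      using i p[OF i] by (auto simp: Q_def P_def mult_left_le mult_nonpos_nonneg)
  qed
  also have "\<dots> = card H * (\<Sum>i\<in>P. p i) + (\<Sum>i\<in>Q. l i - card H)"
    using QP by (simp add: sum.distrib sum_distrib_left sum.If_cases P_def Int_absorb1)
  also have "\<dots> \<le> card H * (\<Sum>k\<in>K. ip E (y k) (y k)) + (\<Sum>w\<in>V - H. \<Sum>v\<in>V. of_bool (R v w))"
  proof (intro add_mono mult_left_mono psum)
    have "(\<Sum>i\<in>Q. l i - card H) = (\<Sum>i\<in>Q. graph_form V R (u i) - card H)"
      by (intro sum.cong refl) (simp add: l_form Q_def)
    also have "\<dots> \<le> (\<Sum>w\<in>V - H. \<Sum>v\<in>V. of_bool (R v w))"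
      by (rule graph_form_sum_le[OF V H Rsym Rirr _ orthonormal_on_subset[OF on]]) (auto simp: Q_def)
    finally show "(\<Sum>i\<in>Q. l i - card H) \<le> (\<Sum>w\<in>V - H. \<Sum>v\<in>V. of_bool (R v w))" .
  qed simp
  finally show ?thesis unfolding total using deg by simp
qed

section \<open>Averaging over links\<close>

lemma ridge_is_facet_minus_vertex:
  assumes "card F = Suc m" "card t = m" "t \<subseteq> F" "0 < m"
  shows "\<exists>v\<in>F. t = F - {v}"
proof -
  have fin: "finite F" "finite t" using assms by (auto intro: card_ge_0_finite)
  then have "card (F - t) = 1" using assms by (simp add: card_Diff_subset)
  then obtain v where "F - t = {v}" by (auto simp: card_1_singleton_iff)
  then show ?thesis using assms(3) by blast
qed

lemma ridges_of_facet:
  assumes F: "card F = Suc m" and m: "0 < m" and T: "\<And>t. t \<in> T \<Longrightarrow> card t = m"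
    and ridge: "\<And>v. v \<in> F \<Longrightarrow> F - {v} \<in> T"
  shows "{t\<in>T. t \<subseteq> F} = (\<lambda>v. F - {v}) ` F" and "card {t\<in>T. t \<subseteq> F} = Suc m"
proof -
  show eq: "{t\<in>T. t \<subseteq> F} = (\<lambda>v. F - {v}) ` F"
  proof (intro equalityI subsetI)
    fix t assume "t \<in> {t\<in>T. t \<subseteq> F}"
    then show "t \<in> (\<lambda>v. F - {v}) ` F" using ridge_is_facet_minus_vertex[OF F T _ m, of t] by blast
  qed (use ridge in auto)
  have "inj_on (\<lambda>v. F - {v}) F" by (auto simp: inj_on_def)
  then show "card {t\<in>T. t \<subseteq> F} = Suc m" unfolding eq using F by (simp add: card_image)
qed

text \<open>
A pure complex with signed incidences \<open>b\<close> between ridges and facets. The signs \<open>\<eta>\<close> are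
incidences one dimension lower, and \<open>cocycle\<close> says that the boundary of a boundary vanishes.
\<close>

locale signed_facets =
  fixes FF T :: "'a set set" and m :: nat and b \<eta> :: "'a set \<Rightarrow> 'a set \<Rightarrow> real"
  assumes finF: "finite FF" and finT: "finite T" and m2: "2 \<le> m"
    and cardF: "\<And>F. F \<in> FF \<Longrightarrow> card F = Suc m"
    and cardT: "\<And>t. t \<in> T \<Longrightarrow> card t = m"
    and ridge: "\<And>F v. F \<in> FF \<Longrightarrow> v \<in> F \<Longrightarrow> F - {v} \<in> T"
    and b_abs: "\<And>F v. F \<in> FF \<Longrightarrow> v \<in> F \<Longrightarrow> \<bar>b (F - {v}) F\<bar> = 1"
    and b_zero: "\<And>F t. F \<in> FF \<Longrightarrow> t \<in> T \<Longrightarrow> \<not> t \<subseteq> F \<Longrightarrow> b t F = 0"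
    and \<eta>_abs: "\<And>t p. t \<in> T \<Longrightarrow> p \<subseteq> t \<Longrightarrow> \<bar>\<eta> t p\<bar> = 1"
    and cocycle: "\<And>F v w. F \<in> FF \<Longrightarrow> v \<in> F \<Longrightarrow> w \<in> F \<Longrightarrow> v \<noteq> w \<Longrightarrow>
      \<eta> (F - {v}) (F - {v, w}) * b (F - {v}) F + \<eta> (F - {w}) (F - {v, w}) * b (F - {w}) F = 0"
begin

definition deg :: "'a set \<Rightarrow> nat" where
  "deg t = card {F\<in>FF. t \<subseteq> F}"

lemma b_square: "F \<in> FF \<Longrightarrow> t \<in> T \<Longrightarrow> (b t F)\<^sup>2 = (if t \<subseteq> F then 1 else 0)"
proof -
  assume F: "F \<in> FF" and t: "t \<in> T"
  show ?thesis
  proof (cases "t \<subseteq> F")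
    case True
    then obtain v where "v \<in> F" "t = F - {v}"
      using ridge_is_facet_minus_vertex[OF cardF[OF F] cardT[OF t]] m2 by auto
    then show ?thesis using b_abs[OF F] True by (metis one_power2 power2_abs)
  qed (simp add: b_zero F t)
qed

lemma ip_b_b: "t \<in> T \<Longrightarrow> ip FF (b t) (b t) = deg t"
  using finF by (simp add: ip_def power2_eq_square[symmetric] b_square sum.If_cases deg_def Int_def)

text \<open>
Multiplying row \<open>t\<close> by \<open>\<eta> t p\<close> does not change squares and turns the rows of the ridges above
\<open>p\<close> into the oriented incidence matrix of a graph: by the cocycle condition the two entries of each column
have opposite signs.
\<close>

lemma link_trace_le:
  assumes K: "finite K" "orthonormal_on FF K y" and p: "card p = m - 1" and H: "H \<subseteq> {t\<in>T. p \<subseteq> t}"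
  shows "(\<Sum>k\<in>K. \<Sum>t\<in>{t\<in>T. p \<subseteq> t}. (ip FF (b t) (y k))\<^sup>2) \<le>
    card H * (\<Sum>k\<in>K. ip {F\<in>FF. p \<subseteq> F} (y k) (y k)) + (\<Sum>t\<in>{t\<in>T. p \<subseteq> t} - H. real (deg t))"
proof -
  define V where "V = {t\<in>T. p \<subseteq> t}"
  define E where "E = {F\<in>FF. p \<subseteq> F}"
  define ends where "ends = (\<lambda>F. {t\<in>V. t \<subseteq> F})"
  define b' where "b' = (\<lambda>t F. \<eta> t p * b t F)"
  have fin: "finite V" "finite E" using finF finT by (auto simp: V_def E_def)
  have ends: "\<exists>v w. v \<in> F \<and> w \<in> F \<and> v \<noteq> w \<and> p = F - {v, w} \<and> F - {v} \<in> V \<and> F - {w} \<in> V \<and>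
      ends F = {F - {v}, F - {w}}" if F: "F \<in> E" for F
  proof -
    have FF: "F \<in> FF" "p \<subseteq> F" using F by (auto simp: E_def)
    have "finite F" using cardF[OF FF(1)] by (auto intro: card_ge_0_finite)
    moreover from this have "finite p" using FF finite_subset by auto
    ultimately have "card (F - p) = 2" using cardF[OF FF(1)] p m2 FF by (simp add: card_Diff_subset)
    then obtain v w where vw: "F - p = {v, w}" "v \<noteq> w" by (auto simp: card_2_iff)
    then have in_F: "v \<in> F" "w \<in> F" "p = F - {v, w}" using FF by auto
    have "ends F = {t\<in>{t\<in>T. t \<subseteq> F}. p \<subseteq> t}" by (auto simp: ends_def V_def)
    also have "{t\<in>T. t \<subseteq> F} = (\<lambda>v. F - {v}) ` F"
      using ridges_of_facet(1)[OF cardF[OF FF(1)] _ cardT ridge[OF FF(1)]] m2 by auto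
    also have "{t\<in>(\<lambda>v. F - {v}) ` F. p \<subseteq> t} = {F - {v}, F - {w}}"
      using in_F by auto
    finally show ?thesis using in_F vw(2) ridge[OF FF(1)] by (intro exI[of _ v] exI[of _ w]) (auto simp: V_def)
  qed
  have "inj_on ends E"
  proof (rule inj_onI)
    fix F G assume FG: "F \<in> E" "G \<in> E" "ends F = ends G"
    have "\<Union> (ends F) = F" if "F \<in> E" for F using ends[OF that] by auto
    then show "F = G" using FG by metis
  qed
  moreover have "\<exists>a\<in>V. \<exists>c\<in>V. a \<noteq> c \<and> ends F = {a, c} \<and> \<bar>b' a F\<bar> = 1 \<and> b' c F = - b' a F \<and>
        (\<forall>t\<in>V - {a, c}. b' t F = 0)" if F: "F \<in> E" for F
  proof -
    obtain v w where vw: "v \<in> F" "w \<in> F" "v \<noteq> w" "p = F - {v, w}" "F - {v} \<in> V" "F - {w} \<in> V"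
      "ends F = {F - {v}, F - {w}}" using ends[OF F] by blast
    have FF: "F \<in> FF" using F by (simp add: E_def)
    have "\<bar>b' (F - {v}) F\<bar> = 1"
      using b_abs[OF FF vw(1)] \<eta>_abs[of "F - {v}" p] vw by (auto simp: b'_def abs_mult V_def)
    moreover have "b' (F - {w}) F = - b' (F - {v}) F"
      using cocycle[OF FF vw(1,2,3)] vw(4) by (simp add: b'_def)
    moreover have "b' t F = 0" if "t \<in> V - {F - {v}, F - {w}}" for t
    proof -
      have "t \<notin> ends F" "t \<in> T" using that vw(7) by (auto simp: V_def)
      then have "\<not> t \<subseteq> F" using that by (auto simp: ends_def)
      then show ?thesis using b_zero[OF FF \<open>t \<in> T\<close>] by (simp add: b'_def)
    qed
    moreover have "F - {v} \<noteq> F - {w}" using vw by auto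
    ultimately have "F - {v} \<noteq> F - {w} \<and> ends F = {F - {v}, F - {w}} \<and> \<bar>b' (F - {v}) F\<bar> = 1 \<and>
        b' (F - {w}) F = - b' (F - {v}) F \<and> (\<forall>t\<in>V - {F - {v}, F - {w}}. b' t F = 0)"
      using vw(7) by metis
    then show ?thesis using vw(5,6) by (intro bexI[of _ "F - {v}"] bexI[of _ "F - {w}"])
  qed
  moreover have ipE: "ip E x z = ip FF (\<lambda>F. if p \<subseteq> F then x F else 0) z" for x z
    unfolding ip_def E_def using finF by (intro sum.mono_neutral_cong_left) auto
  have "(\<Sum>k\<in>K. (ip E x (y k))\<^sup>2) \<le> ip E x x" for x
  proof -
    let ?x = "\<lambda>F. if p \<subseteq> F then x F else 0"
    have "(\<Sum>k\<in>K. (ip E x (y k))\<^sup>2) \<le> ip FF ?x ?x"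
      using bessel[OF K(1,2), of ?x] by (simp only: ipE[symmetric])
    also have "\<dots> = ip E x x" unfolding ipE[of x x] by (auto simp: ip_def intro: sum.cong)
    finally show ?thesis .
  qed
  ultimately have "(\<Sum>k\<in>K. \<Sum>t\<in>V. (ip E (b' t) (y k))\<^sup>2) \<le>
     card H * (\<Sum>k\<in>K. ip E (y k) (y k)) + (\<Sum>t\<in>V - H. real (card {F\<in>E. t \<in> ends F}))"
    using H by (intro graph_edge_trace_le[OF fin _ _ _ K(1)]) (auto simp: V_def)
  moreover have "(ip E (b' t) (y k))\<^sup>2 = (ip FF (b t) (y k))\<^sup>2" if t: "t \<in> V" for t k
  proof -
    have "ip E (b' t) (y k) = \<eta> t p * ip FF (\<lambda>F. if p \<subseteq> F then b t F else 0) (y k)"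
      unfolding b'_def ip_scale_left ipE ..
    also have "ip FF (\<lambda>F. if p \<subseteq> F then b t F else 0) (y k) = ip FF (b t) (y k)"
      using t b_zero by (intro ip_cong) (auto simp: V_def)
    finally show ?thesis using \<eta>_abs[of t p] t
      by (simp add: V_def power_mult_distrib power2_eq_square) (metis abs_mult_self_eq mult_1)
  qed
  moreover have "card {F\<in>E. t \<in> ends F} = deg t" if "t \<in> V" for t
    unfolding deg_def using that by (intro arg_cong[where f = card]) (auto simp: E_def ends_def V_def)
  ultimately show ?thesis by (simp add: V_def[symmetric] E_def[symmetric])
qed

text \<open>
A ridge has \<open>m\<close> vertices, hence \<open>m\<close> faces of codimension one.
\<close>

lemma sum_over_codim2:
  fixes g :: "'a set \<Rightarrow> real"
  defines "P \<equiv> (\<Union>t\<in>T. (\<lambda>v. t - {v}) ` t)"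
  shows "finite P" and "p \<in> P \<Longrightarrow> card p = m - 1" and
    "(\<Sum>p\<in>P. \<Sum>t\<in>{t\<in>T. p \<subseteq> t}. g t) = real m * (\<Sum>t\<in>T. g t)"
proof -
  have fint: "finite t" if "t \<in> T" for t using cardT[OF that] m2 by (auto intro: card_ge_0_finite)
  show finP: "finite P" unfolding P_def using finT fint by auto
  show cP: "card p = m - 1" if "p \<in> P" for p using that cardT by (auto simp: P_def)
  have "card {p\<in>P. p \<subseteq> t} = m" if t: "t \<in> T" for t
  proof -
    have "{p\<in>P. p \<subseteq> t} = (\<lambda>v. t - {v}) ` t"
    proof (intro equalityI subsetI)
      fix p assume "p \<in> {p\<in>P. p \<subseteq> t}"
      then show "p \<in> (\<lambda>v. t - {v}) ` t"
        using ridge_is_facet_minus_vertex[of t "m - 1" p] cP[of p] cardT[OF t] m2 by auto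
    qed (use t in \<open>auto simp: P_def\<close>)
    moreover have "inj_on (\<lambda>v. t - {v}) t" by (auto simp: inj_on_def)
    ultimately show ?thesis using cardT[OF t] by (simp add: card_image)
  qed
  then show "(\<Sum>p\<in>P. \<Sum>t\<in>{t\<in>T. p \<subseteq> t}. g t) = real m * (\<Sum>t\<in>T. g t)"
    by (subst sum.swap_restrict[OF finP finT]) (simp add: sum_distrib_left)
qed

text \<open>
A ridge other than \<open>t0\<close> lies in at most one facet above \<open>t0\<close>, so on the star of \<open>t0\<close> the rows other
than \<open>b t0\<close> are zero or signed unit vectors, \<open>m\<close> of the latter for each facet. With \<open>d = deg t0\<close> the left-hand side is at most
\<open>d + m * q\<close>, and the right-hand side at least \<open>q + m * d\<close>; the difference is \<open>(m - 1) * (d - q)\<close>.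
\<close>

lemma star_trace_strict:
  assumes K: "finite K" "orthonormal_on FF K y" "card K \<le> q" and q: "0 < q"
    and t0: "t0 \<in> T" "q < deg t0"
    and supp: "\<And>k F. k \<in> K \<Longrightarrow> F \<in> FF \<Longrightarrow> \<not> t0 \<subseteq> F \<Longrightarrow> y k F = 0"
  shows "(\<Sum>k\<in>K. \<Sum>t\<in>T. (ip FF (b t) (y k))\<^sup>2) < (\<Sum>t\<in>T. real (min q (deg t)))"
proof -
  define S where "S = {F\<in>FF. t0 \<subseteq> F}"
  define N where "N = (\<lambda>t. {F\<in>S. t \<subseteq> F})"
  have fin: "finite S" "\<And>t. finite (N t)" "finite (T - {t0})" using finF finT by (auto simp: S_def N_def)
  have cN: "N t = {} \<or> (\<exists>F. N t = {F})" if t: "t \<in> T - {t0}" for t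
  proof (cases "N t = {}")
    case False
    \<comment> \<open>Two distinct ridges with \<open>m\<close> vertices each span all \<open>m + 1\<close> vertices of a facet that contains both.\<close>
    have "F = t \<union> t0" if F: "F \<in> N t" for F
    proof -
      have c: "card F = Suc m" using F cardF by (auto simp: N_def S_def)
      then have finF': "finite F" by (auto intro: card_ge_0_finite)
      have sub: "t \<union> t0 \<subseteq> F" using F by (auto simp: N_def S_def)
      then have fins: "finite (t \<union> t0)" using finF' finite_subset by auto
      have "t0 \<subset> t \<union> t0"
        using t t0(1) cardT fins card_subset_eq[of t0 t] card_subset_eq[of t t0] by auto
      then have "m < card (t \<union> t0)" using psubset_card_mono[OF fins] cardT[OF t0(1)] by metis
      then show ?thesis using c sub finF' card_seteq[OF finF' sub] by simp
    qed
    then show ?thesis using False by blast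
  qed auto
  have count: "(\<Sum>t\<in>T - {t0}. \<Sum>F\<in>N t. z F) = real m * (\<Sum>F\<in>S. z F)" for z :: "'a set \<Rightarrow> real"
  proof -
    have "card {t\<in>T - {t0}. t \<subseteq> F} = m" if F: "F \<in> S" for F
    proof -
      have FF: "F \<in> FF" "t0 \<subseteq> F" using F by (auto simp: S_def)
      have "card {t\<in>T. t \<subseteq> F} = Suc m"
        using ridges_of_facet(2)[OF cardF[OF FF(1)] _ cardT ridge[OF FF(1)]] m2 by auto
      moreover have "{t\<in>T - {t0}. t \<subseteq> F} = {t\<in>T. t \<subseteq> F} - {t0}" by auto
      moreover have "t0 \<in> {t\<in>T. t \<subseteq> F}" using t0 FF by auto
      ultimately show ?thesis using finT by simp
    qed
    then show ?thesis unfolding N_def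
      by (subst sum.swap_restrict[OF fin(3,1)]) (simp add: sum_distrib_left)
  qed
  have other: "(ip FF (b t) (y k))\<^sup>2 = (\<Sum>F\<in>N t. (y k F)\<^sup>2)" if t: "t \<in> T - {t0}" and k: "k \<in> K" for t k
  proof -
    have "ip FF (b t) (y k) = (\<Sum>F\<in>N t. b t F * y k F)"
      unfolding ip_def
    proof (rule sum.mono_neutral_right[OF finF])
      show "\<forall>F\<in>FF - N t. b t F * y k F = 0"
      proof
        fix F assume "F \<in> FF - N t"
        then show "b t F * y k F = 0"
          using supp[OF k, of F] b_zero[of F t] t by (cases "t0 \<subseteq> F") (auto simp: N_def S_def)
      qed
    qed (auto simp: N_def S_def)
    moreover have "(b t F)\<^sup>2 = 1" if "F \<in> N t" for F
      using b_square[of F t] t that by (auto simp: N_def S_def)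
    ultimately show ?thesis using cN[OF t] by (auto simp: power_mult_distrib)
  qed
  have "(\<Sum>k\<in>K. (ip FF (b t0) (y k))\<^sup>2) \<le> deg t0"
    using bessel[OF K(1,2), of "b t0"] t0 by (simp add: ip_b_b)
  moreover have "(\<Sum>k\<in>K. \<Sum>t\<in>T - {t0}. (ip FF (b t) (y k))\<^sup>2) \<le> real m * q"
  proof -
    have "(\<Sum>k\<in>K. \<Sum>t\<in>T - {t0}. (ip FF (b t) (y k))\<^sup>2) = (\<Sum>k\<in>K. real m * (\<Sum>F\<in>S. (y k F)\<^sup>2))"
      by (intro sum.cong refl) (simp add: other count)
    also have "\<dots> = (\<Sum>k\<in>K. real m * 1)"
    proof (intro sum.cong refl arg_cong2[where f = times])
      fix k assume k: "k \<in> K"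
      have "(\<Sum>F\<in>S. (y k F)\<^sup>2) = ip FF (y k) (y k)"
        unfolding ip_def power2_eq_square S_def using finF supp[OF k] by (intro sum.mono_neutral_left) auto
      then show "(\<Sum>F\<in>S. (y k F)\<^sup>2) = 1" using K(2) k by (simp add: orthonormal_onD)
    qed
    also have "\<dots> \<le> real m * q" using K(3) by (simp add: mult.commute[of "real m"] mult_right_mono)
    finally show ?thesis .
  qed
  moreover have "(\<Sum>k\<in>K. \<Sum>t\<in>T. (ip FF (b t) (y k))\<^sup>2) =
      (\<Sum>k\<in>K. (ip FF (b t0) (y k))\<^sup>2) + (\<Sum>k\<in>K. \<Sum>t\<in>T - {t0}. (ip FF (b t) (y k))\<^sup>2)"
    by (simp add: sum.remove[OF finT t0(1)] sum.distrib)
  moreover have "real q + real m * deg t0 \<le> (\<Sum>t\<in>T. real (min q (deg t)))"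
  proof -
    have "real m * deg t0 = (\<Sum>t\<in>T - {t0}. real (card (N t)))"
      using count[of "\<lambda>_. 1"] by (simp add: deg_def S_def)
    also have "\<dots> \<le> (\<Sum>t\<in>T - {t0}. real (min q (deg t)))"
    proof (intro sum_mono)
      fix t assume t: "t \<in> T - {t0}"
      have "card (N t) \<le> 1" using cN[OF t] by auto
      moreover have "card (N t) \<le> deg t"
        unfolding deg_def using finF by (intro card_mono) (auto simp: N_def S_def)
      ultimately show "real (card (N t)) \<le> real (min q (deg t))" using q by simp
    qed
    finally show ?thesis using t0 by (simp add: sum.remove[OF finT t0(1)])
  qed
  moreover have "real (deg t0) + real m * q < real q + real m * deg t0"
  proof -
    have "0 < (real m - 1) * (real (deg t0) - real q)" using m2 t0(2) by (intro mult_pos_pos) auto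
    then show ?thesis by (simp add: algebra_simps)
  qed
  ultimately show ?thesis by linarith
qed

text \<open>
Averaging \<open>link_trace_le\<close> with the ridges of degree more than \<open>q\<close> as \<open>H p\<close> gives the weak
inequality, with the defect \<open>card (H p) * (q - s p)\<close> at each face \<open>p\<close>, where \<open>s p\<close> is the mass on the
facets above \<open>p\<close>. If there is no defect at the faces of \<open>t0\<close>, then all the mass lies above each of them.
Since \<open>t0\<close> has at least two faces, it lies above \<open>t0\<close>.
\<close>

theorem signed_trace_strict:
  assumes K: "finite K" "orthonormal_on FF K y" "card K \<le> q" and q: "0 < q"
    and t0: "t0 \<in> T" "q < deg t0"
  shows "(\<Sum>k\<in>K. \<Sum>t\<in>T. (ip FF (b t) (y k))\<^sup>2) < (\<Sum>t\<in>T. real (min q (deg t)))"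
proof -
  define P where "P = (\<Union>t\<in>T. (\<lambda>v. t - {v}) ` t)"
  note P = sum_over_codim2[folded P_def]
  define g where "g = (\<lambda>t. \<Sum>k\<in>K. (ip FF (b t) (y k))\<^sup>2)"
  define H where "H = (\<lambda>p. {t\<in>T. p \<subseteq> t \<and> q < deg t})"
  define s where "s = (\<lambda>p. \<Sum>k\<in>K. ip {F\<in>FF. p \<subseteq> F} (y k) (y k))"
  have total: "(\<Sum>k\<in>K. ip FF (y k) (y k)) \<le> q"
    using K by (simp add: orthonormal_onD)
  have split: "(\<Sum>k\<in>K. ip FF (y k) (y k)) = s p + (\<Sum>k\<in>K. \<Sum>F\<in>{F\<in>FF. \<not> p \<subseteq> F}. (y k F)\<^sup>2)" for p
  proof -
    have "ip FF (y k) (y k) = ip {F\<in>FF. p \<subseteq> F} (y k) (y k) + (\<Sum>F\<in>{F\<in>FF. \<not> p \<subseteq> F}. (y k F)\<^sup>2)" for k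
    proof -
      have "FF = {F\<in>FF. p \<subseteq> F} \<union> {F\<in>FF. \<not> p \<subseteq> F}" by auto
      then have "ip FF (y k) (y k) = (\<Sum>F\<in>{F\<in>FF. p \<subseteq> F} \<union> {F\<in>FF. \<not> p \<subseteq> F}. y k F * y k F)"
        by (simp add: ip_def)
      also have "\<dots> = ip {F\<in>FF. p \<subseteq> F} (y k) (y k) + (\<Sum>F\<in>{F\<in>FF. \<not> p \<subseteq> F}. (y k F)\<^sup>2)"
        unfolding ip_def power2_eq_square using finF by (intro sum.union_disjoint) auto
      finally show ?thesis .
    qed
    then show ?thesis by (simp add: s_def sum.distrib)
  qed
  have sq: "s p \<le> q" for p
  proof -
    have "0 \<le> (\<Sum>k\<in>K. \<Sum>F\<in>{F\<in>FF. \<not> p \<subseteq> F}. (y k F)\<^sup>2)" by (intro sum_nonneg) auto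
    then show ?thesis using split[of p] total by linarith
  qed
  have local: "(\<Sum>t\<in>{t\<in>T. p \<subseteq> t}. g t) \<le>
      (\<Sum>t\<in>{t\<in>T. p \<subseteq> t}. real (min q (deg t))) - card (H p) * (q - s p)" if "p \<in> P" for p
  proof -
    have "(\<Sum>t\<in>{t\<in>T. p \<subseteq> t}. g t) = (\<Sum>k\<in>K. \<Sum>t\<in>{t\<in>T. p \<subseteq> t}. (ip FF (b t) (y k))\<^sup>2)"
      unfolding g_def by (rule sum.swap)
    also have "\<dots> \<le> card (H p) * s p + (\<Sum>t\<in>{t\<in>T. p \<subseteq> t} - H p. real (deg t))"
      unfolding s_def by (rule link_trace_le[OF K(1,2) P(2)[OF that]]) (auto simp: H_def)
    finally have le: "(\<Sum>t\<in>{t\<in>T. p \<subseteq> t}. g t) \<le> \<dots>" .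
    have HT: "H p \<subseteq> {t\<in>T. p \<subseteq> t}" by (auto simp: H_def)
    have "(\<Sum>t\<in>{t\<in>T. p \<subseteq> t}. real (min q (deg t))) =
        (\<Sum>t\<in>{t\<in>T. p \<subseteq> t} - H p. real (min q (deg t))) + (\<Sum>t\<in>H p. real (min q (deg t)))"
      using finT HT by (intro sum.subset_diff) auto
    also have "(\<Sum>t\<in>{t\<in>T. p \<subseteq> t} - H p. real (min q (deg t))) = (\<Sum>t\<in>{t\<in>T. p \<subseteq> t} - H p. real (deg t))"
      by (intro sum.cong refl) (auto simp: H_def)
    also have "(\<Sum>t\<in>H p. real (min q (deg t))) = (\<Sum>t\<in>H p. real q)"
      by (intro sum.cong refl) (auto simp: H_def)
    finally show ?thesis using le by (simp add: right_diff_distrib)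
  qed
  show ?thesis
  proof (cases "\<exists>v\<in>t0. s (t0 - {v}) < q")
    case True
    then obtain v where v: "v \<in> t0" "s (t0 - {v}) < q" by auto
    have pP: "t0 - {v} \<in> P" using v t0 by (auto simp: P_def)
    have "(\<Sum>p\<in>P. \<Sum>t\<in>{t\<in>T. p \<subseteq> t}. g t) < (\<Sum>p\<in>P. \<Sum>t\<in>{t\<in>T. p \<subseteq> t}. real (min q (deg t)))"
    proof (rule sum_strict_mono_ex1[OF P(1)])
      show "\<forall>p\<in>P. (\<Sum>t\<in>{t\<in>T. p \<subseteq> t}. g t) \<le> (\<Sum>t\<in>{t\<in>T. p \<subseteq> t}. real (min q (deg t)))"
      proof
        fix p assume "p \<in> P"
        have "0 \<le> card (H p) * (q - s p)" using sq by simp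
        then show "(\<Sum>t\<in>{t\<in>T. p \<subseteq> t}. g t) \<le> (\<Sum>t\<in>{t\<in>T. p \<subseteq> t}. real (min q (deg t)))"
          using local[OF \<open>p \<in> P\<close>] by linarith
      qed
      have "t0 \<in> H (t0 - {v})" "finite (H (t0 - {v}))" using t0 finT by (auto simp: H_def)
      then have "0 < card (H (t0 - {v}))" by (auto simp: card_gt_0_iff)
      then have "0 < card (H (t0 - {v})) * (q - s (t0 - {v}))" using v by simp
      then show "\<exists>p\<in>P. (\<Sum>t\<in>{t\<in>T. p \<subseteq> t}. g t) < (\<Sum>t\<in>{t\<in>T. p \<subseteq> t}. real (min q (deg t)))"
        using local[OF pP] pP by (intro bexI[of _ "t0 - {v}"]) linarith+
    qed
    then have "(\<Sum>t\<in>T. g t) < (\<Sum>t\<in>T. real (min q (deg t)))"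
      unfolding P(3) using m2 by simp
    moreover have "(\<Sum>t\<in>T. g t) = (\<Sum>k\<in>K. \<Sum>t\<in>T. (ip FF (b t) (y k))\<^sup>2)"
      unfolding g_def by (rule sum.swap)
    ultimately show ?thesis by simp
  next
    case False
    have zero: "y k F = 0" if "k \<in> K" "F \<in> FF" "v \<in> t0" "\<not> t0 - {v} \<subseteq> F" for k F v
    proof -
      define z where "z = (\<lambda>k. \<Sum>F\<in>{F\<in>FF. \<not> t0 - {v} \<subseteq> F}. (y k F)\<^sup>2)"
      have nn: "\<And>k. 0 \<le> z k" by (simp add: z_def sum_nonneg)
      have "sum z K \<le> 0"
      proof -
        have "\<not> s (t0 - {v}) < q" using False that(3) by blast
        then show ?thesis using split[of "t0 - {v}"] total unfolding z_def by linarith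
      qed
      then have "sum z K = 0" using sum_nonneg[of K z] nn by (intro antisym) auto
      then have "z k = 0" using sum_nonneg_eq_0_iff[OF K(1), of z] nn that(1) by blast
      then show ?thesis using finF that by (simp add: z_def sum_nonneg_eq_0_iff)
    qed
    have "card t0 \<noteq> 0" "card t0 \<noteq> 1" using cardT[OF t0(1)] m2 by auto
    then have "t0 \<noteq> {}" "\<And>v. t0 \<noteq> {v}" by auto
    then obtain v where v: "v \<in> t0" "t0 \<noteq> {v}" by blast
    then obtain w where vw: "v \<in> t0" "w \<in> t0" "v \<noteq> w" by blast
    have "y k F = 0" if "k \<in> K" "F \<in> FF" "\<not> t0 \<subseteq> F" for k F
      using zero[OF that(1,2) vw(1)] zero[OF that(1,2) vw(2)] that(3) vw by blast
    then show ?thesis by (rule star_trace_strict[OF K q t0])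
  qed
qed

end

section \<open>Orientation signs\<close>

lemma lookup_scaleR: "Poly_Mapping.lookup (r *\<^sub>R x) i = r *\<^sub>R Poly_Mapping.lookup x i"
  by (simp add: scaleR_poly_mapping_def)

context
  fixes g :: "'a \<Rightarrow> nat"
begin

text \<open>
An auxiliary numbering \<open>g\<close> of the vertices turns the signs of reorderings into products of signs of
lists: \<open>list_sign\<close> is \<open>-1\<close> to the number of inversions, and \<open>cmp_prod v S\<close> is the incidence sign of
the simplex \<open>insert v S\<close> with its face \<open>S\<close> when both carry the increasing orientation.
\<close>

definition cmp :: "'a \<Rightarrow> 'a \<Rightarrow> int" where
  "cmp x y = sgn (int (g y) - int (g x))"

definition cmp_prod :: "'a \<Rightarrow> 'a set \<Rightarrow> int" where
  "cmp_prod v S = (\<Prod>y\<in>S. cmp v y)"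

fun list_sign :: "'a list \<Rightarrow> int" where
  "list_sign [] = 1"
| "list_sign (x # xs) = cmp_prod x (set xs) * list_sign xs"

lemma cmp_flip: "cmp x y = - cmp y x"
  by (simp add: cmp_def sgn_if)

lemma cmp_abs: "g x \<noteq> g y \<Longrightarrow> \<bar>cmp x y\<bar> = 1"
  by (simp add: cmp_def sgn_if)

lemma cmp_prod_abs: "inj_on g V \<Longrightarrow> v \<in> V \<Longrightarrow> S \<subseteq> V \<Longrightarrow> v \<notin> S \<Longrightarrow> \<bar>cmp_prod v S\<bar> = 1"
  unfolding cmp_prod_def abs_prod by (intro prod.neutral ballI cmp_abs) (auto simp: inj_on_def)

lemma cmp_prod_insert: "finite S \<Longrightarrow> w \<notin> S \<Longrightarrow> cmp_prod v (insert w S) = cmp v w * cmp_prod v S"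
  by (simp add: cmp_prod_def)

text \<open>
Moving \<open>v\<close> past the entries of \<open>xs\<close> flips one comparison for each of them. The remaining product does not depend
on the position of \<open>v\<close>; this is why the alternating signs of the boundary map come out independent of
the ordering.
\<close>

lemma list_sign_delete:
  assumes "distinct (xs @ v # ys)"
  shows "list_sign (xs @ v # ys) = (-1) ^ length xs * cmp_prod v (set xs \<union> set ys) * list_sign (xs @ ys)"
  using assms
proof (induction xs)
  case (Cons x xs)
  have "cmp_prod x (set (xs @ v # ys)) = cmp x v * cmp_prod x (set (xs @ ys))"
    using Cons.prems by (simp add: cmp_prod_insert[symmetric])
  moreover have "cmp_prod v (set (x # xs) \<union> set ys) = cmp v x * cmp_prod v (set xs \<union> set ys)"
    using Cons.prems by (simp add: cmp_prod_insert)
  moreover have "list_sign (xs @ v # ys) = (-1) ^ length xs * cmp_prod v (set xs \<union> set ys) * list_sign (xs @ ys)"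
    using Cons by simp
  ultimately show ?case using cmp_flip[of x v] by simp
qed simp

text \<open>
Delete the two entries in order of position: the powers of \<open>-1\<close> agree on both sides, and only the
comparison of \<open>a\<close> with \<open>b\<close> differs.
\<close>

lemma list_sign_swap:
  assumes "distinct (xs @ a # ys @ b # zs)"
  shows "list_sign (xs @ b # ys @ a # zs) = - list_sign (xs @ a # ys @ b # zs)"
proof -
  let ?S = "set xs \<union> set ys \<union> set zs"
  have expand: "list_sign (xs @ c # ys @ d # zs) =
      (-1) ^ length xs * (-1) ^ length (xs @ ys) * cmp c d * cmp_prod c ?S * cmp_prod d ?S * list_sign (xs @ ys @ zs)"
    if "distinct (xs @ c # ys @ d # zs)" for c d
  proof -
    have "list_sign (xs @ c # ys @ d # zs) =
        (-1) ^ length xs * cmp_prod c (insert d ?S) * list_sign ((xs @ ys) @ d # zs)"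
      using list_sign_delete[OF that] by (simp add: Un_assoc)
    also have "list_sign ((xs @ ys) @ d # zs) = (-1) ^ length (xs @ ys) * cmp_prod d ?S * list_sign (xs @ ys @ zs)"
      using that by (subst list_sign_delete) auto
    also have "cmp_prod c (insert d ?S) = cmp c d * cmp_prod c ?S"
      using that by (intro cmp_prod_insert) auto
    finally show ?thesis by simp
  qed
  show ?thesis using expand[of a b] expand[of b a] assms cmp_flip[of a b] by auto
qed

lemma list_sign_transpose:
  assumes "distinct xs" "a \<in> set xs" "b \<in> set xs" "a \<noteq> b"
  shows "list_sign (map (Transposition.transpose a b) xs) = - list_sign xs"
proof -
  have *: "list_sign (map (Transposition.transpose a b) (ps @ c # qs @ d # rs)) = - list_sign (ps @ c # qs @ d # rs)"
    if "distinct (ps @ c # qs @ d # rs)" "{c, d} = {a, b}" for ps qs rs c d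
  proof -
    have same: "map (Transposition.transpose a b) ts = ts" if "a \<notin> set ts" "b \<notin> set ts" for ts
      by (rule map_idI) (use that in \<open>metis transpose_apply_other\<close>)
    have "map (Transposition.transpose a b) (ps @ c # qs @ d # rs) = ps @ d # qs @ c # rs"
      using that by (auto simp: same doubleton_eq_iff)
    then show ?thesis using list_sign_swap[OF that(1)] by simp
  qed
  obtain ps qs where xs: "xs = ps @ a # qs" using assms(2) by (meson split_list)
  then consider "b \<in> set ps" | "b \<in> set qs" using assms by auto
  then show ?thesis
  proof cases
    case 1
    then obtain p1 p2 where "ps = p1 @ b # p2" by (meson split_list)
    then show ?thesis using *[of p1 b p2 a qs] xs assms(1) by auto
  next
    case 2
    then obtain p1 p2 where "qs = p1 @ b # p2" by (meson split_list)
    then show ?thesis using *[of ps a p1 b p2] xs assms(1) by auto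
  qed
qed

lemma list_sign_map_permutes:
  assumes "distinct xs" "p permutes set xs"
  shows "list_sign (map p xs) = sign p * list_sign xs"
  using assms(2) finite_set[of xs]
proof (induction rule: permutes_induct)
  case (swap a b p)
  have fin: "permutation p" "permutation (Transposition.transpose a b)"
    using swap.hyps permutation_permutes finite_set by (auto intro: permutation_swap_id)
  have set: "set (map p xs) = set xs" using swap.hyps by (simp add: permutes_image)
  have dist: "distinct (map p xs)"
    using assms(1) swap.hyps by (simp add: distinct_map permutes_inj_on)
  have "list_sign (map (Transposition.transpose a b \<circ> p) xs) =
      list_sign (map (Transposition.transpose a b) (map p xs))" by simp
  also have "\<dots> = - list_sign (map p xs)"
    using dist set swap.hyps by (intro list_sign_transpose) auto
  finally have flip: "list_sign (map (Transposition.transpose a b \<circ> p) xs) = - list_sign (map p xs)" .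
  have sg: "sign (Transposition.transpose a b \<circ> p) = - sign p"
    unfolding sign_compose[OF fin(2,1)] using swap.hyps by (simp add: sign_swap_id)
  show ?case unfolding flip sg swap.IH by simp
qed (simp add: sign_id)

lemma list_sign_abs:
  assumes "inj_on g (set xs)" "distinct xs"
  shows "\<bar>list_sign xs\<bar> = 1"
  using assms
proof (induction xs)
  case (Cons x xs)
  then have "\<bar>cmp_prod x (set xs)\<bar> = 1" by (intro cmp_prod_abs[OF Cons.prems(1)]) auto
  then show ?case using Cons by (simp add: abs_mult)
qed simp

lemma ordering_sign_eq:
  assumes inj: "inj_on g (set xs)" and dist: "distinct xs" "distinct ys" and set: "set xs = set ys"
  shows "ordering_sign xs ys = list_sign xs * list_sign ys"
proof -
  have len: "length xs = length ys" using dist set by (metis distinct_card)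
  define p where "p = (\<lambda>x. case map_of (zip xs ys) x of Some y \<Rightarrow> y | None \<Rightarrow> x)"
  have map: "map p xs = ys"
    by (rule nth_equalityI) (use len dist in \<open>auto simp: p_def map_of_zip_nth\<close>)
  have "p ` set xs = set xs" using map set by (metis set_map)
  then have "bij_betw p (set xs) (set xs)"
    by (simp add: bij_betw_def finite_surj_inj[OF finite_set] eq_card_imp_inj_on)
  moreover have "p x = x" if "x \<notin> set xs" for x
  proof -
    have "map_of (zip xs ys) x = None" using that len by (simp add: map_of_zip_is_None)
    then show ?thesis by (simp add: p_def)
  qed
  ultimately have perm: "p permutes set xs" by (rule bij_imp_permutes)
  have "(THE p. p permutes set xs \<and> map p xs = ys) = p"
  proof (rule the_equality)
    fix p' assume p': "p' permutes set xs \<and> map p' xs = ys"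
    then have "map p' xs = map p xs" using map by simp
    then have "\<forall>x\<in>set xs. p' x = p x" by simp
    then show "p' = p" using p' perm by (metis ext permutes_not_in)
  qed (use perm map in auto)
  then have "ordering_sign xs ys = sign p" by (simp add: ordering_sign_def)
  moreover have "list_sign ys = sign p * list_sign xs"
    using list_sign_map_permutes[OF dist(1) perm] map by simp
  moreover have "list_sign xs * list_sign xs = 1"
    using list_sign_abs[OF inj dist(1)] by (metis abs_mult_self_eq mult_1)
  ultimately show ?thesis by (simp add: mult.left_commute)
qed

text \<open>
Up to factors that depend on the facet alone or on the ridge alone, the incidence is the comparison
product of the omitted vertex.
\<close>

lemma incidence_face:
  assumes X: "orientation X ori" "F \<in> X" "F - {v} \<in> X" and v: "v \<in> F" and inj: "inj_on g F"
  shows "incidence ori F (F - {v}) =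
    of_int (list_sign (ori F) * list_sign (ori (F - {v})) * cmp_prod v (F - {v}))"
proof -
  let ?xs = "ori F"
  have F: "distinct ?xs" "set ?xs = F" and t: "distinct (ori (F - {v}))" "set (ori (F - {v})) = F - {v}"
    using X by (auto simp: orientation_def)
  obtain as bs where xs: "?xs = as @ v # bs" using v F(2) by (metis split_list)
  have del: "set (take j ?xs @ drop (Suc j) ?xs) = F - {?xs ! j}" if "j < length ?xs" for j
  proof -
    have e: "?xs = take j ?xs @ ?xs ! j # drop (Suc j) ?xs" using that by (rule id_take_nth_drop)
    have "distinct (take j ?xs @ ?xs ! j # drop (Suc j) ?xs)" unfolding e[symmetric] by (rule F(1))
    moreover have "set (take j ?xs @ ?xs ! j # drop (Suc j) ?xs) = F" unfolding e[symmetric] by (rule F(2))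
    ultimately show ?thesis by auto
  qed
  have lookup: "Poly_Mapping.lookup ((-1) ^ j *\<^sub>R oriented_simplex ori (take j ?xs @ drop (Suc j) ?xs)) (F - {v})
      = (if j = length as then (-1) ^ length as * of_int (ordering_sign (as @ bs) (ori (F - {v}))) else 0)"
    if "j < length ?xs" for j
  proof (cases "j = length as")
    case True
    have "set as \<union> set bs = F - {v}" using F xs by auto
    then show ?thesis using True xs by (simp add: oriented_simplex_def lookup_scaleR)
  next
    case False
    have "?xs ! length as = v" by (simp add: xs)
    then have "?xs ! j \<noteq> v" using False that F(1) xs nth_eq_iff_index_eq[of ?xs j "length as"] by auto
    moreover have "?xs ! j \<in> F" using that F(2) nth_mem by blast
    ultimately have "F - {?xs ! j} \<noteq> F - {v}" using v by auto
    then show ?thesis using False del[OF that] by (simp add: oriented_simplex_def lookup_single lookup_scaleR)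
  qed
  have "incidence ori F (F - {v}) = (\<Sum>j<length ?xs.
      if j = length as then (-1) ^ length as * of_int (ordering_sign (as @ bs) (ori (F - {v}))) else 0)"
    unfolding incidence_def boundary_simplex_def lookup_sum by (intro sum.cong refl lookup) simp
  also have "\<dots> = of_int ((-1) ^ length as * ordering_sign (as @ bs) (ori (F - {v})))"
    using xs by simp
  also have "ordering_sign (as @ bs) (ori (F - {v})) = list_sign (as @ bs) * list_sign (ori (F - {v}))"
    using F t xs by (intro ordering_sign_eq inj_on_subset[OF inj]) auto
  also have "(-1) ^ length as * (list_sign (as @ bs) * list_sign (ori (F - {v}))) =
      list_sign (ori F) * list_sign (ori (F - {v})) * cmp_prod v (F - {v})"
  proof -
    have S: "set as \<union> set bs = F - {v}" using F xs by auto
    have "list_sign (ori F) = (-1) ^ length as * cmp_prod v (F - {v}) * list_sign (as @ bs)"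
      using list_sign_delete[of as v bs] F(1) xs S by simp
    moreover have "cmp_prod v (F - {v}) * cmp_prod v (F - {v}) = 1"
      using cmp_prod_abs[OF inj v, of "F - {v}"] by (metis Diff_iff Diff_subset abs_mult_self_eq mult_1 singletonI)
    ultimately show ?thesis by (simp add: mult_ac)
  qed
  finally show ?thesis .
qed

end

lemma incidence_nonface:
  assumes "orientation X ori" "F \<in> X" "\<And>v. v \<in> F \<Longrightarrow> t \<noteq> F - {v}"
  shows "incidence ori F t = 0"
proof -
  let ?xs = "ori F"
  have F: "distinct ?xs" "set ?xs = F" using assms by (auto simp: orientation_def)
  have "Poly_Mapping.lookup ((-1) ^ j *\<^sub>R oriented_simplex ori (take j ?xs @ drop (Suc j) ?xs)) t = 0"
    if "j < length ?xs" for j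
  proof -
    have e: "?xs = take j ?xs @ ?xs ! j # drop (Suc j) ?xs" using that by (rule id_take_nth_drop)
    have "distinct (take j ?xs @ ?xs ! j # drop (Suc j) ?xs)" unfolding e[symmetric] by (rule F(1))
    moreover have "set (take j ?xs @ ?xs ! j # drop (Suc j) ?xs) = F" unfolding e[symmetric] by (rule F(2))
    ultimately have "set (take j ?xs @ drop (Suc j) ?xs) = F - {?xs ! j}" "?xs ! j \<in> F" by auto
    then show ?thesis using assms(3)[of "?xs ! j"] by (auto simp: oriented_simplex_def lookup_single lookup_scaleR)
  qed
  then show ?thesis unfolding incidence_def boundary_simplex_def lookup_sum by (intro sum.neutral) simp
qed

section \<open>Eigenvalue lists of symmetric matrices\<close>

text \<open>
The orthogonal matrix of eigenvectors conjugates \<open>A\<close> to a diagonal matrix.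
\<close>

lemma proots_char_poly_eigenbasis:
  assumes A: "A \<in> carrier_mat n n"
    and on: "orthonormal_on {..<n} {..<n} u"
    and eig: "\<And>i s. i < n \<Longrightarrow> s < n \<Longrightarrow> mat_op {..<n} (\<lambda>s t. A $$ (s, t)) (u i) s = l i * u i s"
  shows "proots (char_poly A) = mset (map l [0..<n])"
proof -
  define U where "U = mat n n (\<lambda>(i, j). u j i)"
  define D where "D = mat n n (\<lambda>(i, j). if i = j then l i else 0)"
  have carr: "U \<in> carrier_mat n n" "D \<in> carrier_mat n n" by (simp_all add: U_def D_def)
  have UU: "transpose_mat U * U = 1\<^sub>m n"
  proof (rule eq_matI)
    fix i j assume ij: "i < dim_row (1\<^sub>m n :: real mat)" "j < dim_col (1\<^sub>m n :: real mat)"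
    then have "(transpose_mat U * U) $$ (i, j) = ip {..<n} (u i) (u j)"
      by (auto simp: U_def scalar_prod_def ip_def lessThan_atLeast0 intro!: sum.cong)
    then show "(transpose_mat U * U) $$ (i, j) = 1\<^sub>m n $$ (i, j)"
      using ij orthonormal_onD[OF on, of i j] by auto
  qed (simp_all add: U_def)
  have UU': "U * transpose_mat U = 1\<^sub>m n"
    by (rule mat_mult_left_right_inverse[OF _ _ UU]) (use carr in auto)
  have "A * U = U * D"
  proof (rule eq_matI)
    fix i j assume ij: "i < dim_row (U * D)" "j < dim_col (U * D)"
    then have ij': "i < n" "j < n" using carr by auto
    have "(A * U) $$ (i, j) = mat_op {..<n} (\<lambda>s t. A $$ (s, t)) (u j) i"
      using ij' A by (auto simp: U_def scalar_prod_def mat_op_def lessThan_atLeast0 intro!: sum.cong)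
    also have "\<dots> = (\<Sum>k<n. if k = j then u k i * l k else 0)" using eig[OF ij'(2,1)] ij' by (simp add: mult.commute)
    also have "\<dots> = (\<Sum>k<n. u k i * (if k = j then l k else 0))"
      by (intro sum.cong refl) simp
    also have "\<dots> = (U * D) $$ (i, j)"
      using ij' by (auto simp: U_def D_def scalar_prod_def lessThan_atLeast0 intro!: sum.cong)
    finally show "(A * U) $$ (i, j) = (U * D) $$ (i, j)" .
  qed (use A carr in auto)
  then have "A * U * transpose_mat U = U * D * transpose_mat U" by simp
  moreover have "A * U * transpose_mat U = A"
    using A carr UU' by (subst assoc_mult_mat[of _ n n _ n _ n]) auto
  ultimately have "similar_mat A D"
    unfolding similar_mat_def using A carr UU UU'
    by (intro exI[of _ U] exI[of _ "transpose_mat U"] similar_mat_witI[of _ _ n]) auto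
  then have "char_poly A = char_poly D" by (rule char_poly_similar)
  also have "\<dots> = (\<Prod>a\<leftarrow>diag_mat D. [:- a, 1:])"
    by (rule char_poly_upper_triangular[OF carr(2)]) (auto simp: D_def)
  also have "diag_mat D = map l [0..<n]"
    by (auto simp: diag_mat_def D_def intro!: nth_equalityI)
  finally have cp: "char_poly A = (\<Prod>a\<leftarrow>map l [0..<n]. [:- a, 1:])" .
  have "proots (\<Prod>a\<leftarrow>xs. [:- a, 1:]) = mset xs" for xs :: "real list"
  proof (induction xs)
    case (Cons x xs)
    have "(\<Prod>a\<leftarrow>xs. [:- a, 1:]) \<noteq> (0 :: real poly)" by (auto simp: prod_list_zero_iff)
    then have "proots ([:- x, 1:] * (\<Prod>a\<leftarrow>xs. [:- a, 1:])) = proots [:- x, 1:] + proots (\<Prod>a\<leftarrow>xs. [:- a, 1:])"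
      by (intro proots_mult) auto
    then show ?case using Cons.IH by (simp only: list.map prod_list.Cons proots_linear_factor) simp
  qed simp
  then show ?thesis unfolding cp .
qed

lemma symmetric_eigenvalues_desc:
  assumes A: "A \<in> carrier_mat n n" and sym: "\<And>s t. s < n \<Longrightarrow> t < n \<Longrightarrow> A $$ (s, t) = A $$ (t, s)"
  shows "\<exists>u l. orthonormal_on {..<n} {..<n} u \<and>
    (\<forall>i<n. \<forall>s<n. mat_op {..<n} (\<lambda>s t. A $$ (s, t)) (u i) s = l i * u i s) \<and>
    eigenvalues_desc A = map l [0..<n] \<and> (\<forall>i j. i \<le> j \<longrightarrow> j < n \<longrightarrow> l j \<le> l i)"
proof -
  have "\<exists>u' l'. (\<forall>i<0. u' i = (\<lambda>_. 0) \<and> l' i = (0::real)) \<and> orthonormal_on {..<n} {..<card {..<n}} u' \<and>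
     (\<forall>i<card {..<n}. \<forall>s\<in>{..<n}. mat_op {..<n} (\<lambda>s t. A $$ (s, t)) (u' i) s = l' i * u' i s)"
    by (rule extend_to_eigenbasis) (auto simp: sym orthonormal_on_def)
  then obtain u0 l0 where on0: "orthonormal_on {..<n} {..<n} u0"
    and eig0: "\<forall>i<n. \<forall>s\<in>{..<n}. mat_op {..<n} (\<lambda>s t. A $$ (s, t)) (u0 i) s = l0 i * u0 i s"
    by auto
  define es where "es = eigenvalues_desc A"
  have "proots (char_poly A) = mset (map l0 [0..<n])"
    by (rule proots_char_poly_eigenbasis[OF A on0]) (use eig0 in auto)
  then have "es = rev (sort (map l0 [0..<n]))"
    by (simp only: es_def eigenvalues_desc_def sorted_list_of_multiset_mset)
  then have mset: "mset es = mset (map l0 [0..<n])" and desc: "sorted (rev es)" by simp_all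
  obtain p where p: "p permutes {..<n}" "permute_list p (map l0 [0..<n]) = es"
    using mset_eq_permutation[OF mset] by auto
  define u l where "u = u0 \<circ> p" and "l = l0 \<circ> p"
  have pn: "p i < n" if "i < n" for i using permutes_in_image[OF p(1)] that by auto
  have "orthonormal_on {..<n} {..<n} u"
    using on0 pn permutes_inj[OF p(1)] by (auto simp: orthonormal_on_def u_def inj_def)
  moreover have es: "es = map l [0..<n]"
    using pn by (subst p(2)[symmetric]) (auto simp: permute_list_def l_def)
  moreover have "l j \<le> l i" if "i \<le> j" "j < n" for i j
  proof -
    have "sorted_wrt (\<ge>) es" using desc by (simp add: sorted_wrt_rev)
    then have "es ! j \<le> es ! i" using that es by (cases "i = j") (auto simp: sorted_wrt_iff_nth_less)
    then show ?thesis using that es by simp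
  qed
  ultimately show ?thesis
    using eig0 pn by (intro exI[of _ u] exI[of _ l]) (auto simp: es_def u_def l_def)
qed


section \<open>Dimension of the top homology\<close>

text \<open>
Cosets of the zero subspace are singletons, so the quotient is the space itself in disguise.
\<close>

lemma quotient_zero_simps:
  fixes S :: "'b::real_vector set"
  shows "carrier (quotient_module (subspace_module S) {0}) = (\<lambda>x. {x}) ` S"
    and "add (quotient_module (subspace_module S) {0}) {x} {y} = {x + y}"
    and "zero (quotient_module (subspace_module S) {0}) = {0}"
    and "module.smult (quotient_module (subspace_module S) {0}) a {x} = {a *\<^sub>R x}"
  by (auto simp: quotient_module_def subspace_module_def A_RCOSETS_def' a_r_coset_def' set_add_def')

lemma vectorspace_quotient_zero:
  fixes S :: "'b::real_vector set"
  assumes "0 \<in> S" "\<And>x y. x \<in> S \<Longrightarrow> y \<in> S \<Longrightarrow> x + y \<in> S" "\<And>a x. x \<in> S \<Longrightarrow> a *\<^sub>R x \<in> S"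
  shows "vectorspace (class_ring :: real ring) (quotient_module (subspace_module S) {0})"
proof -
  let ?Q = "quotient_module (subspace_module S) {0}"
  note simps = quotient_zero_simps
  have neg: "- x \<in> S" if "x \<in> S" for x using assms(3)[OF that, of "-1"] by simp
  have "abelian_group ?Q"
  proof (rule abelian_groupI)
    fix x assume "x \<in> carrier ?Q"
    then obtain y where "x = {y}" "y \<in> S" by (auto simp: simps)
    then show "\<exists>y\<in>carrier ?Q. y \<oplus>\<^bsub>?Q\<^esub> x = \<zero>\<^bsub>?Q\<^esub>"
      using neg by (intro bexI[of _ "{- y}"]) (auto simp: simps)
  qed (auto simp: simps assms algebra_simps)
  moreover have "field (class_ring :: real ring)" by (rule class_field)
  ultimately show ?thesis
    unfolding vectorspace_def
    by (intro conjI moduleI field.axioms) 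
      (auto simp: simps assms algebra_simps field_def domain_def)
qed

lemma dim_quotient_zero:
  fixes S :: "'b::real_vector set"
  assumes S: "0 \<in> S" "\<And>x y. x \<in> S \<Longrightarrow> y \<in> S \<Longrightarrow> x + y \<in> S" "\<And>a x. x \<in> S \<Longrightarrow> a *\<^sub>R x \<in> S"
    and I: "finite I" and e: "\<And>i. i \<in> I \<Longrightarrow> e i \<in> S"
    and gen: "\<And>x. x \<in> S \<Longrightarrow> \<exists>c. x = (\<Sum>i\<in>I. c i *\<^sub>R e i)"
    and ind: "\<And>c. (\<Sum>i\<in>I. c i *\<^sub>R e i) = 0 \<Longrightarrow> \<forall>i\<in>I. c i = 0"
  shows "vectorspace.dim (class_ring :: real ring) (quotient_module (subspace_module S) {0}) = card I"
proof -
  define Q where "Q = quotient_module (subspace_module S) {0}"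
  note simps = quotient_zero_simps[of S, folded Q_def]
  interpret vectorspace "class_ring :: real ring" Q
    unfolding Q_def by (rule vectorspace_quotient_zero[OF S])
  define h where "h = (\<lambda>i. {e i})"
  have inj: "inj_on h I"
  proof (rule inj_onI, rule ccontr)
    fix i j assume ij: "i \<in> I" "j \<in> I" "h i = h j" "i \<noteq> j"
    have "(\<Sum>k\<in>I. ((if k = i then 1 else 0) - (if k = j then 1 else 0)) *\<^sub>R e k) = e i - e j"
      using I ij by (simp add: scaleR_left_diff_distrib sum_subtractf if_distrib[of "\<lambda>c. c *\<^sub>R _"] cong: if_cong)
    then show False using ind[of "\<lambda>k. (if k = i then 1 else 0) - (if k = j then 1 else 0)"] ij
      by (auto simp: h_def)
  qed
  have hQ: "h ` I \<subseteq> carrier Q" using e by (auto simp: h_def simps)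
  have lc: "lincomb a (h ` J) = {\<Sum>i\<in>J. a (h i) *\<^sub>R e i}" if "J \<subseteq> I" for a J
  proof -
    have "finite J" using that I finite_subset by auto
    then show ?thesis using that
    proof (induction J)
      case empty
      then show ?case by (simp add: lincomb_def simps)
    next
      case (insert j J)
      have S_J: "(\<Sum>i\<in>J'. c i *\<^sub>R e i) \<in> S" if "J' \<subseteq> I" for J' c
        using that finite_subset[OF that I] S e by (induction J' rule: infinite_finite_induct) auto
      have "h j \<notin> h ` J" using inj insert.prems insert.hyps by (auto simp: inj_on_def)
      moreover have "a v \<odot>\<^bsub>Q\<^esub> v \<in> carrier Q" if "v \<in> h ` insert j J" for v
        using that hQ insert.prems by (intro smult_closed) auto
      ultimately have "lincomb a (h ` insert j J) = a (h j) \<odot>\<^bsub>Q\<^esub> h j \<oplus>\<^bsub>Q\<^esub> lincomb a (h ` J)"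
        unfolding lincomb_def image_insert using insert.hyps
        by (subst finsum_insert) auto
      also have "\<dots> = {(\<Sum>i\<in>insert j J. a (h i) *\<^sub>R e i)}"
        using insert by (simp add: h_def simps)
      finally show ?case .
    qed
  qed
  have "gen_set (h ` I)"
  proof
    show "span (h ` I) \<subseteq> carrier Q" using hQ by (rule span_is_subset2)
    show "carrier Q \<subseteq> span (h ` I)"
    proof
      fix X assume "X \<in> carrier Q"
      then obtain x where x: "X = {x}" "x \<in> S" by (auto simp: simps)
      obtain c where c: "x = (\<Sum>i\<in>I. c i *\<^sub>R e i)" using gen[OF x(2)] by auto
      have "lincomb (\<lambda>v. c (the_inv_into I h v)) (h ` I) = X"
        using lc[of I] inj unfolding x c by (simp add: the_inv_into_f_f)
      then show "X \<in> span (h ` I)"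
        using I unfolding span_def by (force simp: class_ring_simps)
    qed
  qed
  moreover have "lin_indpt (h ` I)"
  proof
    assume "lin_dep (h ` I)"
    then obtain A a v where A: "finite A" "A \<subseteq> h ` I" "lincomb a A = \<zero>\<^bsub>Q\<^esub>" "v \<in> A" "a v \<noteq> 0"
      unfolding lin_dep_def by auto
    obtain J where J: "J \<subseteq> I" "A = h ` J" using A(2) by (meson subset_imageE)
    have "(\<Sum>i\<in>J. a (h i) *\<^sub>R e i) = 0" using lc[OF J(1), of a] A(3) J(2) by (simp add: simps)
    moreover have "(\<Sum>i\<in>I. (if i \<in> J then a (h i) else 0) *\<^sub>R e i) = (\<Sum>i\<in>J. a (h i) *\<^sub>R e i)"
      using I J(1) by (intro sum.mono_neutral_cong_right) auto
    ultimately have "\<forall>i\<in>I. (if i \<in> J then a (h i) else 0) = 0" by (intro ind) simp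
    moreover obtain i where "i \<in> J" "v = h i" using A(4) J(2) by blast
    ultimately show False using A(5) J(1) by fastforce
  qed
  ultimately have "basis (h ` I)" using hQ by (simp add: basis_def)
  then have "dim = card (h ` I)" using I by (intro dim_basis) auto
  then show ?thesis using inj by (simp add: card_image Q_def)
qed

section \<open>The eigenvalue sums of a complex\<close>

lemma mat_op_matrix_cong:
  "(\<And>s t. s \<in> S \<Longrightarrow> t \<in> S \<Longrightarrow> a s t = a' s t) \<Longrightarrow> s \<in> S \<Longrightarrow> mat_op S a x s = mat_op S a' x s"
  by (simp add: mat_op_def)

locale oriented_complex =
  fixes V :: "'a set" and X :: "'a set set" and ori :: "'a set \<Rightarrow> 'a list" and r :: int
  assumes complex: "simplicial_complex V X" and ori: "orientation X ori"
    and dim: "complex_dim X = r" and r2: "r \<ge> 2"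
begin

definition facets :: "'a set set" where "facets = simplices X r"
definition ridges :: "'a set set" where "ridges = simplices X (r - 1)"
definition inc :: "'a set \<Rightarrow> 'a set \<Rightarrow> real" where "inc t F = incidence ori F t"

lemma finite_V: "finite V" and finite_X: "finite X" and sub_V: "F \<in> X \<Longrightarrow> F \<subseteq> V"
  and down: "F \<in> X \<Longrightarrow> t \<subseteq> F \<Longrightarrow> t \<in> X" and empty_X: "{} \<in> X"
  using complex finite_subset[of X "Pow V"] unfolding simplicial_complex_def by auto

lemma card_le: "F \<in> X \<Longrightarrow> int (card F) \<le> r + 1"
proof -
  assume "F \<in> X"
  then have "int (card F) - 1 \<le> Max ((\<lambda>\<sigma>. int (card \<sigma>) - 1) ` X)"
    using finite_X by (intro Max_ge) auto
  then show ?thesis using dim by (simp add: complex_dim_def)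
qed

text \<open>
There are no chains above dimension \<open>r\<close>, so the top homology consists of the cycles.
\<close>

lemma top_empty: "simplices X (r + 1) = {}"
  using card_le by (force simp: simplices_def)

lemma facets_iff: "F \<in> facets \<longleftrightarrow> F \<in> X \<and> card F = Suc (nat r)"
  and ridges_iff: "t \<in> ridges \<longleftrightarrow> t \<in> X \<and> card t = nat r"
  using r2 by (auto simp: facets_def ridges_def simplices_def)

lemma finite_facets: "finite facets" and finite_ridges: "finite ridges"
  using finite_X finite_subset by (auto simp: facets_def ridges_def simplices_def)

lemma ridge_of_facet: "F \<in> facets \<Longrightarrow> v \<in> F \<Longrightarrow> F - {v} \<in> ridges"
  using down by (auto simp: facets_iff ridges_iff)

lemma ridges_nonempty: "ridges \<noteq> {}"
proof -
  have "Max ((\<lambda>\<sigma>. int (card \<sigma>) - 1) ` X) \<in> (\<lambda>\<sigma>. int (card \<sigma>) - 1) ` X"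
    using finite_X empty_X by (intro Max_in) auto
  then obtain F where "F \<in> X" "int (card F) - 1 = r"
    using dim by (auto simp: complex_dim_def)
  then have F: "F \<in> facets" using r2 by (auto simp: facets_iff)
  then have "F \<noteq> {}" by (auto simp: facets_iff)
  then show ?thesis using ridge_of_facet[OF F] by blast
qed

lemma inc_nonridge: "F \<in> facets \<Longrightarrow> t \<notin> ridges \<Longrightarrow> inc t F = 0"
  unfolding inc_def using ridge_of_facet
  by (intro incidence_nonface[OF ori]) (auto simp: facets_iff)

text \<open>
The lower incidence of \<open>t\<close> and \<open>p\<close> is given by the comparison product of the one vertex in \<open>t - p\<close>;
as a product over \<open>t - p\<close> it is a sign for every \<open>p \<subseteq> t\<close>. Omitting two vertices in the two possible
orders then gives expressions that differ in a single comparison, which is antisymmetric.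
\<close>

lemma signed: "\<exists>\<eta>. signed_facets facets ridges (nat r) inc \<eta>"
proof -
  obtain g :: "'a \<Rightarrow> nat" where g: "inj_on g V"
    using finite_V by (meson finite_imp_inj_to_nat_seg)
  have gF: "inj_on g F" if "F \<in> X" for F using inj_on_subset[OF g sub_V[OF that]] .
  have ls: "\<bar>list_sign g (ori F)\<bar> = 1" if "F \<in> X" for F
    using list_sign_abs[of g "ori F"] gF[OF that] ori that by (simp add: orientation_def)
  have inc: "inc (F - {v}) F = of_int (list_sign g (ori F) * list_sign g (ori (F - {v})) * cmp_prod g v (F - {v}))"
    if "F \<in> facets" "v \<in> F" for F v
    unfolding inc_def using that ridge_of_facet[OF that]
    by (intro incidence_face[OF ori]) (auto simp: facets_iff ridges_iff gF)
  define \<eta> :: "'a set \<Rightarrow> 'a set \<Rightarrow> real" where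
    "\<eta> = (\<lambda>t p. of_int (list_sign g (ori t) * (\<Prod>w\<in>t - p. cmp_prod g w p)))"
  have "signed_facets facets ridges (nat r) inc \<eta>"
  proof
    show "finite facets" "finite ridges" "2 \<le> nat r"
      using finite_facets finite_ridges r2 by auto
  next
    fix F v assume F: "F \<in> facets" "v \<in> F"
    show "F - {v} \<in> ridges" by (rule ridge_of_facet[OF F])
    have "F \<in> X" "F - {v} \<in> X" using F down by (auto simp: facets_iff)
    moreover have "\<bar>cmp_prod g v (F - {v})\<bar> = 1"
      using F gF by (intro cmp_prod_abs[of g F]) (auto simp: facets_iff)
    ultimately have "\<bar>list_sign g (ori F) * list_sign g (ori (F - {v})) * cmp_prod g v (F - {v})\<bar> = 1"
      by (simp add: abs_mult ls)
    then show "\<bar>inc (F - {v}) F\<bar> = 1" unfolding inc[OF F] by (metis of_int_1 of_int_abs)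
  next
    fix F t assume "F \<in> facets" "t \<in> ridges" "\<not> t \<subseteq> F"
    then show "inc t F = 0"
      unfolding inc_def by (intro incidence_nonface[OF ori]) (auto simp: facets_iff)
  next
    fix t p assume t: "t \<in> ridges" "p \<subseteq> t"
    then have tX: "t \<in> X" by (simp add: ridges_iff)
    have "\<bar>\<Prod>w\<in>t - p. cmp_prod g w p\<bar> = 1"
      unfolding abs_prod using t gF[OF tX] by (intro prod.neutral ballI cmp_prod_abs[of g t]) auto
    then have "\<bar>list_sign g (ori t) * (\<Prod>w\<in>t - p. cmp_prod g w p)\<bar> = 1"
      by (simp add: abs_mult ls[OF tX])
    then show "\<bar>\<eta> t p\<bar> = 1" unfolding \<eta>_def by (metis of_int_1 of_int_abs)
  next
    fix F v w assume F: "F \<in> facets" and vw: "v \<in> F" "w \<in> F" "v \<noteq> w"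
    have fin: "finite F" using F by (auto simp: facets_iff intro: card_ge_0_finite)
    have half: "\<eta> (F - {v}) (F - {v, w}) * inc (F - {v}) F =
        of_int (cmp g v w * (list_sign g (ori F) * cmp_prod g v (F - {v, w}) * cmp_prod g w (F - {v, w})))"
      if vw: "v \<in> F" "w \<in> F" "v \<noteq> w" for v w
    proof -
      have "F - {v} - (F - {v, w}) = {w}" using vw by auto
      moreover have "F - {v} = insert w (F - {v, w})" using vw by auto
      then have "cmp_prod g v (F - {v}) = cmp g v w * cmp_prod g v (F - {v, w})"
        using fin by (simp add: cmp_prod_insert)
      moreover have "list_sign g (ori (F - {v})) * list_sign g (ori (F - {v})) = 1"
        using ls[of "F - {v}"] F down[of F "F - {v}"] by (metis Diff_subset abs_mult_self_eq facets_iff mult_1)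
      ultimately have "(list_sign g (ori (F - {v})) * (\<Prod>x\<in>F - {v} - (F - {v, w}). cmp_prod g x (F - {v, w}))) *
          (list_sign g (ori F) * list_sign g (ori (F - {v})) * cmp_prod g v (F - {v})) =
          cmp g v w * (list_sign g (ori F) * cmp_prod g v (F - {v, w}) * cmp_prod g w (F - {v, w}))"
        by (simp add: mult_ac)
      then show ?thesis unfolding \<eta>_def inc[OF F vw(1)] of_int_mult[symmetric] by (simp only:)
    qed
    have "F - {w, v} = F - {v, w}" by auto
    then show "\<eta> (F - {v}) (F - {v, w}) * inc (F - {v}) F + \<eta> (F - {w}) (F - {v, w}) * inc (F - {w}) F = 0"
      using half[OF vw] half[OF vw(2,1)] vw(3) cmp_flip[of g w v] by (simp add: mult_ac)
  qed (auto simp: facets_iff ridges_iff)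
  then show ?thesis by blast
qed

definition fdeg :: "'a set \<Rightarrow> nat" where
  "fdeg t = card {F\<in>facets. t \<subseteq> F}"

lemma up_degree_eq: "up_degree X (r - 1) t = fdeg t"
  by (simp add: up_degree_def fdeg_def facets_def)

lemma conj_degree_sum: "(\<Sum>i=1..q. real (conj_degree X (r - 1) i)) = (\<Sum>t\<in>ridges. real (min q (fdeg t)))"
proof -
  have "real (conj_degree X (r - 1) i) = (\<Sum>t\<in>ridges. of_bool (i \<le> fdeg t))" for i
    using finite_ridges unfolding conj_degree_def up_degree_eq ridges_def[symmetric]
    by (simp add: sum.If_cases of_bool_def Int_def)
  then have "(\<Sum>i=1..q. real (conj_degree X (r - 1) i)) = (\<Sum>t\<in>ridges. \<Sum>i=1..q. of_bool (i \<le> fdeg t))"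
    by (simp only:) (rule sum.swap)
  also have "\<dots> = (\<Sum>t\<in>ridges. real (min q (fdeg t)))"
  proof (intro sum.cong refl)
    fix t
    have "{1..q} \<inter> {i. i \<le> fdeg t} = {1..min q (fdeg t)}" by auto
    then show "(\<Sum>i=1..q. of_bool (i \<le> fdeg t)) = real (min q (fdeg t))"
      by (simp add: sum.If_cases of_bool_def)
  qed
  finally show ?thesis .
qed

text \<open>
The singular value decomposition of the boundary matrix, with \<open>p\<close> its rank. The list of eigenvalues is weakly
decreasing and its entries after the first \<open>p\<close> are zero, so the partial sums only see the positive ones.
\<close>

lemma laplacian_singular_vectors:
  "\<exists>p l w. p \<le> card facets \<and> (\<forall>i<p. 0 < l i) \<and> orthonormal_on facets {..<p} w \<and>
    (\<forall>z. (\<Sum>t\<in>ridges. (ip facets (inc t) z)\<^sup>2) = (\<Sum>i<p. l i * (ip facets (w i) z)\<^sup>2)) \<and>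
    (\<forall>q. (\<Sum>i=1..q. laplacian_eigenvalue X ori (r - 1) i) = (\<Sum>i<min p q. l i)) \<and>
    (\<Sum>i<p. l i) = (\<Sum>t\<in>ridges. real (fdeg t))"
proof -
  define n where "n = card ridges"
  define \<tau> where "\<tau> = from_nat_into ridges"
  define L where "L = up_laplacian X ori (r - 1)"
  define b where "b = (\<lambda>s. inc (\<tau> s))"
  have bij: "bij_betw \<tau> {..<n} ridges"
    unfolding \<tau>_def n_def by (rule bij_betw_from_nat_into_finite[OF finite_ridges])
  have bijF: "bij_betw (from_nat_into facets) {..<card facets} facets"
    by (rule bij_betw_from_nat_into_finite[OF finite_facets])
  have reidx: "(\<Sum>t\<in>ridges. h t) = (\<Sum>s<n. h (\<tau> s))" for h :: "'a set \<Rightarrow> real"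
    using sum.reindex_bij_betw[OF bij, of h] by simp
  have L: "L \<in> carrier_mat n n"
    by (auto simp: L_def up_laplacian_def boundary_matrix_def face_count_def n_def ridges_def)
  have Lst: "L $$ (s, t) = ip facets (b s) (b t)" if "s < n" "t < n" for s t
  proof -
    have "L $$ (s, t) = (\<Sum>j<card facets. b s (from_nat_into facets j) * b t (from_nat_into facets j))"
      using that by (simp add: L_def up_laplacian_def boundary_matrix_def face_count_def n_def
          ridges_def[symmetric] facets_def[symmetric] scalar_prod_def b_def inc_def \<tau>_def lessThan_atLeast0)
    also have "\<dots> = ip facets (b s) (b t)"
      unfolding ip_def by (rule sum.reindex_bij_betw[OF bijF])
    finally show ?thesis .
  qed
  have Lsym: "L $$ (s, t) = L $$ (t, s)" if "s < n" "t < n" for s t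
    using Lst[OF that] Lst[OF that(2,1)] ip_commute[of facets "b s" "b t"] by simp
  obtain u l where on: "orthonormal_on {..<n} {..<n} u"
    and eigL: "\<forall>i<n. \<forall>s<n. mat_op {..<n} (\<lambda>s t. L $$ (s, t)) (u i) s = l i * u i s"
    and es: "eigenvalues_desc L = map l [0..<n]"
    and desc: "\<forall>i j. i \<le> j \<longrightarrow> j < n \<longrightarrow> l j \<le> l i"
    using symmetric_eigenvalues_desc[OF L Lsym] by blast
  have eig: "mat_op {..<n} (\<lambda>s t. ip facets (b s) (b t)) (u i) s = l i * u i s" if "i < n" "s \<in> {..<n}" for i s
  proof -
    have "mat_op {..<n} (\<lambda>s t. ip facets (b s) (b t)) (u i) s = mat_op {..<n} (\<lambda>s t. L $$ (s, t)) (u i) s"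
      using that by (intro mat_op_matrix_cong) (auto simp: Lst)
    then show ?thesis using eigL that by simp
  qed
  define w where "w = (\<lambda>i e. (1 / sqrt (l i)) * (\<Sum>s\<in>{..<n}. u i s * b s e))"
  note sv = gram_singular_vectors[of "{..<n}" facets u b l, unfolded card_lessThan, OF finite_lessThan finite_facets on]
  define p where "p = card {i. i < n \<and> 0 < l i}"
  have P: "{i. i < n \<and> 0 < l i} = {..<p}"
  proof -
    have "{i. i < n \<and> 0 < l i} \<subseteq> {..<p}"
    proof
      fix i assume i: "i \<in> {i. i < n \<and> 0 < l i}"
      then have "{..i} \<subseteq> {i. i < n \<and> 0 < l i}" using desc by (fastforce intro: less_le_trans)
      then have "card {..i} \<le> p" unfolding p_def by (intro card_mono) auto
      then show "i \<in> {..<p}" by simp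
    qed
    then show ?thesis by (intro card_subset_eq) (auto simp: p_def)
  qed
  have pn: "p \<le> n" using card_mono[of "{..<n}" "{i. i < n \<and> 0 < l i}"] by (auto simp: p_def)
  have onw: "orthonormal_on facets {..<p} w"
    unfolding w_def P[symmetric] by (rule sv(2), rule eig)
  have tr: "(\<Sum>t\<in>ridges. (ip facets (inc t) z)\<^sup>2) = (\<Sum>i<p. l i * (ip facets (w i) z)\<^sup>2)" for z
  proof -
    have "(\<Sum>s<n. (ip facets (b s) z)\<^sup>2) = (\<Sum>i<p. l i * (ip facets (w i) z)\<^sup>2)"
      unfolding w_def P[symmetric] by (rule sv(3), rule eig)
    then show ?thesis by (simp add: reidx b_def)
  qed
  have l0: "l i = 0" if "i < n" "\<not> i < p" for i
  proof -
    have "l i = ip facets (\<lambda>e. \<Sum>s<n. u i s * b s e) (\<lambda>e. \<Sum>s<n. u i s * b s e)"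
      by (rule sv(1)[OF _ that(1)], rule eig)
    then have "0 \<le> l i" using ip_self_nonneg by simp
    moreover have "\<not> 0 < l i" using that P by blast
    ultimately show ?thesis by simp
  qed
  have "(\<Sum>i=1..q. laplacian_eigenvalue X ori (r - 1) i) = (\<Sum>i<min p q. l i)" for q
  proof -
    have "(\<Sum>i=1..q. laplacian_eigenvalue X ori (r - 1) i) = (\<Sum>i<q. laplacian_eigenvalue X ori (r - 1) (Suc i))"
      by (rule sum.reindex_bij_witness[of _ Suc "\<lambda>i. i - 1"]) auto
    also have "\<dots> = (\<Sum>i<q. if i < n then l i else 0)"
      by (intro sum.cong refl) (auto simp: laplacian_eigenvalue_def L_def[symmetric] es)
    also have "\<dots> = (\<Sum>i<min p q. l i)"
      using l0 pn by (intro sum.mono_neutral_cong_right) auto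
    finally show ?thesis .
  qed
  moreover have "(\<Sum>i<p. l i) = (\<Sum>t\<in>ridges. real (fdeg t))"
  proof -
    obtain \<eta> where "signed_facets facets ridges (nat r) inc \<eta>" using signed by blast
    then interpret signed_facets facets ridges "nat r" inc \<eta> .
    have "(\<Sum>i<p. l i) = (\<Sum>i<n. l i)"
      using l0 pn by (intro sum.mono_neutral_left) auto
    also have "\<dots> = (\<Sum>s<n. ip facets (b s) (b s))"
      by (rule trace_eq_eigenvalue_sum[OF _ _ on]) (use eig in auto)
    also have "\<dots> = (\<Sum>t\<in>ridges. ip facets (inc t) (inc t))" by (simp add: reidx b_def)
    also have "\<dots> = (\<Sum>t\<in>ridges. real (fdeg t))"
      by (intro sum.cong refl) (simp add: ip_b_b deg_def fdeg_def)
    finally show ?thesis .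
  qed
  moreover have "p \<le> card facets" using card_orthonormal_le[OF finite_facets _ onw] by simp
  moreover have "\<forall>i<p. 0 < l i" using P by blast
  ultimately show ?thesis using onw tr by blast
qed

definition chain :: "('a set \<Rightarrow> real) \<Rightarrow> ('a set \<Rightarrow>\<^sub>0 real)" where
  "chain z = (\<Sum>F\<in>facets. z F *\<^sub>R Poly_Mapping.single F 1)"

lemma lookup_chain: "Poly_Mapping.lookup (chain z) F = (if F \<in> facets then z F else 0)"
  using finite_facets by (simp add: chain_def lookup_sum lookup_scaleR lookup_single when_def if_distrib cong: if_cong)

lemma lookup_boundary:
  assumes "Poly_Mapping.keys c \<subseteq> facets"
  shows "Poly_Mapping.lookup (boundary ori c) t = ip facets (inc t) (Poly_Mapping.lookup c)"
proof -
  have "Poly_Mapping.lookup (boundary ori c) t = (\<Sum>F\<in>Poly_Mapping.keys c. inc t F * Poly_Mapping.lookup c F)"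
    by (simp add: boundary_def lookup_sum lookup_scaleR inc_def incidence_def mult.commute)
  also have "\<dots> = ip facets (inc t) (Poly_Mapping.lookup c)"
    unfolding ip_def using assms finite_facets by (intro sum.mono_neutral_left) (auto simp: in_keys_iff)
  finally show ?thesis .
qed

lemma cycles_iff: "c \<in> cycles X ori r \<longleftrightarrow> Poly_Mapping.keys c \<subseteq> facets \<and>
    (\<forall>t\<in>ridges. ip facets (inc t) (Poly_Mapping.lookup c) = 0)"
proof -
  have "boundary ori c = 0 \<longleftrightarrow> (\<forall>t\<in>ridges. ip facets (inc t) (Poly_Mapping.lookup c) = 0)"
    if c: "Poly_Mapping.keys c \<subseteq> facets"
  proof -
    have "ip facets (inc t) (Poly_Mapping.lookup c) = 0" if "t \<notin> ridges" for t
      using that inc_nonridge by (simp add: ip_def)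
    then show ?thesis using lookup_boundary[OF c]
      by (metis lookup_zero poly_mapping_eqI)
  qed
  then show ?thesis by (auto simp: cycles_def chains_def facets_def)
qed

lemma boundaries_top: "boundaries X ori r = {0}"
  by (auto simp: boundaries_def chains_def top_empty boundary_def)

text \<open>
The cycles are the orthogonal complement of the \<open>p\<close> right singular vectors; completing these to an
orthonormal basis gives a basis of the cycles with \<open>card facets - p\<close> elements.
\<close>

lemma betti_eq:
  assumes p: "p \<le> card facets" and l: "\<forall>i<p. 0 < l i" and on: "orthonormal_on facets {..<p} w"
    and tr: "\<forall>z. (\<Sum>t\<in>ridges. (ip facets (inc t) z)\<^sup>2) = (\<Sum>i<p. l i * (ip facets (w i) z)\<^sup>2)"
  shows "betti X ori r = card facets - p"
proof -
  let ?f = "card facets" and ?lk = Poly_Mapping.lookup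
  obtain w' where w': "\<forall>i<p. w' i = w i" and on': "orthonormal_on facets {..<?f} w'"
    using extend_to_eigenbasis[OF finite_facets, of "\<lambda>_ _. 0" p w "\<lambda>_. 0"] on by (auto simp: mat_op_def)
  have kernel: "(\<forall>t\<in>ridges. ip facets (inc t) z = 0) \<longleftrightarrow> (\<forall>i<p. ip facets (w' i) z = 0)" for z
  proof -
    have "(\<forall>t\<in>ridges. ip facets (inc t) z = 0) \<longleftrightarrow> (\<Sum>t\<in>ridges. (ip facets (inc t) z)\<^sup>2) = 0"
      using finite_ridges by (simp add: sum_nonneg_eq_0_iff)
    also have "\<dots> \<longleftrightarrow> (\<Sum>i<p. l i * (ip facets (w i) z)\<^sup>2) = 0" using tr by simp
    also have "\<dots> \<longleftrightarrow> (\<forall>i\<in>{..<p}. l i * (ip facets (w i) z)\<^sup>2 = 0)"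
      using l by (intro sum_nonneg_eq_0_iff) (auto intro: mult_nonneg_nonneg less_imp_le)
    also have "\<dots> \<longleftrightarrow> (\<forall>i<p. ip facets (w' i) z = 0)"
    proof -
      have "l i * (ip facets (w i) z)\<^sup>2 = 0 \<longleftrightarrow> ip facets (w' i) z = 0" if "i < p" for i
        using l[rule_format, OF that] w' that by simp
      then show ?thesis by auto
    qed
    finally show ?thesis .
  qed
  have cyc: "c \<in> cycles X ori r \<longleftrightarrow> Poly_Mapping.keys c \<subseteq> facets \<and> (\<forall>i<p. ip facets (w' i) (?lk c) = 0)" for c
    unfolding cycles_iff kernel ..
  have keys_iff: "Poly_Mapping.keys c \<subseteq> facets \<longleftrightarrow> (\<forall>F. F \<notin> facets \<longrightarrow> ?lk c F = 0)" for c :: "'a set \<Rightarrow>\<^sub>0 real"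
    by (auto simp: in_keys_iff)
  have lk_chain: "ip facets z (?lk (chain z')) = ip facets z z'" for z z'
    by (rule ip_cong) (auto simp: lookup_chain)
  have comb: "?lk (\<Sum>i\<in>{p..<?f}. c i *\<^sub>R chain (w' i)) F = (if F \<in> facets then \<Sum>i\<in>{p..<?f}. c i * w' i F else 0)" for c F
    by (simp add: lookup_sum lookup_scaleR lookup_chain)
  have "betti X ori r = card {p..<?f}"
    unfolding betti_def reduced_homology_def boundaries_top
  proof (rule dim_quotient_zero[where e = "\<lambda>i. chain (w' i)"])
    show "0 \<in> cycles X ori r" by (simp add: cyc ip_def)
    show "x + y \<in> cycles X ori r" if "x \<in> cycles X ori r" "y \<in> cycles X ori r" for x y
      using that ip_add_right[of facets _ "?lk x" "?lk y"] by (simp add: cyc keys_iff lookup_add[abs_def] plus_poly_mapping.rep_eq)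
    show "a *\<^sub>R x \<in> cycles X ori r" if "x \<in> cycles X ori r" for a x
    proof -
      have "?lk (a *\<^sub>R x) = (\<lambda>F. a * ?lk x F)" by (auto simp: lookup_scaleR)
      then show ?thesis using that by (simp add: cyc keys_iff ip_scale_right)
    qed
    show "chain (w' i) \<in> cycles X ori r" if "i \<in> {p..<?f}" for i
      using that on' p by (auto simp: cyc keys_iff lookup_chain lk_chain orthonormal_onD)
    show "\<exists>c. x = (\<Sum>i\<in>{p..<?f}. c i *\<^sub>R chain (w' i))" if x: "x \<in> cycles X ori r" for x
    proof (intro exI poly_mapping_eqI)
      fix F
      show "?lk x F = ?lk (\<Sum>i\<in>{p..<?f}. ip facets (?lk x) (w' i) *\<^sub>R chain (w' i)) F"
      proof (cases "F \<in> facets")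
        case True
        have "?lk x F = (\<Sum>i<?f. ip facets (?lk x) (w' i) * w' i F)"
          using orthonormal_basis_expansion[OF finite_facets _ on' _ True] by simp
        also have "\<dots> = (\<Sum>i\<in>{p..<?f}. ip facets (?lk x) (w' i) * w' i F)"
          using x by (intro sum.mono_neutral_right) (auto simp: cyc ip_commute[of _ "?lk x"] not_le)
        finally show ?thesis using True by (simp add: comb)
      qed (use x in \<open>simp add: cyc keys_iff comb\<close>)
    qed
    show "\<forall>i\<in>{p..<?f}. c i = 0" if c: "(\<Sum>i\<in>{p..<?f}. c i *\<^sub>R chain (w' i)) = 0" for c
    proof
      fix j assume j: "j \<in> {p..<?f}"
      have "(\<Sum>i\<in>{p..<?f}. c i * w' i F) = 0" if "F \<in> facets" for F
        using comb[of c F] that by (simp add: c)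
      then have "ip facets (\<lambda>F. \<Sum>i\<in>{p..<?f}. c i * w' i F) (w' j) = 0" by (simp add: ip_def)
      moreover have "(\<Sum>i\<in>{p..<?f}. c i * ip facets (w' i) (w' j)) = (\<Sum>i\<in>{p..<?f}. if i = j then c i else 0)"
        using on' j by (intro sum.cong) (auto simp: orthonormal_onD)
      ultimately show "c j = 0" using j by (simp add: ip_sum_left)
    qed
  qed simp
  then show ?thesis by simp
qed

text \<open>
If no ridge has degree more than \<open>q\<close>, the conjugate degree sum is the full trace, and the eigenvalue
sum equals it iff no positive eigenvalue is left out, that is, iff \<open>q\<close> is at least the rank. If some ridge has
larger degree, the eigenvalue sum is strictly smaller.
\<close>

theorem eigenvalue_sum_eq_iff:
  assumes q: "q > 0"
  shows "(\<Sum>i=1..q. laplacian_eigenvalue X ori (r - 1) i) = (\<Sum>i=1..q. real (conj_degree X (r - 1) i))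
     \<longleftrightarrow> int q \<ge> max (int (face_count X r) - int (betti X ori r)) (int (max_up_degree X (r - 1)))"
proof -
  obtain p l w where p: "p \<le> card facets" and l: "\<forall>i<p. 0 < l i" and on: "orthonormal_on facets {..<p} w"
    and tr: "\<forall>z. (\<Sum>t\<in>ridges. (ip facets (inc t) z)\<^sup>2) = (\<Sum>i<p. l i * (ip facets (w i) z)\<^sup>2)"
    and sums: "\<forall>q. (\<Sum>i=1..q. laplacian_eigenvalue X ori (r - 1) i) = (\<Sum>i<min p q. l i)"
    and total: "(\<Sum>i<p. l i) = (\<Sum>t\<in>ridges. real (fdeg t))"
    using laplacian_singular_vectors by blast
  have rank: "int (face_count X r) - int (betti X ori r) = int p"
    using betti_eq[OF p l on tr] p by (simp add: face_count_def facets_def[symmetric])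
  have "up_degree X (r - 1) = fdeg" by (rule ext) (rule up_degree_eq)
  then have max_deg: "max_up_degree X (r - 1) \<le> q \<longleftrightarrow> (\<forall>t\<in>ridges. fdeg t \<le> q)"
    using finite_ridges ridges_nonempty unfolding max_up_degree_def ridges_def[symmetric] by simp
  have rhs: "int q \<ge> max (int (face_count X r) - int (betti X ori r)) (int (max_up_degree X (r - 1)))
      \<longleftrightarrow> p \<le> q \<and> (\<forall>t\<in>ridges. fdeg t \<le> q)"
    unfolding rank max_deg[symmetric] by auto
  show ?thesis
  proof (cases "\<forall>t\<in>ridges. fdeg t \<le> q")
    case True
    then have conj: "(\<Sum>i=1..q. real (conj_degree X (r - 1) i)) = (\<Sum>i<p. l i)"
      unfolding conj_degree_sum total by (intro sum.cong) auto
    have "(\<Sum>i<p. l i) = (\<Sum>i<min p q. l i) + (\<Sum>i\<in>{q..<p}. l i)"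
    proof -
      have "{..<p} = {..<min p q} \<union> {q..<p}" by auto
      then show ?thesis by (metis (no_types, lifting) finite_lessThan finite_atLeastLessThan sum.union_disjoint
          disjoint_iff lessThan_iff atLeastLessThan_iff min_less_iff_conj not_le)
    qed
    moreover have "(\<Sum>i\<in>{q..<p}. l i) = 0 \<longleftrightarrow> p \<le> q"
    proof
      assume "(\<Sum>i\<in>{q..<p}. l i) = 0"
      then have "\<forall>i\<in>{q..<p}. l i = 0"
        using l by (subst (asm) sum_nonneg_eq_0_iff) (auto intro: less_imp_le)
      then show "p \<le> q" using l by (metis atLeastLessThan_iff less_irrefl not_le order_refl)
    qed simp
    ultimately show ?thesis unfolding rhs conj using sums True by auto
  next
    case False
    then obtain t0 where t0: "t0 \<in> ridges" "q < fdeg t0" by (auto simp: not_le)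
    obtain \<eta> where "signed_facets facets ridges (nat r) inc \<eta>" using signed by blast
    then interpret signed_facets facets ridges "nat r" inc \<eta> .
    have deg: "deg = fdeg" by (simp add: deg_def fdeg_def fun_eq_iff)
    have "(\<Sum>k<min p q. \<Sum>t\<in>ridges. (ip facets (inc t) (w k))\<^sup>2) < (\<Sum>t\<in>ridges. real (min q (fdeg t)))"
      using signed_trace_strict[OF finite_lessThan orthonormal_on_subset[OF on], of "min p q" q t0] q t0
      by (simp add: deg)
    moreover have "(\<Sum>t\<in>ridges. (ip facets (inc t) (w k))\<^sup>2) = l k" if "k < p" for k
    proof -
      have "(\<Sum>i<p. l i * (ip facets (w i) (w k))\<^sup>2) = (\<Sum>i<p. if i = k then l i else 0)"
        using on that by (intro sum.cong) (auto simp: orthonormal_onD)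
      then show ?thesis using tr that by simp
    qed
    ultimately have "(\<Sum>i<min p q. l i) < (\<Sum>t\<in>ridges. real (min q (fdeg t)))" by simp
    then show ?thesis unfolding rhs conj_degree_sum using sums False by auto
  qed
qed

end

theorem corollary3:
  fixes V :: "'a set" and X :: "'a set set" and ori :: "'a set \<Rightarrow> 'a list"
    and r :: int and q :: nat
  assumes "simplicial_complex V X"
    and "orientation X ori"
    and "complex_dim X = r"
    and "r \<ge> 2"
    and "q > 0"
  shows "(\<Sum>i=1..q. laplacian_eigenvalue X ori (r - 1) i)
           = (\<Sum>i=1..q. real (conj_degree X (r - 1) i))
         \<longleftrightarrow> int q \<ge> max (int (face_count X r) - int (betti X ori r))
                          (int (max_up_degree X (r - 1)))"
proof -
  interpret oriented_complex V X ori r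
    using assms by (simp add: oriented_complex_def)
  show ?thesis using assms(5) by (rule eigenvalue_sum_eq_iff)
qed

end
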